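(* Let $\nu>0$ and $a>0$. (i) For any $0\le b\le a$, $$\lim_{t\to\infty}t^{\nu}\,P^{(\nu)}_a(I_t-I_\infty>b)=\frac{2\nu}{2^{\nu}a^{2\nu}\Gamma(\nu+1)}\int_b^a z^{2\nu-1}(z-b)^{2\nu}\,dz.$$ In particular, $$\lim_{t\to\infty}t^{\nu}\,P^{(\nu)}_a(\rho_\infty>t)=\frac{a^{2\nu}}{2^{\nu+1}\Gamma(\nu+1)}.$$ (ii) For any continuous function $g:\mathbb{R}\to\mathbb{R}$, $$\lim_{t\to\infty}t^{\nu}\Big\{E^{(\nu)}_a[g(I_\infty)]-E^{(\nu)}_a[g(I_t)]\Big\}=\frac{2\nu}{2^{\nu}a^{2\nu}\Gamma(\nu+1)}\int_0^a (a^{2\nu}-2z^{2\nu})z^{2\nu-1}g(z)\,dz.$$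
   Context: For $\mu\in\mathbb{R}$ and $x>0$, $P^{(\mu)}_x$ denotes the law on $\Omega=C([0,\infty);\mathbb{R})$ of the Bessel process with index $\mu$ (dimension $2(\mu+1)$) started at $x$, and $E^{(\mu)}_x$ the corresponding expectation; $R$ is the coordinate process on $\Omega$. For $t\ge0$, $I_t=\inf_{0\le s\le t}R_s$, and $I_\infty=\inf_{t\ge0}R_t$. Set $\rho_\infty=\inf\{t\ge0: R_t=I_\infty\}$. $\Gamma$ is the gamma function. *)

theory Defs
  imports "HOL-Probability.Probability"
begin

definition besselI :: "real \<Rightarrow> real \<Rightarrow> real" where
  "besselI nu z = (\<Sum>k. (z / 2) powr (2 * real k + nu) / (fact k * Gamma (real k + nu + 1)))"

text \<open>Transition density of the Bessel process of index nu \<ge> 0 from x > 0 to y over time t > 0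
  (Revuz--Yor): q_t(x,y) = (1/t) (y/x)^nu y exp(-(x^2+y^2)/(2t)) I_nu(xy/t) for y > 0.\<close>
definition bessel_density :: "real \<Rightarrow> real \<Rightarrow> real \<Rightarrow> real \<Rightarrow> real" where
  "bessel_density nu t x y =
     (if 0 < y then (1 / t) * (y / x) powr nu * y * exp (- (x\<^sup>2 + y\<^sup>2) / (2 * t)) * besselI nu (x * y / t)
      else 0)"

text \<open>Finite-dimensional distributions: a list of (time increment, Borel set) pairs.\<close>
fun bessel_fdd :: "real \<Rightarrow> real \<Rightarrow> (real \<times> real set) list \<Rightarrow> ennreal" where
  "bessel_fdd nu x [] = 1"
| "bessel_fdd nu x ((dt, A) # rest) =
     (\<integral>\<^sup>+ y. ennreal (bessel_density nu dt x y) * indicator A y * bessel_fdd nu y rest \<partial>lborel)"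

fun path_event :: "('w \<Rightarrow> real \<Rightarrow> real) \<Rightarrow> real \<Rightarrow> 'w \<Rightarrow> (real \<times> real set) list \<Rightarrow> bool" where
  "path_event R s w [] = True"
| "path_event R s w ((dt, A) # rest) = (R w (s + dt) \<in> A \<and> path_event R (s + dt) w rest)"

text \<open>R is a Bessel process of index nu (> 0) started at a > 0 on the probability space M:
  continuous paths on [0,oo), R_0 = a, and finite-dimensional distributions given by the
  Bessel transition densities.  Its law is then P^(nu)_a.\<close>
definition bessel_process :: "'w measure \<Rightarrow> ('w \<Rightarrow> real \<Rightarrow> real) \<Rightarrow> real \<Rightarrow> real \<Rightarrow> bool" where
  "bessel_process M R nu a \<longleftrightarrow>
     prob_space M \<and>
     (\<forall>t\<ge>0. (\<lambda>w. R w t) \<in> borel_measurable M) \<and>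
     (\<forall>w\<in>space M. continuous_on {0..} (R w) \<and> R w 0 = a) \<and>
     (\<forall>xs. (\<forall>(dt, A)\<in>set xs. 0 < dt \<and> A \<in> sets borel) \<longrightarrow>
        emeasure M {w \<in> space M. path_event R 0 w xs} = bessel_fdd nu a xs)"

definition run_inf :: "(real \<Rightarrow> real) \<Rightarrow> real \<Rightarrow> real" where
  "run_inf r t = Inf (r ` {0..t})"

definition total_inf :: "(real \<Rightarrow> real) \<Rightarrow> real" where
  "total_inf r = Inf (r ` {0..})"

definition argmin_time :: "(real \<Rightarrow> real) \<Rightarrow> real" where
  "argmin_time r = Inf {t. 0 \<le> t \<and> r t = total_inf r}"

end

theory Submission
  imports Defs "HOL-Real_Asymp.Real_Asymp"
begin

text \<open>
  Write \<open>h(x) = x\<^sup>-\<^sup>2\<^sup>\<nu>\<close>, the (inverted) scale function. Integrating the Bessel series termwise gives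
  \<open>P\<^sub>t h(x) = h(x) F(x\<^sup>2/2t)\<close> with \<open>F\<close> the distribution function of the Gamma\<open>(\<nu>)\<close> law. Hence \<open>h\<close> is
  excessive, and along a grid of step \<open>d\<close> the defect \<open>h - P\<^sub>d h\<close> is \<open>O(d\<^sup>3)\<close> away from 0. Stopping
  \<open>h(R)\<close> on finer and finer grids at the first visit below \<open>z\<close> therefore yields
  \<open>P(inf R < z after time s | past) = (z/R\<^sub>s)\<^sup>2\<^sup>\<nu>\<close> on \<open>R\<^sub>s \<ge> z\<close>: given the past, the future infimum is
  \<open>R\<^sub>s V\<close> with \<open>V\<close> of density \<open>2\<nu> v\<^sup>2\<^sup>\<nu>\<^sup>-\<^sup>1\<close> on (0,1), and the total infimum is distributed as \<open>a V\<close>.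

  Both quantities of the theorem thus have the form \<open>E[h(R\<^sub>t) \<phi>(I\<^sub>t)]\<close> with \<open>\<phi>\<close> continuous. Since
  \<open>t\<^sup>\<nu> h(R\<^sub>t)\<close> is uniformly integrable, \<open>I\<^sub>t\<close> may be replaced by \<open>I\<^sub>s\<close> for a large fixed \<open>s\<close>; by the Markov
  property at \<open>s\<close> and \<open>t\<^sup>\<nu> P\<^sub>t\<^sub>-\<^sub>s h \<rightarrow> C = 1/(2\<^sup>\<nu> \<Gamma>(\<nu>+1))\<close> the limit is \<open>C E[\<phi>(I\<^sub>\<infinity>)]\<close>.
\<close>

section \<open>Modified Bessel functions\<close>

text \<open>The hypothesis gives finite-dimensional distributions and continuity only: no
  filtration, no strong Markov property, no martingale to stop. Hitting a level is therefore phrased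
  with lists of grid times, and the conditional law of the future infimum as an equality of image
  measures. The grid must become finer and reach infinity at once: \<open>4 ^ m\<close> steps of
  length \<open>1 / 2 ^ m\<close> reach \<open>2 ^ m\<close>, so the one-step defect has to be
  \<open>o(d^2)\<close>, and the third moment of the Gamma law yields \<open>d^3\<close>. What the
  stopped \<open>h\<close> leaves on paths that stay above the level is removed by a cutoff
  \<open>L\<close> and the decay of the density in \<open>t\<close>. With future infimum
  \<open>R_t V\<close>, the gap exceeds \<open>b\<close> with conditional probability
  \<open>((I_t - b)^+ / R_t)^(2 nu)\<close>, so \<open>\<phi>(y) = ((y - b)^+)^(2 nu)\<close> in
  (i). In (ii), \<open>\<phi>(y) = G(y) - g(y) y^(2 nu)\<close>, where \<open>G(y)\<close>
  integrates \<open>g(z) 2 nu z^(2 nu - 1)\<close> over \<open>[0, y]\<close>. The right-hand sides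
  of the theorem are \<open>C E[\<phi>(a V)]\<close>; an integration by parts brings in the factor 2
  of \<open>a^(2 nu) - 2 z^(2 nu)\<close>.\<close>

lemma gauss_moment:
  fixes \<beta> t :: real
  assumes "\<beta> > 0" "t > 0"
  shows "(\<integral>\<^sup>+y. ennreal (y powr (2*\<beta> - 1) * exp (- y\<^sup>2 / (2*t))) * indicator {0<..} y \<partial>lborel)
     = ennreal ((2*t) powr \<beta> * Gamma \<beta> / 2)"
proof -
  let ?f = "\<lambda>u::real. u powr (\<beta> - 1) / exp u"
  have "(?f has_integral Gamma \<beta>) {0..}" using Gamma_integral_real[OF assms(1)] .
  then have G: "(?f has_integral Gamma \<beta>) {0<..}"
    by (rule has_integral_spike_set_eq[THEN iffD1, rotated 2])
       (auto intro: negligible_subset[of "{0}"])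
  have absG: "?f absolutely_integrable_on {0<..}"
    using G by (intro nonnegative_absolutely_integrable_1) (auto simp: integrable_on_def)
  let ?g = "\<lambda>y::real. y\<^sup>2 / (2*t)"
  have im: "?g ` {0<..} = {0<..}"
  proof (intro equalityI subsetI)
    fix x :: real assume "x \<in> {0<..}"
    then have "x = ?g (sqrt (2*t*x))" "sqrt (2*t*x) \<in> {0<..}" using assms by auto
    then show "x \<in> ?g ` {0<..}" by blast
  qed (use assms in auto)
  have inj: "inj_on ?g {0<..}"
    using assms by (auto simp: inj_on_def)
  have der: "(?g has_field_derivative (x/t)) (at x within {0<..})" for x
    using assms by (auto intro!: derivative_eq_intros simp: field_simps)
  \<comment> \<open>The substitution \<open>u = y^2 / (2 t)\<close> in the Gamma integral;
    \<open>y / t\<close> is its Jacobian.\<close>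
  have "(\<lambda>y. \<bar>y/t\<bar> * ?f (?g y)) absolutely_integrable_on {0<..} \<and> integral {0<..} (\<lambda>y. \<bar>y/t\<bar> * ?f (?g y)) = Gamma \<beta>"
    by (subst has_absolute_integral_change_of_variables_1'[OF _ der inj])
       (use absG G im in auto)
  then have hi: "((\<lambda>y. \<bar>y/t\<bar> * ?f (?g y)) has_integral Gamma \<beta>) {0<..}"
    by (metis (no_types, lifting) absolutely_integrable_on_def has_integral_iff)
  have "((\<lambda>y. (2*t) powr \<beta> / 2 * (\<bar>y/t\<bar> * ?f (?g y))) has_integral (2*t) powr \<beta> / 2 * Gamma \<beta>) {0<..}"
    by (rule has_integral_mult_right[OF hi])
  then have "((\<lambda>y. y powr (2*\<beta> - 1) * exp (- y\<^sup>2 / (2*t))) has_integral (2*t) powr \<beta> / 2 * Gamma \<beta>) {0<..}"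
  proof (rule has_integral_cong[THEN iffD1, rotated])
    fix y :: real assume y: "y \<in> {0<..}"
    have e: "exp (- y\<^sup>2 / (2*t)) = 1 / exp (?g y)" by (simp add: exp_minus field_simps)
    have p1: "(?g y) powr (\<beta> - 1) = y powr (2*(\<beta>-1)) / (2*t) powr (\<beta>-1)"
      using y assms by (simp add: powr_divide powr_powr flip: powr_numeral)
    have p2: "(2*t) powr \<beta> = (2*t) * (2*t) powr (\<beta>-1)"
      using assms by (simp add: powr_mult_base)
    have p3: "y powr (2*\<beta> - 1) = y * y powr (2*(\<beta>-1))"
      using y by (simp add: powr_mult_base algebra_simps)
    show "(2*t) powr \<beta> / 2 * (\<bar>y/t\<bar> * ?f (?g y)) = y powr (2*\<beta> - 1) * exp (- y\<^sup>2 / (2*t))"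
      unfolding e p1 p2 p3 using y assms by (simp add: field_simps)
  qed
  then show ?thesis
    by (subst nn_integral_has_integral_lebesgue') (auto simp: mult.commute)
qed

lemma exp_sums_real: "(\<lambda>k. v ^ k / fact k) sums exp (v::real)"
  using exp_converges[of v] by (simp add: divide_inverse_commute)

text \<open>Iterate the functional equation and discard \<open>nu\<close> in each factor. This
  dominates the Bessel and incomplete gamma series by exponential series.\<close>

lemma Gamma_fact_le:
  fixes nu :: real
  assumes "nu > 0"
  shows "fact k * Gamma (nu + 1) \<le> Gamma (real k + nu + 1)"
proof (induction k)
  case (Suc k)
  have "Gamma (real k + nu + 1 + 1) = (real k + nu + 1) * Gamma (real k + nu + 1)"
    using assms by (intro Gamma_plus1) (auto simp: nonpos_Ints_def)
  moreover have "(real k + 1) * (fact k * Gamma (nu + 1)) \<le> (real k + nu + 1) * Gamma (real k + nu + 1)"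
    using Suc assms by (intro mult_mono) (auto intro!: Gamma_real_nonneg)
  ultimately show ?case by (simp add: algebra_simps)
qed auto

lemma power_over_fact_le_exp: "v \<ge> 0 \<Longrightarrow> v ^ k / fact k \<le> exp (v::real)"
  using sum_le_suminf[of "\<lambda>n. v^n / fact n" "{k}"] summable_exp[of v]
  by (auto simp: exp_def divide_inverse mult.commute)

text \<open>Of the two factors \<open>v ^ k / fact k\<close> left by \<open>Gamma_fact_le\<close>,
  one is bounded by \<open>exp v\<close> and the other is kept for summation. With
  \<open>v = z / 2\<close> the exponentials combine to \<open>exp z\<close>, exactly the factor that
  completes the square in \<open>bessel_density_le\<close>.\<close>

lemma besselI_term_le:
  fixes nu v :: real
  assumes "nu > 0" "v > 0"
  shows "v powr (2 * real k + nu) / (fact k * Gamma (real k + nu + 1))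
    \<le> v powr nu / Gamma (nu+1) * exp v * (v ^ k / fact k)"
proof -
  have G: "Gamma (nu+1) > 0" using assms by (intro Gamma_real_pos) auto
  have G2: "Gamma (real k + nu+1) > 0" using assms by (intro Gamma_real_pos) auto
  have "v powr (2 * real k + nu) / (fact k * Gamma (real k + nu + 1)) \<le> v powr (2 * real k + nu) / (fact k * (fact k * Gamma (nu + 1)))"
    using Gamma_fact_le[OF assms(1), of k] G G2 by (intro divide_left_mono mult_left_mono) auto
  also have "\<dots> = v powr nu * v ^ k * v ^ k / (fact k * (fact k * Gamma (nu + 1)))"
  proof -
    have "2 * real k + nu = nu + real k + real k" by simp
    then show ?thesis using assms by (simp only: powr_add powr_realpow)
  qed
  also have "v powr nu * v ^ k * v ^ k / (fact k * (fact k * Gamma (nu + 1))) = v powr nu / Gamma (nu+1) * (v^k / fact k) * (v ^ k / fact k)"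
    by simp
  also have "\<dots> \<le> v powr nu / Gamma (nu+1) * exp v * (v ^ k / fact k)"
    using assms G power_over_fact_le_exp[of v k] by (intro mult_right_mono mult_left_mono) auto
  finally show ?thesis .
qed

lemma
  fixes nu z :: real
  assumes "nu > 0" "z > 0"
  shows besselI_summable: "summable (\<lambda>k. (z/2) powr (2 * real k + nu) / (fact k * Gamma (real k + nu + 1)))"
    and besselI_le: "besselI nu z \<le> (z/2) powr nu / Gamma (nu+1) * exp z"
    and besselI_nonneg: "0 \<le> besselI nu z"
proof -
  have G: "Gamma (real k + nu+1) > 0" for k using assms by (intro Gamma_real_pos) auto
  have s: "(\<lambda>k. (z/2) powr nu / Gamma (nu+1) * exp (z/2) * ((z/2) ^ k / fact k)) sums ((z/2) powr nu / Gamma (nu+1) * exp (z/2) * exp (z/2))"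
    by (intro sums_mult exp_sums_real)
  show 1: "summable (\<lambda>k. (z/2) powr (2 * real k + nu) / (fact k * Gamma (real k + nu + 1)))"
    by (rule summable_comparison_test_ev[OF _ sums_summable[OF s]])
       (use assms besselI_term_le[of nu "z/2"] G in \<open>auto simp: less_imp_le\<close>)
  have "besselI nu z \<le> (\<Sum>k. (z/2) powr nu / Gamma (nu+1) * exp (z/2) * ((z/2) ^ k / fact k))"
    unfolding besselI_def by (intro suminf_le 1 sums_summable[OF s] besselI_term_le) (use assms in auto)
  also have "\<dots> = (z/2) powr nu / Gamma (nu+1) * exp z"
    using sums_unique[OF s] by (simp add: mult.assoc flip: exp_add)
  finally show "besselI nu z \<le> (z/2) powr nu / Gamma (nu+1) * exp z" .
  show "0 \<le> besselI nu z"
    unfolding besselI_def by (intro suminf_nonneg 1) (use G in \<open>auto simp: less_imp_le\<close>)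
qed

section \<open>The incomplete gamma function\<close>

text \<open>Tricomi's incomplete gamma function: \<open>w powr nu * gamma_ratio nu w\<close> is the
  Gamma(nu) distribution function at \<open>w > 0\<close>. Dividing out the power makes it regular
  at 0, where its argument \<open>x^2 / (2 t)\<close> goes as \<open>t\<close> tends to
  infinity.\<close>

definition gamma_ratio :: "real \<Rightarrow> real \<Rightarrow> real" where
  "gamma_ratio nu w = exp (-w) * (\<Sum>k. w ^ k / Gamma (real k + nu + 1))"

text \<open>Comparison with the exponential series from above and with the term \<open>k = 0\<close>
  from below. The two bounds meet as \<open>w\<close> tends to 0, which later gives the limit
  constant.\<close>

lemma
  fixes nu w :: real
  assumes "nu > 0" "w \<ge> 0"
  shows gamma_ratio_summable: "summable (\<lambda>k. w ^ k / Gamma (real k + nu + 1))"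
    and gamma_ratio_le: "gamma_ratio nu w \<le> 1 / Gamma (nu + 1)"
    and gamma_ratio_ge: "exp (-w) / Gamma (nu + 1) \<le> gamma_ratio nu w"
proof -
  have G: "Gamma (real k + nu+1) > 0" for k using assms by (intro Gamma_real_pos) auto
  have G0: "Gamma (nu+1) > 0" using G[of 0] by simp
  have s: "(\<lambda>k. 1 / Gamma (nu+1) * (w ^ k / fact k)) sums (1 / Gamma (nu+1) * exp w)"
    by (intro sums_mult exp_sums_real)
  have le: "w ^ k / Gamma (real k + nu + 1) \<le> 1 / Gamma (nu+1) * (w ^ k / fact k)" for k
  proof -
    have "w ^ k / Gamma (real k + nu + 1) \<le> w ^ k / (fact k * Gamma (nu + 1))"
      using Gamma_fact_le[OF assms(1), of k] G[of k] G0 assms by (intro divide_left_mono) auto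
    then show ?thesis by (simp add: mult.commute)
  qed
  show 1: "summable (\<lambda>k. w ^ k / Gamma (real k + nu + 1))"
    by (rule summable_comparison_test_ev[OF _ sums_summable[OF s]])
       (use assms le G in \<open>auto simp: less_imp_le\<close>)
  have "(\<Sum>k. w ^ k / Gamma (real k + nu + 1)) \<le> 1 / Gamma (nu+1) * exp w"
    using suminf_le[OF le 1 sums_summable[OF s]] sums_unique[OF s] by simp
  then have "gamma_ratio nu w \<le> exp (-w) * (1 / Gamma (nu+1) * exp w)"
    unfolding gamma_ratio_def by (intro mult_left_mono) auto
  then show "gamma_ratio nu w \<le> 1 / Gamma (nu + 1)" by (simp add: exp_minus)
  have "(\<Sum>k\<in>{0}. w ^ k / Gamma (real k + nu + 1)) \<le> (\<Sum>k. w ^ k / Gamma (real k + nu + 1))"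
    by (intro sum_le_suminf 1) (use G assms in \<open>auto simp: less_imp_le\<close>)
  then have "exp (-w) * (1 / Gamma (nu+1)) \<le> gamma_ratio nu w"
    unfolding gamma_ratio_def by (intro mult_left_mono) auto
  then show "exp (-w) / Gamma (nu + 1) \<le> gamma_ratio nu w" by simp
qed

lemma gamma_ratio_nonneg: "nu > 0 \<Longrightarrow> w \<ge> 0 \<Longrightarrow> 0 \<le> gamma_ratio nu w"
  using gamma_ratio_ge[of nu w] Gamma_real_pos[of "nu+1"]
  by (smt (verit) divide_nonneg_pos exp_ge_zero)

text \<open>The derivatives of the terms telescope: term \<open>k + 1\<close> contributes
  \<open>?e k - ?e (k + 1)\<close>, and term 0 contributes the Gamma density minus
  \<open>?e 0\<close>. Integration over \<open>{0..w}\<close> leaves a remainder dominated by the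
  general term of a convergent series.\<close>

lemma gamma_ratio_incomplete:
  fixes nu w :: real
  assumes "nu > 0" "w > 0"
  shows "w powr nu * gamma_ratio nu w = integral {0..w} (\<lambda>u. u powr (nu - 1) / exp u) / Gamma nu"
proof -
  let ?t = "\<lambda>k u. exp (-u) * u powr (real k + nu) / Gamma (real k + nu + 1)"
  let ?f = "\<lambda>u. u powr (nu - 1) / exp u"
  let ?e = "\<lambda>n u. exp (-u) * u powr (real n + nu) / Gamma (real n + nu + 1)"
  have G: "Gamma (real k + nu+1) > 0" for k using assms by (intro Gamma_real_pos) auto
  have "?f integrable_on {0..}" using Gamma_integral_real[OF assms(1)] by blast
  then have int: "?f integrable_on {0..w}"
    using integrable_on_subinterval by fastforce
  have D: "((\<lambda>u. exp (-u) * u powr r / c) has_real_derivative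
      (r * (exp (-u) * u powr (r - 1)) - exp (-u) * u powr r) / c) (at u)" if "u > 0" for r c u :: real
  proof -
    have d: "((\<lambda>u. exp (-u)) has_real_derivative (- exp (-u))) (at u)"
      by (auto intro!: derivative_eq_intros)
    show ?thesis
      using DERIV_cdivide[OF DERIV_mult[OF d has_real_derivative_powr[OF that, of r]], of c]
      by (simp add: mult_ac)
  qed
  have der: "((\<lambda>u. \<Sum>k<Suc n. ?t k u) has_real_derivative (?f u / Gamma nu - ?e n u)) (at u)" if "u > 0" for n u
  proof (induction n)
    case 0
    have "Gamma (nu + 1) = nu * Gamma nu" using assms by (intro Gamma_plus1) (auto simp: nonpos_Ints_def)
    moreover have "exp (-u) * u powr (nu - 1) = ?f u" by (simp add: exp_minus divide_inverse)
    ultimately have "(nu * (exp (-u) * u powr (nu - 1)) - exp (-u) * u powr nu) / Gamma (nu+1) = ?f u / Gamma nu - ?e 0 u"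
      using assms by (simp add: diff_divide_distrib)
    then show ?case using D[OF that, of nu "Gamma (nu+1)"] by simp
  next
    case (Suc n)
    have "Gamma (real n + nu + 1 + 1) = (real n + nu + 1) * Gamma (real n + nu + 1)"
      using assms by (intro Gamma_plus1) (auto simp: nonpos_Ints_def)
    then have GS: "Gamma (real (Suc n) + nu + 1) = (real n + nu + 1) * Gamma (real n + nu + 1)"
      by (simp add: algebra_simps)
    have n0: "real n + nu + 1 > 0" using assms by simp
    have eqS: "real (Suc n) + nu = real n + nu + 1" by simp
    have "((real n + nu + 1) * (exp (-u) * u powr (real n + nu + 1 - 1)) - exp (-u) * u powr (real n + nu + 1)) / Gamma (real (Suc n) + nu + 1)
       = ?e n u - ?e (Suc n) u"
      unfolding diff_divide_distrib GS unfolding eqS using n0 by simp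
    with D[OF that, of "real n + nu + 1" "Gamma (real (Suc n) + nu + 1)"]
    have "((\<lambda>u. ?t (Suc n) u) has_real_derivative ?e n u - ?e (Suc n) u) (at u)"
      unfolding eqS by simp
    then have "((\<lambda>u. (\<Sum>k<Suc n. ?t k u) + ?t (Suc n) u) has_real_derivative
       (?f u / Gamma nu - ?e n u) + (?e n u - ?e (Suc n) u)) (at u)"
      by (rule DERIV_add[OF Suc])
    then show ?case by simp
  qed
  have cont: "continuous_on {0..w} (?t k)" for k
  proof -
    have "continuous_on {0..w} (\<lambda>u. u powr (real k + nu))"
      using assms by (intro continuous_on_powr') (auto intro!: continuous_intros)
    moreover have "continuous_on {0..w} (\<lambda>u. exp (-u))" by (intro continuous_intros)
    ultimately show ?thesis using G[of k] by (intro continuous_on_divide continuous_on_mult) auto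
  qed
  have hi: "((\<lambda>u. ?f u / Gamma nu - ?e n u) has_integral (\<Sum>k<Suc n. ?t k w)) {0..w}" for n
  proof -
    \<comment> \<open>For \<open>nu < 1\<close> the integrand is unbounded at 0, hence the
      fundamental theorem with derivatives in the interior only.\<close>
    have "((\<lambda>u. ?f u / Gamma nu - ?e n u) has_integral ((\<Sum>k<Suc n. ?t k w) - (\<Sum>k<Suc n. ?t k 0))) {0..w}"
      by (intro fundamental_theorem_of_calculus_interior continuous_on_sum cont)
         (use assms der[of _ n] in \<open>auto simp: has_real_derivative_iff_has_vector_derivative\<close>)
    moreover have "(\<Sum>k<Suc n. ?t k 0) = 0" using assms by (intro sum.neutral) auto
    ultimately show ?thesis by simp
  qed
  have inte: "(?e n) integrable_on {0..w}" for n using cont by (rule integrable_continuous_real)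
  have eq: "(\<Sum>k<Suc n. ?t k w) = integral {0..w} ?f / Gamma nu - integral {0..w} (?e n)" for n
  proof -
    have "((\<lambda>u. ?f u / Gamma nu - ?e n u) has_integral (integral {0..w} ?f / Gamma nu - integral {0..w} (?e n))) {0..w}"
      by (intro has_integral_diff has_integral_divide integrable_integral int inte)
    then show ?thesis using hi[of n] has_integral_unique by blast
  qed
  have small: "(\<lambda>n. integral {0..w} (?e n)) \<longlonglongrightarrow> 0"
  proof (rule tendsto_sandwich[OF _ _ tendsto_const])
    show "\<forall>\<^sub>F n in sequentially. 0 \<le> integral {0..w} (?e n)"
      using G by (intro always_eventually allI Henstock_Kurzweil_Integration.integral_nonneg inte) (auto simp: less_imp_le)
    have "integral {0..w} (?e n) \<le> integral {0..w} (\<lambda>u. w powr nu * (w ^ n / Gamma (real n + nu + 1)))" for n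
    proof (intro integral_le inte)
      fix u assume u: "u \<in> {0..w}"
      have "exp (-u) * u powr (real n + nu) \<le> 1 * w powr (real n + nu)"
        using u assms by (intro mult_mono powr_mono2) auto
      then show "?e n u \<le> w powr nu * (w ^ n / Gamma (real n + nu + 1))"
        using G[of n] assms by (auto simp: powr_add powr_realpow mult.commute intro!: divide_right_mono)
    qed auto
    then show "\<forall>\<^sub>F n in sequentially. integral {0..w} (?e n) \<le> w * (w powr nu * (w ^ n / Gamma (real n + nu + 1)))"
      using assms by (intro always_eventually) (auto simp: mult_ac)
    have "(\<lambda>n. w ^ n / Gamma (real n + nu + 1)) \<longlonglongrightarrow> 0"
      using gamma_ratio_summable[of nu w] assms by (intro summable_LIMSEQ_zero) auto
    then show "(\<lambda>n. w * (w powr nu * (w ^ n / Gamma (real n + nu + 1)))) \<longlonglongrightarrow> 0"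
      by (intro tendsto_mult_right_zero)
  qed
  have "(\<lambda>n. \<Sum>k<Suc n. ?t k w) \<longlonglongrightarrow> integral {0..w} ?f / Gamma nu - 0"
    unfolding eq by (intro tendsto_intros small)
  moreover have "(\<lambda>k. ?t k w) sums (w powr nu * gamma_ratio nu w)"
  proof -
    have "(\<lambda>k. w powr nu * (exp (-w) * (w ^ k / Gamma (real k + nu + 1)))) sums (w powr nu * gamma_ratio nu w)"
      unfolding gamma_ratio_def
      by (intro sums_mult summable_sums gamma_ratio_summable) (use assms in auto)
    then show ?thesis using assms by (simp add: powr_add powr_realpow mult_ac)
  qed
  then have "(\<lambda>n. \<Sum>k<Suc n. ?t k w) \<longlonglongrightarrow> w powr nu * gamma_ratio nu w"
    unfolding sums_def by (rule LIMSEQ_Suc)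
  ultimately show ?thesis using LIMSEQ_unique by fastforce
qed

text \<open>The lower bound is Markov's inequality for the third moment of the Gamma law:
  \<open>1 \<le> (u / w)^3\<close> on the tail \<open>u > w\<close>, and the moment is
  \<open>Gamma (nu + 3) / Gamma nu\<close>. Three is the least integer exponent for which the errors
  of \<open>4 ^ m\<close> steps of length \<open>1 / 2 ^ m\<close> sum to something
  vanishing.\<close>

lemma
  fixes nu w :: real
  assumes "nu > 0" "w > 0"
  shows gamma_ratio_powr_le_1: "w powr nu * gamma_ratio nu w \<le> 1"
    and gamma_ratio_powr_ge: "1 - (Gamma (nu + 3) / Gamma nu) / w ^ 3 \<le> w powr nu * gamma_ratio nu w"
proof -
  let ?f = "\<lambda>u. u powr (nu - 1) / exp u"
  have G: "Gamma nu > 0" using assms by (intro Gamma_real_pos) auto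
  have F: "(?f has_integral Gamma nu) {0..}" by (rule Gamma_integral_real[OF assms(1)])
  then have int: "?f integrable_on {0..w}"
    using integrable_on_subinterval by fastforce
  have "integral {0..w} ?f \<le> integral {0..} ?f"
    using F int by (intro integral_subset_le) auto
  then have "integral {0..w} ?f \<le> Gamma nu" using F by (simp add: integral_unique)
  then show "w powr nu * gamma_ratio nu w \<le> 1"
    using G unfolding gamma_ratio_incomplete[OF assms] by simp
  have "((\<lambda>u. u powr (nu + 3 - 1) / exp u) has_integral Gamma (nu + 3)) {0..}"
    using assms by (intro Gamma_integral_real) auto
  then have F3: "((\<lambda>u. (u powr (nu + 3 - 1) / exp u) * (1 / w^3)) has_integral Gamma (nu + 3) * (1 / w ^ 3)) {0..}"
    by (rule has_integral_mult_left)
  have Fr: "((\<lambda>u. if u \<in> {0..w} then ?f u else 0) has_integral integral {0..w} ?f) {0..}"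
    using integrable_integral[OF int] by (subst has_integral_restrict) auto
  have "Gamma nu \<le> integral {0..w} ?f + Gamma (nu + 3) * (1 / w ^ 3)"
  proof (rule has_integral_le[OF F has_integral_add[OF Fr F3]])
    fix u :: real assume u: "u \<in> {0..}"
    show "?f u \<le> (if u \<in> {0..w} then ?f u else 0) + (u powr (nu + 3 - 1) / exp u) * (1 / w^3)"
    proof (cases "u \<le> w")
      case False
      then have u0: "u > 0" "u > w" using assms by auto
      have "u powr (nu + 3 - 1) = u powr (nu - 1) * u ^ 3"
      proof -
        have "nu + 3 - 1 = (nu - 1) + real 3" by simp
        then show ?thesis using u0 by (simp only: powr_add powr_realpow)
      qed
      moreover have "1 \<le> u ^ 3 / w ^ 3" using u0 assms by (simp add: power_mono)
      then have "u powr (nu - 1) * 1 \<le> u powr (nu - 1) * (u ^ 3 / w ^ 3)" by (intro mult_left_mono) auto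
      ultimately have "u powr (nu - 1) \<le> u powr (nu + 3 - 1) * (1 / w^3)" by simp
      then have "u powr (nu - 1) / exp u \<le> u powr (nu + 3 - 1) * (1 / w^3) / exp u"
        by (rule divide_right_mono) auto
      then show ?thesis using False by (simp add: mult.commute)
    qed (use u assms in auto)
  qed
  then have "1 \<le> (integral {0..w} ?f + Gamma (nu + 3) * (1 / w ^ 3)) / Gamma nu"
    using G by simp
  then show "1 - (Gamma (nu + 3) / Gamma nu) / w ^ 3 \<le> w powr nu * gamma_ratio nu w"
    unfolding gamma_ratio_incomplete[OF assms] by (simp add: add_divide_distrib mult.commute)
qed

section \<open>The Bessel transition density\<close>

lemma borel_measurable_besselI [measurable]: "besselI nu \<in> borel_measurable borel"
  unfolding besselI_def[abs_def] by measurable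

lemma borel_measurable_bessel_density [measurable (raw)]:
  assumes [measurable]: "f \<in> borel_measurable M" "g \<in> borel_measurable M"
  shows "(\<lambda>w. bessel_density nu t (f w) (g w)) \<in> borel_measurable M"
  unfolding bessel_density_def by measurable

lemma borel_measurable_bessel_fdd:
  assumes "\<forall>(dt, A)\<in>set xs. 0 < dt \<and> A \<in> sets borel"
  shows "(\<lambda>x. bessel_fdd nu x xs) \<in> borel_measurable borel"
  using assms
proof (induction xs)
  case (Cons p xs)
  obtain dt A where p: "p = (dt, A)" by force
  then have [measurable]: "A \<in> sets borel" "(\<lambda>x. bessel_fdd nu x xs) \<in> borel_measurable borel"
    using Cons by auto
  show ?case unfolding p by simp
qed simp

lemma bessel_density_nonneg: "nu > 0 \<Longrightarrow> t > 0 \<Longrightarrow> x > 0 \<Longrightarrow> 0 \<le> bessel_density nu t x y"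
  unfolding bessel_density_def by (auto intro!: mult_nonneg_nonneg divide_nonneg_nonneg besselI_nonneg)

lemma bessel_density_nonpos [simp]: "y \<le> 0 \<Longrightarrow> bessel_density nu t x y = 0"
  unfolding bessel_density_def by auto

text \<open>The bound on \<open>besselI\<close> completes the square in the exponent, and the powers
  of \<open>x\<close> cancel, so the prefactor does not depend on the starting point. Its decay in
  \<open>t\<close> is transience in quantitative form.\<close>

lemma bessel_density_le:
  fixes nu t x y :: real
  assumes "nu > 0" "t > 0" "x > 0" "y > 0"
  shows "bessel_density nu t x y \<le> y powr (2*nu + 1) * exp (- (x - y)\<^sup>2 / (2*t)) / (2 powr nu * Gamma (nu+1) * t powr (nu + 1))"
proof -
  have G0: "Gamma (nu+1) > 0" using assms by (intro Gamma_real_pos) auto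
  have "bessel_density nu t x y = (1 / t) * (y / x) powr nu * y * exp (- (x\<^sup>2 + y\<^sup>2) / (2 * t)) * besselI nu (x * y / t)"
    using assms by (simp add: bessel_density_def)
  also have "\<dots> \<le> (1 / t) * (y / x) powr nu * y * exp (- (x\<^sup>2 + y\<^sup>2) / (2 * t)) * ((x * y / t / 2) powr nu / Gamma (nu+1) * exp (x * y / t))"
    using assms by (intro mult_left_mono besselI_le) auto
  also have "\<dots> = ((y / x) powr nu * y * (x * y / t / 2) powr nu / t) * (exp (- (x\<^sup>2 + y\<^sup>2) / (2 * t)) * exp (x * y / t)) / Gamma (nu + 1)"
    by simp
  also have "exp (- (x\<^sup>2 + y\<^sup>2) / (2 * t)) * exp (x * y / t) = exp (- (x - y)\<^sup>2 / (2*t))"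
    unfolding exp_add[symmetric] using assms by (simp add: power2_eq_square field_simps)
  also have "(y / x) powr nu * y * (x * y / t / 2) powr nu / t = y powr (2*nu + 1) / (2 powr nu * t powr (nu + 1))"
  proof -
    have "2*nu + 1 = nu + nu + 1" by simp
    then have "y powr (2*nu + 1) = y powr nu * y powr nu * y" using assms by (simp only: powr_add) simp
    moreover have "(x * y / t / 2) powr nu = x powr nu * y powr nu / t powr nu / 2 powr nu"
      using assms by (simp add: powr_mult powr_divide)
    ultimately show ?thesis using assms by (simp add: powr_divide powr_add mult_ac)
  qed
  finally show ?thesis by (simp add: mult_ac)
qed

text \<open>All terms are nonnegative, so the Bessel series may be integrated termwise by
  \<open>gauss_moment\<close>. The condition on \<open>p\<close> keeps the Gamma arguments positive;
  \<open>p = 0\<close> gives the total mass and \<open>p = 2*nu\<close> the action on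
  \<open>h\<close>.\<close>

lemma bessel_density_moment:
  fixes nu t x p :: real
  assumes "nu > 0" "t > 0" "x > 0" "p < 2 * nu + 2"
  shows "(\<integral>\<^sup>+y. ennreal (bessel_density nu t x y) * ennreal (y powr (-p)) \<partial>lborel) =
    (\<Sum>k. ennreal (exp (- (x\<^sup>2 / (2*t))) * (x\<^sup>2 / (2*t)) ^ k * (2*t) powr (-p/2) * Gamma (real k + nu + 1 - p/2)
        / (fact k * Gamma (real k + nu + 1))))"
proof -
  define T where "T = 2 * t"
  have T: "T > 0" "t = T / 2" using assms by (auto simp: T_def)
  have G: "Gamma (real k + nu+1) > 0" for k using assms by (intro Gamma_real_pos) auto
  define A where "A k = (2/T) * x powr (-nu) * exp (- (x\<^sup>2 / T)) * (x / T) powr (2 * real k + nu) / (fact k * Gamma (real k + nu + 1))" for k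
  have A0: "A k \<ge> 0" for k unfolding A_def using T assms G[of k] by simp
  let ?b = "\<lambda>k. real k + nu + 1 - p / 2"
  have b0: "?b k > 0" for k using assms by simp
  have pt: "ennreal (bessel_density nu t x y) * ennreal (y powr (-p)) =
      (\<Sum>k. ennreal (A k) * (ennreal (y powr (2 * ?b k - 1) * exp (- y\<^sup>2 / (2*t))) * indicator {0<..} y))" for y
  proof (cases "y > 0")
    case True
    have s: "summable (\<lambda>k. (x*y/t/2) powr (2 * real k + nu) / (fact k * Gamma (real k + nu + 1)))"
      using True assms by (intro besselI_summable) auto
    let ?c = "(1 / t) * (y / x) powr nu * y * exp (- (x\<^sup>2 + y\<^sup>2) / (2 * t)) * y powr (-p)"
    have term_eq: "?c * ((x*y/t/2) powr (2 * real k + nu) / (fact k * Gamma (real k + nu + 1))) =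
       A k * (y powr (2 * ?b k - 1) * exp (- y\<^sup>2 / (2*t)))" for k
    proof -
      have 1: "(x*y/t/2) powr (2 * real k + nu) = (x / T) powr (2 * real k + nu) * y powr (2 * real k + nu)"
        using True assms T by (simp add: powr_mult powr_divide)
      have "2 * ?b k - 1 = nu + 1 + (-p) + (2 * real k + nu)" by (simp add: algebra_simps)
      then have 2: "y powr (2 * ?b k - 1) = y powr nu * y * y powr (-p) * y powr (2 * real k + nu)"
        using True by (simp only: powr_add powr_one)
      have "- (x\<^sup>2 + y\<^sup>2) / (2 * t) = - (x\<^sup>2 / T) + (- y\<^sup>2 / (2*t))"
        by (simp add: T_def diff_divide_distrib)
      then have 3: "exp (- (x\<^sup>2 + y\<^sup>2) / (2 * t)) = exp (- (x\<^sup>2 / T)) * exp (- y\<^sup>2 / (2*t))"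
        by (simp only: exp_add)
      have 4: "(y / x) powr nu = y powr nu * x powr (-nu)" using True assms by (simp add: powr_divide powr_minus_divide)
      have 5: "2 / T = 1 / t" by (simp add: T_def)
      show ?thesis unfolding 1 2 3 4 5 A_def by (simp only: mult_ac times_divide_eq_left times_divide_eq_right divide_divide_eq_left)
    qed
    have "bessel_density nu t x y * y powr (-p) = ?c * besselI nu (x*y/t)"
      using True by (simp add: bessel_density_def)
    also have "\<dots> = (\<Sum>k. ?c * ((x*y/t/2) powr (2 * real k + nu) / (fact k * Gamma (real k + nu + 1))))"
      unfolding besselI_def using s by (rule suminf_mult[symmetric])
    also have "\<dots> = (\<Sum>k. A k * (y powr (2 * ?b k - 1) * exp (- y\<^sup>2 / (2*t))))"
      by (simp only: term_eq)
    finally have e: "bessel_density nu t x y * y powr (-p) = (\<Sum>k. A k * (y powr (2 * ?b k - 1) * exp (- y\<^sup>2 / (2*t))))" .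
    have "summable (\<lambda>k. A k * (y powr (2 * ?b k - 1) * exp (- y\<^sup>2 / (2*t))))"
      unfolding term_eq[symmetric] by (rule summable_mult[OF s])
    then have "ennreal (bessel_density nu t x y * y powr (-p)) = (\<Sum>k. ennreal (A k * (y powr (2 * ?b k - 1) * exp (- y\<^sup>2 / (2*t)))))"
      unfolding e by (intro suminf_ennreal2[symmetric]) (auto simp: A0)
    then show ?thesis using True A0 bessel_density_nonneg[OF assms(1-3), of y] by (simp add: ennreal_mult'')
  next
    case False
    then show ?thesis by simp
  qed
  have "(\<integral>\<^sup>+y. ennreal (bessel_density nu t x y) * ennreal (y powr (-p)) \<partial>lborel) =
    (\<Sum>k. \<integral>\<^sup>+y. ennreal (A k) * (ennreal (y powr (2 * ?b k - 1) * exp (- y\<^sup>2 / (2*t))) * indicator {0<..} y) \<partial>lborel)"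
    unfolding pt by (intro nn_integral_suminf) measurable
  also have "\<dots> = (\<Sum>k. ennreal (A k) * ennreal ((2*t) powr ?b k * Gamma (?b k) / 2))"
    by (subst nn_integral_cmult) (measurable, subst gauss_moment[OF b0 assms(2)], simp)
  also have "\<dots> = (\<Sum>k. ennreal (exp (- (x\<^sup>2 / (2*t))) * (x\<^sup>2 / (2*t)) ^ k * (2*t) powr (-p/2) * Gamma (?b k)
        / (fact k * Gamma (real k + nu + 1))))"
  proof (intro suminf_cong)
    fix k
    have "?b k = real k + nu + 1 + (-p/2)" by simp
    then have 1: "T powr ?b k = T ^ k * T powr nu * T * T powr (-p/2)"
      using T by (simp only: powr_add powr_realpow powr_one)
    have "2 * real k + nu = real k + real k + nu" by simp
    then have 2: "(x / T) powr (2 * real k + nu) = (x/T)^k * (x/T)^k * (x powr nu / T powr nu)"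
      using T assms by (simp only: powr_add powr_realpow divide_pos_pos powr_divide less_imp_le power_divide)
    have 3: "x powr (-nu) * x powr nu = 1" using assms by (simp add: powr_minus)
    have 4: "(x\<^sup>2 / T) ^ k = (x/T)^k * (x/T)^k * T ^ k"
    proof -
      have "x\<^sup>2 / T = x/T * (x/T) * T" using T by (simp add: power2_eq_square)
      then show ?thesis by (simp only: power_mult_distrib)
    qed
    have "A k * (T powr ?b k * Gamma (?b k) / 2) =
      (x powr (-nu) * x powr nu) * (exp (- (x\<^sup>2 / T)) * ((x/T)^k * (x/T)^k * T ^ k) * T powr (-p/2) * Gamma (?b k)
        / (fact k * Gamma (real k + nu + 1)))"
      unfolding A_def 1 2 using T by simp
    then have "A k * (T powr ?b k * Gamma (?b k) / 2) = 
       exp (- (x\<^sup>2 / T)) * (x\<^sup>2 / T) ^ k * T powr (-p/2) * Gamma (?b k) / (fact k * Gamma (real k + nu + 1))"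
      unfolding 3 4 by simp
    then show "ennreal (A k) * ennreal ((2*t) powr ?b k * Gamma (?b k) / 2) =
      ennreal (exp (- (x\<^sup>2 / (2*t))) * (x\<^sup>2 / (2*t)) ^ k * (2*t) powr (-p/2) * Gamma (?b k)
        / (fact k * Gamma (real k + nu + 1)))"
      using A0[of k] by (simp add: T_def ennreal_mult'[symmetric])
  qed
  finally show ?thesis .
qed

lemma bessel_density_mass:
  assumes "nu > 0" "t > 0" "x > 0"
  shows "(\<integral>\<^sup>+y. ennreal (bessel_density nu t x y) \<partial>lborel) = 1"
proof -
  let ?w = "x\<^sup>2 / (2*t)"
  have G: "Gamma (real k + nu+1) > 0" for k using assms by (intro Gamma_real_pos) auto
  have "(\<integral>\<^sup>+y. ennreal (bessel_density nu t x y) \<partial>lborel) = (\<integral>\<^sup>+y. ennreal (bessel_density nu t x y) * ennreal (y powr (-0)) \<partial>lborel)"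
    \<comment> \<open>The moment formula carries the factor \<open>y powr 0\<close>, which is 0
      rather than 1 at \<open>y = 0\<close>; the density vanishes there, so the integral is
      unchanged.\<close>
    by (intro nn_integral_cong) (metis bessel_density_nonpos ennreal_0 ennreal_1 linorder_linear minus_zero mult.right_neutral mult_zero_left powr_zero_eq_one)
  also have "\<dots> = (\<Sum>k. ennreal (exp (- ?w) * (?w ^ k / fact k)))"
  proof (subst bessel_density_moment, goal_cases)
    case 5
    have "Gamma (real k + nu + 1) \<noteq> 0" for k using G[of k] by simp
    then show ?case using assms by (intro suminf_cong) simp
  qed (use assms in auto)
  also have "\<dots> = ennreal (exp (-?w) * exp ?w)"
    using sums_mult[OF exp_sums_real[of ?w], of "exp (-?w)"] assms
    by (intro suminf_ennreal_eq) auto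
  finally show ?thesis by (simp add: exp_minus)
qed

text \<open>At \<open>p = 2*nu\<close> the Gamma value in the numerator is \<open>fact k\<close> and
  cancels, which leaves the series of \<open>gamma_ratio\<close>.\<close>

lemma bessel_density_harmonic:
  assumes "nu > 0" "t > 0" "x > 0"
  shows "(\<integral>\<^sup>+y. ennreal (bessel_density nu t x y) * ennreal (y powr (-2*nu)) \<partial>lborel)
    = ennreal ((2*t) powr (-nu) * gamma_ratio nu (x\<^sup>2 / (2*t)))"
proof -
  let ?w = "x\<^sup>2 / (2*t)"
  have G: "Gamma (real k + nu+1) > 0" for k using assms by (intro Gamma_real_pos) auto
  have "(\<integral>\<^sup>+y. ennreal (bessel_density nu t x y) * ennreal (y powr (-2*nu)) \<partial>lborel) =
    (\<integral>\<^sup>+y. ennreal (bessel_density nu t x y) * ennreal (y powr (-(2*nu))) \<partial>lborel)" by simp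
  also have "\<dots> = (\<Sum>k. ennreal ((2*t) powr (-nu) * (exp (- ?w) * (?w ^ k / Gamma (real k + nu + 1)))))"
  proof (subst bessel_density_moment, goal_cases)
    case 5
    have "Gamma (real k + 1) = fact k" for k using Gamma_fact[of k, where ?'a=real] by (simp add: add.commute)
    then show ?case by (intro suminf_cong) (simp add: mult_ac)
  qed (use assms in auto)
  also have "\<dots> = ennreal ((2*t) powr (-nu) * gamma_ratio nu ?w)"
    unfolding gamma_ratio_def using assms G
    by (intro suminf_ennreal_eq sums_mult summable_sums gamma_ratio_summable) (auto simp: less_imp_le)
  finally show ?thesis .
qed

lemma powr_neg_eq_scaled:
  fixes nu :: real
  assumes "t > 0" "x > 0"
  shows "x powr (-2*nu) * (x\<^sup>2 / (2*t)) powr nu = (2*t) powr (-nu)"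
proof -
  have "(x\<^sup>2) powr nu = x powr (2*nu)" using assms by (simp add: powr_powr flip: powr_numeral)
  then have "(x\<^sup>2 / (2*t)) powr nu = x powr (2*nu) / (2*t) powr nu" using assms by (simp only: powr_divide)
  moreover have "x powr (-2*nu) = 1 / x powr (2*nu)" "(2*t) powr (-nu) = 1 / (2*t) powr nu"
    using powr_minus_divide[of x "2*nu"] powr_minus_divide[of "2*t" nu] by simp_all
  moreover have "x powr (2*nu) \<noteq> 0" using assms by simp
  ultimately show ?thesis by (simp only: times_divide_times_eq) simp
qed

lemma bessel_density_superharmonic:
  assumes "nu > 0" "t > 0" "x > 0"
  shows "(\<integral>\<^sup>+y. ennreal (bessel_density nu t x y) * ennreal (y powr (-2*nu)) \<partial>lborel) \<le> ennreal (x powr (-2*nu))"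
proof -
  have "(2*t) powr (-nu) * gamma_ratio nu (x\<^sup>2 / (2*t)) = x powr (-2*nu) * ((x\<^sup>2 / (2*t)) powr nu * gamma_ratio nu (x\<^sup>2 / (2*t)))"
    unfolding powr_neg_eq_scaled[OF assms(2,3), symmetric] by simp
  also have "\<dots> \<le> x powr (-2*nu) * 1"
    using assms by (intro mult_left_mono gamma_ratio_powr_le_1) auto
  finally show ?thesis unfolding bessel_density_harmonic[OF assms] by simp
qed

text \<open>The defect is \<open>x powr (-2*nu)\<close> times the Gamma tail beyond
  \<open>x^2 / (2 t)\<close>; the bound from \<open>gamma_ratio_powr_ge\<close> is largest at the
  lowest admissible point \<open>z\<close>. The additive form avoids the truncated subtraction of
  \<open>ennreal\<close>.\<close>

lemma bessel_density_almost_harmonic: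
  assumes "nu > 0" "t > 0" "x \<ge> z" "z > 0"
  shows "ennreal (x powr (-2*nu)) \<le> (\<integral>\<^sup>+y. ennreal (bessel_density nu t x y) * ennreal (y powr (-2*nu)) \<partial>lborel)
     + ennreal (z powr (-2*nu) * (Gamma (nu + 3) / Gamma nu) * (2*t/z\<^sup>2) ^ 3)"
proof -
  have x: "x > 0" using assms by simp
  let ?w = "x\<^sup>2 / (2*t)"
  have w: "?w > 0" using x assms by simp
  have G: "Gamma nu > 0" "Gamma (nu + 3) > 0" using assms by (auto intro!: Gamma_real_pos)
  have "x powr (-2*nu) * (1 - (Gamma (nu + 3) / Gamma nu) / ?w ^ 3) \<le> x powr (-2*nu) * (?w powr nu * gamma_ratio nu ?w)"
    using assms w by (intro mult_left_mono gamma_ratio_powr_ge) auto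
  also have "\<dots> = (2*t) powr (-nu) * gamma_ratio nu ?w"
    unfolding powr_neg_eq_scaled[OF assms(2) x, symmetric] by simp
  finally have 1: "x powr (-2*nu) \<le> (2*t) powr (-nu) * gamma_ratio nu ?w + x powr (-2*nu) * (Gamma (nu + 3) / Gamma nu) * (1 / ?w) ^ 3"
    unfolding power_one_over by (subst (asm) right_diff_distrib) (simp only: mult_1_right times_divide_eq_right diff_le_eq)
  have "x powr (-2*nu) * (Gamma (nu + 3) / Gamma nu) * (1 / ?w) ^ 3 \<le> z powr (-2*nu) * (Gamma (nu + 3) / Gamma nu) * (2*t/z\<^sup>2) ^ 3"
  proof (intro mult_mono power_mono)
    show "x powr (-2*nu) \<le> z powr (-2*nu)" using assms by (intro powr_mono2') auto
    show "1 / ?w \<le> 2*t / z\<^sup>2" using assms x by (auto intro!: divide_left_mono power_mono)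
  qed (use G assms x in auto)
  with 1 have "x powr (-2*nu) \<le> (2*t) powr (-nu) * gamma_ratio nu ?w + z powr (-2*nu) * (Gamma (nu + 3) / Gamma nu) * (2*t/z\<^sup>2) ^ 3"
    by simp
  moreover have "0 \<le> (2*t) powr (-nu) * gamma_ratio nu ?w" using gamma_ratio_nonneg[of nu ?w] assms w by simp
  moreover have "0 \<le> z powr (-2*nu) * (Gamma (nu + 3) / Gamma nu) * (2*t/z\<^sup>2) ^ 3" using G assms by simp
  ultimately show ?thesis unfolding bessel_density_harmonic[OF assms(1,2) x]
    by (metis ennreal_leI ennreal_plus)
qed

section \<open>Hitting a level along a grid\<close>

text \<open>After \<open>bessel_density_le\<close> the integrand is at most a constant on
  \<open>{0..r}\<close>, since \<open>q \<le> 2*nu + 1\<close> makes the remaining power of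
  \<open>y\<close> monotone. The case \<open>q = 0\<close> serves probabilities,
  \<open>q = 2*nu\<close> serves \<open>h\<close>; \<open>E\<close> is 1 or the Gaussian cost of
  jumping across a gap.\<close>

lemma nn_integral_bessel_density_below:
  fixes nu t x r E q :: real
  assumes "nu > 0" "t > 0" "x > 0" "r > 0" "q \<le> 2*nu + 1" and E: "\<And>y. 0 < y \<Longrightarrow> y < r \<Longrightarrow> exp (- (x - y)\<^sup>2 / (2*t)) \<le> E"
  shows "(\<integral>\<^sup>+y. ennreal (bessel_density nu t x y) * ennreal (y powr (-q)) * indicator {..<r} y \<partial>lborel)
    \<le> ennreal (r powr (2*nu + 2 - q) * E / (2 powr nu * Gamma (nu+1) * t powr (nu + 1)))"
proof -
  have r: "r > 0" by fact
  let ?K = "2 powr nu * Gamma (nu+1) * t powr (nu + 1)"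
  have G0: "Gamma (nu+1) > 0" using assms by (intro Gamma_real_pos) auto
  have K: "?K > 0" using assms G0 by simp
  have E0: "E \<ge> 0" using E[of "r/2"] r exp_ge_zero order_trans by (metis field_sum_of_halves half_gt_zero less_add_same_cancel1)
  have "(\<integral>\<^sup>+y. ennreal (bessel_density nu t x y) * ennreal (y powr (-q)) * indicator {..<r} y \<partial>lborel)
    \<le> (\<integral>\<^sup>+y. ennreal (r powr (2*nu + 1 - q) * E / ?K) * indicator {0..r} y \<partial>lborel)"
  proof (intro nn_integral_mono)
    fix y
    show "ennreal (bessel_density nu t x y) * ennreal (y powr (-q)) * indicator {..<r} y
       \<le> ennreal (r powr (2*nu + 1 - q) * E / ?K) * indicator {0..r} y"
    proof (cases "0 < y \<and> y < r")
      case True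
      have "bessel_density nu t x y * y powr (-q) \<le> (y powr (2*nu + 1) * exp (- (x - y)\<^sup>2 / (2*t)) / ?K) * y powr (-q)"
        using assms True by (intro mult_right_mono bessel_density_le) auto
      also have "\<dots> = y powr (2*nu + 1 + (-q)) * exp (- (x - y)\<^sup>2 / (2*t)) / ?K"
        unfolding powr_add[of y "2*nu + 1" "-q"] by (simp only: mult_ac times_divide_eq_left times_divide_eq_right)
      also have "\<dots> \<le> r powr (2*nu + 1 - q) * E / ?K"
        using True E[of y] K assms by (intro divide_right_mono mult_mono) (auto intro!: powr_mono2)
      finally have "ennreal (bessel_density nu t x y * y powr (-q)) \<le> ennreal (r powr (2*nu + 1 - q) * E / ?K)"
        by (rule ennreal_leI)
      then show ?thesis using True bessel_density_nonneg[OF assms(1-3), of y] by (simp add: ennreal_mult'')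
    next
      case False
      then show ?thesis by (cases "0 < y") (auto simp: indicator_def)
    qed
  qed
  also have "\<dots> = ennreal (r powr (2*nu + 1 - q) * E / ?K) * ennreal r"
    using r by (subst nn_integral_cmult_indicator) auto
  also have "\<dots> = ennreal (r powr (2*nu + 2 - q) * E / ?K)"
  proof -
    have e: "2*nu + 2 - q = (2*nu + 1 - q) + 1" by simp
    have "r powr (2*nu + 2 - q) = r powr (2*nu + 1 - q) * r" unfolding e powr_add using r by simp
    then show ?thesis using r K E0 by (subst ennreal_mult''[symmetric]) (auto simp: mult_ac)
  qed
  finally show ?thesis .
qed

text \<open>Probability, from \<^term>\<open>x\<close>, of being below \<^term>\<open>z\<close> at one of the times \<open>d, 2d, \<dots>, nd\<close>
  (decomposed by the first such time), and of staying above \<^term>\<open>z\<close> at all of them and ending below \<^term>\<open>L\<close>.\<close>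
definition bessel_hit :: "real \<Rightarrow> real \<Rightarrow> real \<Rightarrow> nat \<Rightarrow> real \<Rightarrow> ennreal" where
  "bessel_hit nu d z n x = (\<Sum>k<n. bessel_fdd nu x (replicate k (d, {z..}) @ [(d, {..<z})]))"

definition bessel_survive :: "real \<Rightarrow> real \<Rightarrow> real \<Rightarrow> real \<Rightarrow> nat \<Rightarrow> real \<Rightarrow> ennreal" where
  "bessel_survive nu d z L n x = (case n of 0 \<Rightarrow> indicator {..<L} x
     | Suc m \<Rightarrow> bessel_fdd nu x (replicate m (d, {z..}) @ [(d, {z..<L})]))"

lemma bessel_hit_measurable [measurable]: "d > 0 \<Longrightarrow> bessel_hit nu d z n \<in> borel_measurable borel"
  unfolding bessel_hit_def[abs_def]
  by (intro borel_measurable_sum borel_measurable_bessel_fdd) auto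

lemma bessel_survive_measurable [measurable]: "d > 0 \<Longrightarrow> bessel_survive nu d z L n \<in> borel_measurable borel"
proof (cases n)
  case (Suc m)
  assume "d > 0"
  then show ?thesis unfolding bessel_survive_def[abs_def] Suc 
    by (simp, intro borel_measurable_bessel_fdd) auto
qed (simp add: bessel_survive_def[abs_def])

text \<open>First-step decomposition, on which both bounds for \<open>bessel_hit\<close> run by
  induction.\<close>

lemma bessel_hit_Suc:
  assumes "d > 0"
  shows "bessel_hit nu d z (Suc n) x = (\<integral>\<^sup>+y. ennreal (bessel_density nu d x y) * (indicator {..<z} y + indicator {z..} y * bessel_hit nu d z n y) \<partial>lborel)"
proof -
  have m[measurable]: "(\<lambda>x. bessel_fdd nu x (replicate k (d, {z..}) @ [(d, {..<z})])) \<in> borel_measurable borel" for k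
    using assms by (intro borel_measurable_bessel_fdd) auto
  have "bessel_hit nu d z (Suc n) x = bessel_fdd nu x [(d, {..<z})] +
      (\<Sum>k<n. \<integral>\<^sup>+y. ennreal (bessel_density nu d x y) * indicator {z..} y * bessel_fdd nu y (replicate k (d, {z..}) @ [(d, {..<z})]) \<partial>lborel)"
    unfolding bessel_hit_def by (subst sum.lessThan_Suc_shift) simp
  also have "\<dots> = (\<integral>\<^sup>+y. ennreal (bessel_density nu d x y) * indicator {..<z} y \<partial>lborel) +
      (\<integral>\<^sup>+y. (\<Sum>k<n. ennreal (bessel_density nu d x y) * indicator {z..} y * bessel_fdd nu y (replicate k (d, {z..}) @ [(d, {..<z})])) \<partial>lborel)"
    by (subst nn_integral_sum) auto
  also have "\<dots> = (\<integral>\<^sup>+y. ennreal (bessel_density nu d x y) * indicator {..<z} y + (\<Sum>k<n. ennreal (bessel_density nu d x y) * indicator {z..} y * bessel_fdd nu y (replicate k (d, {z..}) @ [(d, {..<z})])) \<partial>lborel)"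
    by (subst nn_integral_add) auto
  also have "\<dots> = (\<integral>\<^sup>+y. ennreal (bessel_density nu d x y) * (indicator {..<z} y + indicator {z..} y * bessel_hit nu d z n y) \<partial>lborel)"
    unfolding bessel_hit_def by (simp only: sum_distrib_left distrib_left mult.assoc)
  finally show ?thesis .
qed

lemma bessel_survive_Suc:
  "bessel_survive nu d z L (Suc n) x = (\<integral>\<^sup>+y. ennreal (bessel_density nu d x y) * (indicator {z..} y * bessel_survive nu d z L n y) \<partial>lborel)"
proof (cases n)
  case 0
  have "indicator {z..<L} y = indicator {z..} y * (indicator {..<L} y :: ennreal)" for y
    by (auto simp: indicator_def)
  then show ?thesis unfolding 0 bessel_survive_def by simp
next
  case (Suc m)
  then show ?thesis unfolding bessel_survive_def by (simp add: mult.assoc)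
qed

text \<open>A discrete maximal inequality for the supermartingale \<open>h(R)\<close>:
  \<open>z powr (2*nu)\<close> times \<open>h\<close> dominates 1 below \<open>z\<close>, and a
  transition step does not increase its mean.\<close>

lemma bessel_hit_le:
  assumes "nu > 0" "d > 0" "x > 0" "z > 0"
  shows "bessel_hit nu d z n x \<le> ennreal (z powr (2*nu)) * ennreal (x powr (-2*nu))"
  using assms(3)
proof (induction n arbitrary: x)
  case 0
  then show ?case by (simp add: bessel_hit_def)
next
  case (Suc n)
  have "bessel_hit nu d z (Suc n) x \<le> (\<integral>\<^sup>+y. ennreal (z powr (2*nu)) * (ennreal (bessel_density nu d x y) * ennreal (y powr (-2*nu))) \<partial>lborel)"
    unfolding bessel_hit_Suc[OF assms(2)]
  proof (intro nn_integral_mono)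
    fix y
    have "indicator {..<z} y + indicator {z..} y * bessel_hit nu d z n y \<le> ennreal (z powr (2*nu)) * ennreal (y powr (-2*nu))"
      if y: "y > 0"
    proof (cases "y < z")
      case True
      have "1 \<le> z powr (2*nu) / y powr (2*nu)"
        using True y assms by (simp add: powr_mono2)
      then have "1 \<le> z powr (2*nu) * y powr (-2*nu)"
        using powr_minus_divide[of y "2*nu"] by simp
      then have "1 \<le> ennreal (z powr (2*nu) * y powr (-2*nu))" by (metis ennreal_leI ennreal_1)
      then show ?thesis using True by (simp add: ennreal_mult)
    next
      case False
      then show ?thesis using Suc.IH[OF y] by simp
    qed
    then show "ennreal (bessel_density nu d x y) * (indicator {..<z} y + indicator {z..} y * bessel_hit nu d z n y)
      \<le> ennreal (z powr (2*nu)) * (ennreal (bessel_density nu d x y) * ennreal (y powr (-2*nu)))"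
      by (cases "y > 0") (auto simp: mult.left_commute[of "ennreal (z powr _)"] intro!: mult_left_mono)
  qed
  also have "\<dots> = ennreal (z powr (2*nu)) * (\<integral>\<^sup>+y. ennreal (bessel_density nu d x y) * ennreal (y powr (-2*nu)) \<partial>lborel)"
    by (intro nn_integral_cmult) measurable
  also have "\<dots> \<le> ennreal (z powr (2*nu)) * ennreal (x powr (-2*nu))"
    using assms Suc by (intro mult_left_mono bessel_density_superharmonic) auto
  finally show ?case .
qed

text \<open>The first term bounds the one-step failure of \<open>h\<close> to be harmonic at points above \<^term>\<open>z\<close>, the second
  the part of \<open>P\<^sub>d h\<close> due to jumps from above \<^term>\<open>z\<close> to below \<open>z'\<close>.\<close>
definition hit_error :: "real \<Rightarrow> real \<Rightarrow> real \<Rightarrow> real \<Rightarrow> real" where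
  "hit_error nu z z' d = z powr (-2*nu) * (Gamma (nu + 3) / Gamma nu) * (2*d/z\<^sup>2) ^ 3
     + z' powr 2 * exp (- (z - z')\<^sup>2 / (2*d)) / (2 powr nu * Gamma (nu+1) * d powr (nu + 1))"

text \<open>The converse of \<open>bessel_hit_le\<close> up to errors, obtained by stopping
  \<open>h\<close> at the first grid visit below \<open>z\<close> or after \<open>n\<close> steps. A
  visit in \<open>[z', z)\<close> costs at most \<open>h(z')\<close>, a survivor at most
  \<open>h(z)\<close> if it ends below \<open>L\<close> and at most \<open>h(L)\<close> otherwise;
  each step adds one \<open>hit_error\<close>.\<close>

lemma bessel_hit_ge:
  assumes "nu > 0" "d > 0" "0 < z'" "z' < z" "z \<le> x" "L > 0"
  shows "ennreal (x powr (-2*nu)) \<le> ennreal (z' powr (-2*nu)) * bessel_hit nu d z n x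
     + ennreal (z powr (-2*nu)) * bessel_survive nu d z L n x + (ennreal (L powr (-2*nu)) + of_nat n * ennreal (hit_error nu z z' d))"
  using assms(5)
proof (induction n arbitrary: x)
  case 0
  have "x powr (-2*nu) \<le> z powr (-2*nu)" using 0 assms by (intro powr_mono2') auto
  moreover have "x powr (-2*nu) \<le> L powr (-2*nu)" if "L \<le> x" using that assms by (intro powr_mono2') auto
  ultimately show ?case
    by (cases "x < L") (auto simp: bessel_survive_def bessel_hit_def intro!: ennreal_leI add_increasing2)
next
  case (Suc n)
  have x: "x > 0" using Suc assms by simp
  let ?q = "\<lambda>y. ennreal (bessel_density nu d x y)"
  let ?h = "\<lambda>y. ennreal (y powr (-2*nu))"
  let ?e = "ennreal (L powr (-2*nu)) + of_nat n * ennreal (hit_error nu z z' d)"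
  let ?e1 = "z powr (-2*nu) * (Gamma (nu + 3) / Gamma nu) * (2*d/z\<^sup>2) ^ 3"
  let ?e2 = "z' powr 2 * exp (- (z - z')\<^sup>2 / (2*d)) / (2 powr nu * Gamma (nu+1) * d powr (nu + 1))"
  note [measurable] = bessel_hit_measurable[OF assms(2)] bessel_survive_measurable[OF assms(2)]
  have G: "Gamma nu > 0" "Gamma (nu + 3) > 0" "Gamma (nu+1) > 0" using assms by (auto intro!: Gamma_real_pos)
  have e: "ennreal (hit_error nu z z' d) = ennreal ?e1 + ennreal ?e2"
    unfolding hit_error_def using G assms by (intro ennreal_plus) auto
  have low: "(\<integral>\<^sup>+y. ?q y * ?h y * indicator {..<z'} y \<partial>lborel) \<le> ennreal ?e2"
  proof -
    have "exp (- (x - y)\<^sup>2 / (2*d)) \<le> exp (- (z - z')\<^sup>2 / (2*d))" if "y < z'" for y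
      using that Suc assms by (auto intro!: divide_right_mono power_mono)
    then show ?thesis
      using nn_integral_bessel_density_below[of nu d x z' "2*nu" "exp (- (z - z')\<^sup>2 / (2*d))"] assms x by simp
  qed
  have "(\<integral>\<^sup>+y. ?q y * ?h y \<partial>lborel) \<le> (\<integral>\<^sup>+y. ?q y * ?h y * indicator {..<z'} y
      + (ennreal (z' powr (-2*nu)) * (?q y * (indicator {..<z} y + indicator {z..} y * bessel_hit nu d z n y))
      + (ennreal (z powr (-2*nu)) * (?q y * (indicator {z..} y * bessel_survive nu d z L n y)) + ?q y * ?e)) \<partial>lborel)"
  proof (intro nn_integral_mono)
    fix y
    \<comment> \<open>Since \<open>h\<close> is unbounded near 0, landings below \<open>z'\<close>
      cannot be charged to a hit and are left to the estimate \<open>low\<close>. Landings in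
      \<open>[z', z)\<close> are hits, and from \<open>z\<close> on the induction hypothesis
      applies.\<close>
    consider "y < z'" | "z' \<le> y" "y < z" | "z \<le> y" by linarith
    then show "?q y * ?h y \<le> ?q y * ?h y * indicator {..<z'} y
      + (ennreal (z' powr (-2*nu)) * (?q y * (indicator {..<z} y + indicator {z..} y * bessel_hit nu d z n y))
      + (ennreal (z powr (-2*nu)) * (?q y * (indicator {z..} y * bessel_survive nu d z L n y)) + ?q y * ?e))"
    proof cases
      case 1
      then show ?thesis by (auto intro!: add_increasing2)
    next
      case 2
      then have "y powr (-2*nu) \<le> z' powr (-2*nu)" using assms by (intro powr_mono2') auto
      then have "?q y * ?h y \<le> ennreal (z' powr (-2*nu)) * ?q y"
        by (subst mult.commute) (intro mult_right_mono ennreal_leI, auto)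
      then show ?thesis using 2 by (auto intro!: add_increasing2)
    next
      case 3
      have "?q y * ?h y \<le> ?q y * (ennreal (z' powr (-2*nu)) * bessel_hit nu d z n y
     + ennreal (z powr (-2*nu)) * bessel_survive nu d z L n y + ?e)"
        using Suc.IH[OF 3] by (intro mult_left_mono) auto
      then show ?thesis using 3 assms by (simp add: distrib_left mult_ac add_ac)
    qed
  qed
  also have "\<dots> = (\<integral>\<^sup>+y. ?q y * ?h y * indicator {..<z'} y \<partial>lborel)
      + (ennreal (z' powr (-2*nu)) * bessel_hit nu d z (Suc n) x
      + (ennreal (z powr (-2*nu)) * bessel_survive nu d z L (Suc n) x + 1 * ?e))"
    unfolding bessel_hit_Suc[OF assms(2)] bessel_survive_Suc bessel_density_mass[OF assms(1,2) x, symmetric]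
    by (simp add: nn_integral_add nn_integral_cmult nn_integral_multc)
  also have "\<dots> \<le> ennreal ?e2 + (ennreal (z' powr (-2*nu)) * bessel_hit nu d z (Suc n) x
      + (ennreal (z powr (-2*nu)) * bessel_survive nu d z L (Suc n) x + 1 * ?e))"
    by (intro add_right_mono low)
  finally have "(\<integral>\<^sup>+y. ?q y * ?h y \<partial>lborel) + ennreal ?e1 \<le> ennreal ?e2 + (ennreal (z' powr (-2*nu)) * bessel_hit nu d z (Suc n) x
      + (ennreal (z powr (-2*nu)) * bessel_survive nu d z L (Suc n) x + 1 * ?e)) + ennreal ?e1"
    by (rule add_right_mono)
  moreover have "?h x \<le> (\<integral>\<^sup>+y. ?q y * ?h y \<partial>lborel) + ennreal ?e1"
    using assms Suc by (intro bessel_density_almost_harmonic) auto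
  ultimately have "?h x \<le> ennreal ?e2 + (ennreal (z' powr (-2*nu)) * bessel_hit nu d z (Suc n) x
      + (ennreal (z powr (-2*nu)) * bessel_survive nu d z L (Suc n) x + 1 * ?e)) + ennreal ?e1"
    by (rule order_trans[rotated])
  then show ?case unfolding e by (simp add: distrib_right algebra_simps)
qed

text \<open>For \<open>d = 1 / 2 ^ m\<close> the number of steps \<open>4 ^ m\<close> is
  \<open>1 / d^2\<close>. It is beaten by the cube in the harmonicity defect and by the Gaussian
  cost of jumping the fixed gap \<open>z - z'\<close>.\<close>

lemma hit_error_tendsto:
  assumes "nu > 0" "0 < z'" "z' < z"
  shows "(\<lambda>m. real (4 ^ m) * hit_error nu z z' (1 / 2 ^ m)) \<longlonglongrightarrow> 0"
proof -
  define c1 where "c1 = z powr (-2*nu) * (Gamma (nu + 3) / Gamma nu) * (2/z\<^sup>2) ^ 3"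
  define c2 where "c2 = z' powr 2 / (2 powr nu * Gamma (nu+1))"
  define k where "k = (z - z')\<^sup>2 / 2"
  have k: "k > 0" using assms by (simp add: k_def)
  have "((\<lambda>d. (1/d)^2 * (c1 * d ^ 3 + c2 * (exp (- (k/d)) / d powr (nu + 1)))) \<longlongrightarrow> 0) (at_right 0)"
    using k assms by real_asymp
  moreover have "filterlim (\<lambda>m. 1 / 2 ^ m :: real) (at_right 0) sequentially"
    by real_asymp
  ultimately have "(\<lambda>m. (1/(1 / 2 ^ m))^2 * (c1 * (1 / 2 ^ m) ^ 3 + c2 * (exp (- (k/(1 / 2 ^ m))) / (1 / 2 ^ m) powr (nu + 1)))) \<longlonglongrightarrow> 0"
    by (rule filterlim_compose)
  moreover have "(1/(1 / 2 ^ m))^2 = real (4 ^ m)" for m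
    by (simp add: power_mult[symmetric] mult.commute[of m 2] power_mult)
  moreover have "hit_error nu z z' d = c1 * d ^ 3 + c2 * (exp (- (k/d)) / d powr (nu + 1))" for d
    unfolding hit_error_def c1_def c2_def k_def by (simp add: power_divide power_mult_distrib)
  ultimately show ?thesis by simp
qed

section \<open>Infima along grids and finite-dimensional distributions\<close>

text \<open>Rounding past \<open>u\<close> keeps the index at least 1, so that only strictly
  positive time increments occur, as the finite-dimensional distributions demand.\<close>

lemma floor_grid_tendsto:
  fixes u :: real and d :: "nat \<Rightarrow> real"
  assumes "u \<ge> 0" "\<And>m. d m > 0" "d \<longlonglongrightarrow> 0"
  shows "(\<lambda>m. real (nat \<lfloor>u / d m\<rfloor> + 1) * d m) \<longlonglongrightarrow> u"
proof (rule tendsto_sandwich[OF _ _ tendsto_const])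
  have fl: "real (nat \<lfloor>u / d m\<rfloor> + 1) = real_of_int \<lfloor>u / d m\<rfloor> + 1" for m
    using assms(1) assms(2)[of m] by (simp add: of_nat_nat)
  show "\<forall>\<^sub>F m in sequentially. u \<le> real (nat \<lfloor>u / d m\<rfloor> + 1) * d m"
  proof (intro always_eventually allI)
    fix m
    have "u / d m \<le> real_of_int \<lfloor>u / d m\<rfloor> + 1" by linarith
    then have "u / d m * d m \<le> real (nat \<lfloor>u / d m\<rfloor> + 1) * d m"
      unfolding fl using assms(2)[of m] by (intro mult_right_mono) auto
    then show "u \<le> real (nat \<lfloor>u / d m\<rfloor> + 1) * d m" using assms(2)[of m] by simp
  qed
  show "\<forall>\<^sub>F m in sequentially. real (nat \<lfloor>u / d m\<rfloor> + 1) * d m \<le> u + d m"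
  proof (intro always_eventually allI)
    fix m
    have "real_of_int \<lfloor>u / d m\<rfloor> + 1 \<le> u / d m + 1" by linarith
    then have "real (nat \<lfloor>u / d m\<rfloor> + 1) * d m \<le> (u / d m + 1) * d m"
      unfolding fl using assms(2)[of m] by (intro mult_right_mono) auto
    then show "real (nat \<lfloor>u / d m\<rfloor> + 1) * d m \<le> u + d m" using assms(2)[of m] by (simp add: distrib_right)
  qed
  show "(\<lambda>m. u + d m) \<longlonglongrightarrow> u" using tendsto_add[OF tendsto_const assms(3), of u] by simp
qed

lemma continuous_ge_of_seq:
  fixes r :: "real \<Rightarrow> real"
  assumes "continuous_on {0..} r" "u \<ge> 0" "x \<longlonglongrightarrow> u" "\<And>m. x m \<ge> 0" "\<forall>\<^sub>F m in sequentially. r (x m) \<ge> y"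
  shows "r u \<ge> y"
proof -
  have "(\<lambda>m. r (x m)) \<longlonglongrightarrow> r u"
    by (rule continuous_on_tendsto_compose[OF assms(1,3)]) (use assms in auto)
  then show ?thesis using assms(5) by (intro tendsto_lowerbound) auto
qed

text \<open>Continuity reduces the condition to countably many times. Time 0 is not among them; it
  is reached as a limit of grid points.\<close>

lemma all_ge_iff_grid:
  fixes r :: "real \<Rightarrow> real"
  assumes "continuous_on {0..} r" "s > 0"
  shows "(\<forall>u\<in>{0..s}. r u \<ge> y) \<longleftrightarrow> (\<forall>m. \<forall>k\<in>{1..2^m}. r (real k * (s / 2^m)) \<ge> y)" (is "?L \<longleftrightarrow> ?R")
proof
  assume L: ?L
  show ?R
  proof (intro allI ballI)
    fix m k assume "k \<in> {1..2^m::nat}"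
    then have "real k \<le> 2 ^ m" using of_nat_le_iff[of k "2^m", where ?'a=real] by simp
    then have "real k * (s / 2^m) \<le> 2 ^ m * (s / 2 ^ m)" using assms by (intro mult_right_mono) auto
    then show "r (real k * (s / 2^m)) \<ge> y" using L assms by simp
  qed
next
  assume R: ?R
  show ?L
  proof
    fix u assume u: "u \<in> {0..s}"
    show "r u \<ge> y"
    proof (cases "u = s")
      case True
      \<comment> \<open>Rounding past \<open>u = s\<close> would leave the grid, but the coarsest
        grid \<open>m = 0\<close>, \<open>k = 1\<close> consists of \<open>s\<close> itself.\<close>
      then show ?thesis using R[rule_format, of 1 0] by simp
    next
      case False
      let ?d = "\<lambda>m. s / 2 ^ m"
      have d0: "?d \<longlonglongrightarrow> 0" by real_asymp
      show ?thesis
      proof (rule continuous_ge_of_seq[OF assms(1) _ floor_grid_tendsto[of u ?d]])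
        show "\<forall>\<^sub>F m in sequentially. y \<le> r (real (nat \<lfloor>u / ?d m\<rfloor> + 1) * ?d m)"
        proof (intro always_eventually allI)
          fix m
          have "u * 2 ^ m < s * 2 ^ m" using False u by auto
          then have "u / ?d m < 2 ^ m" using assms u by (simp add: field_simps)
          then have "\<lfloor>u / ?d m\<rfloor> < 2 ^ m" by (simp add: floor_less_iff)
          then have "nat \<lfloor>u / ?d m\<rfloor> < 2 ^ m" using u assms
            by (subst nat_less_iff) (auto simp: zero_le_floor)
          then have "nat \<lfloor>u / ?d m\<rfloor> + 1 \<in> {1..2 ^ m}" unfolding atLeastAtMost_iff by linarith
          then show "y \<le> r (real (nat \<lfloor>u / ?d m\<rfloor> + 1) * ?d m)" by (rule R[rule_format])
        qed
      qed (use u assms d0 in \<open>auto\<close>)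
    qed
  qed
qed

text \<open>At level \<open>m\<close> the grid reaches \<open>s + 2 ^ m\<close>, so every later time
  is eventually inside the window while the mesh shrinks.\<close>

lemma all_ge_iff_grid_infinite:
  fixes r :: "real \<Rightarrow> real"
  assumes "continuous_on {0..} r" "s \<ge> 0"
  shows "(\<forall>u\<in>{s..}. r u \<ge> y) \<longleftrightarrow> (\<forall>m. \<forall>k\<in>{1..4^m}. r (s + real k * (1 / 2^m)) \<ge> y)" (is "?L \<longleftrightarrow> ?R")
proof
  assume L: ?L
  show ?R using L by simp
next
  assume R: ?R
  show ?L
  proof
    fix u assume u: "u \<in> {s..}"
    let ?d = "\<lambda>m. 1 / 2 ^ m :: real"
    have d0: "?d \<longlonglongrightarrow> 0" by real_asymp
    have t: "(\<lambda>m. s + real (nat \<lfloor>(u-s) / ?d m\<rfloor> + 1) * ?d m) \<longlonglongrightarrow> s + (u - s)"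
      using u d0 by (intro tendsto_add tendsto_const floor_grid_tendsto) auto
    have "s + (u - s) \<ge> 0 \<Longrightarrow> r (s + (u - s)) \<ge> y"
    proof (rule continuous_ge_of_seq[OF assms(1) _ t])
      have "\<forall>\<^sub>F m in sequentially. u - s < 2 ^ m"
        by real_asymp
      then show "\<forall>\<^sub>F m in sequentially. y \<le> r (s + real (nat \<lfloor>(u-s) / ?d m\<rfloor> + 1) * ?d m)"
      proof eventually_elim
        case (elim m)
        then have "(u - s) * 2 ^ m < 2 ^ m * 2 ^ m" by simp
        also have "(2 ^ m * 2 ^ m :: real) = 4 ^ m" by (simp flip: power_mult_distrib)
        finally have "(u-s) / ?d m < 4 ^ m" by simp
        then have "\<lfloor>(u-s) / ?d m\<rfloor> < 4 ^ m" by (simp add: floor_less_iff)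
        then have "nat \<lfloor>(u-s) / ?d m\<rfloor> < 4 ^ m" using u assms
          by (subst nat_less_iff) (auto simp: zero_le_floor)
        then have "nat \<lfloor>(u-s) / ?d m\<rfloor> + 1 \<in> {1..4 ^ m}" unfolding atLeastAtMost_iff by linarith
        then show ?case by (rule R[rule_format])
      qed
    qed (use assms in auto)
    then show "r u \<ge> y" using u assms by simp
  qed
qed

text \<open>\<open>Inf\<close> on the reals is a least upper bound of the negated set, up to sign.
  Without any upper bound the defining predicate is constantly false, so all sets unbounded below
  share one unspecified value.\<close>

lemma Inf_real_not_bdd_below:
  fixes X :: "real set"
  assumes "\<not> bdd_below X"
  shows "Inf X = Inf UNIV"
proof -
  have "\<not> (\<forall>x\<in>uminus ` X. x \<le> z)" for z
  proof
    assume *: "\<forall>x\<in>uminus ` X. x \<le> z"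
    have "bdd_below X" by (rule bdd_belowI[of _ "-z"]) (use * in force)
    with assms show False by blast
  qed
  moreover have "\<not> (\<forall>x\<in>uminus ` UNIV. x \<le> z)" for z :: real
    using gt_ex[of z] by (auto simp: not_le)
  ultimately have "(\<lambda>z. \<forall>x\<in>uminus ` X. x \<le> z) = (\<lambda>z. \<forall>x\<in>uminus ` UNIV. x \<le> z)" by (intro ext) blast
  then show ?thesis unfolding Inf_real_def Sup_real_def by simp
qed

lemma path_event_append:
  "path_event R s w (ys @ xs) \<longleftrightarrow> path_event R s w ys \<and> path_event R (s + sum_list (map fst ys)) w xs"
  by (induction ys arbitrary: s) (auto simp: add.assoc)

lemma path_event_replicate:
  "path_event R s w (replicate n (d, A)) \<longleftrightarrow> (\<forall>k\<in>{1..n}. R w (s + real k * d) \<in> A)"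
proof (induction n arbitrary: s)
  case (Suc n)
  have "(\<forall>k\<in>{1..Suc n}. P k) \<longleftrightarrow> P 1 \<and> (\<forall>k\<in>{1..n}. P (Suc k))" for P :: "nat \<Rightarrow> bool"
  proof (intro iffI conjI ballI)
    fix k assume *: "P 1 \<and> (\<forall>k\<in>{1..n}. P (Suc k))" "k \<in> {1..Suc n}"
    then obtain j where j: "k = Suc j" by (cases k) auto
    show "P k" using * unfolding j by (cases "j = 0") auto
  qed auto
  from this[of "\<lambda>k. R w (s + real k * d) \<in> A"] show ?case using Suc by (simp add: distrib_right add.assoc)
qed simp

lemma sum_list_map_fst_replicate: "sum_list (map fst (replicate n (d::real, A))) = real n * d"
  by (induction n) (auto simp: algebra_simps)

section \<open>Paths and the Markov property\<close>

locale bessel_path = prob_space M for M :: "'w measure" +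
  fixes R :: "'w \<Rightarrow> real \<Rightarrow> real" and nu a :: real
  assumes nu: "nu > 0" and a: "a > 0"
    and R_measurable: "\<And>t. t \<ge> 0 \<Longrightarrow> (\<lambda>w. R w t) \<in> borel_measurable M"
    and R_cont: "\<And>w. w \<in> space M \<Longrightarrow> continuous_on {0..} (R w)"
    and R_0: "\<And>w. w \<in> space M \<Longrightarrow> R w 0 = a"
    and R_fdd: "\<And>xs. \<forall>(dt, A)\<in>set xs. 0 < dt \<and> A \<in> sets borel \<Longrightarrow>
        emeasure M {w \<in> space M. path_event R 0 w xs} = bessel_fdd nu a xs"
begin

definition future_inf :: "'w \<Rightarrow> real \<Rightarrow> real" where
  "future_inf w s = Inf (R w ` {s..})"

lemma total_inf_eq: "total_inf (R w) = future_inf w 0"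
  by (simp add: total_inf_def future_inf_def)

lemma bdd_below_path: "w \<in> space M \<Longrightarrow> bdd_below (R w ` {0..t})"
  by (intro bounded_imp_bdd_below compact_imp_bounded compact_continuous_image continuous_on_subset[OF R_cont]) auto

lemma run_inf_ge_iff:
  assumes "w \<in> space M" "t \<ge> 0"
  shows "y \<le> run_inf (R w) t \<longleftrightarrow> (\<forall>u\<in>{0..t}. y \<le> R w u)"
proof
  assume "y \<le> run_inf (R w) t"
  then show "\<forall>u\<in>{0..t}. y \<le> R w u"
    unfolding run_inf_def using cInf_lower[OF _ bdd_below_path[OF assms(1)], of _ t] by force
next
  assume "\<forall>u\<in>{0..t}. y \<le> R w u"
  then show "y \<le> run_inf (R w) t"
    unfolding run_inf_def using assms by (intro cInf_greatest) auto
qed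

lemma run_inf_measurable: "t > 0 \<Longrightarrow> (\<lambda>w. run_inf (R w) t) \<in> borel_measurable M"
proof (subst borel_measurable_iff_ge, intro allI)
  fix y assume t: "t > 0"
  have [measurable]: "(\<lambda>w. R w (real k * (t / 2^m))) \<in> borel_measurable M" for k m
    using t by (intro R_measurable) auto
  have "{w \<in> space M. y \<le> run_inf (R w) t} = {w \<in> space M. \<forall>m. \<forall>k\<in>{1..2^m}. y \<le> R w (real k * (t / 2^m))}"
    using run_inf_ge_iff all_ge_iff_grid[OF R_cont t] t by auto
  also have "\<dots> \<in> sets M" by measurable
  finally show "{w \<in> space M. y \<le> run_inf (R w) t} \<in> sets M" .
qed

lemma future_inf_ge_iff:
  assumes "bdd_below (R w ` {s..})"
  shows "y \<le> future_inf w s \<longleftrightarrow> (\<forall>u\<in>{s..}. y \<le> R w u)"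
proof
  assume "y \<le> future_inf w s"
  then show "\<forall>u\<in>{s..}. y \<le> R w u"
    unfolding future_inf_def using cInf_lower[OF _ assms] by force
next
  assume "\<forall>u\<in>{s..}. y \<le> R w u"
  then show "y \<le> future_inf w s"
    unfolding future_inf_def by (intro cInf_greatest) auto
qed

lemma all_ge_future_measurable:
  assumes "s \<ge> 0"
  shows "{w \<in> space M. \<forall>u\<in>{s..}. y \<le> R w u} \<in> sets M"
proof -
  have [measurable]: "(\<lambda>w. R w (s + real k * (1 / 2^m))) \<in> borel_measurable M" for k m
    using assms by (intro R_measurable) auto
  have "{w \<in> space M. \<forall>u\<in>{s..}. y \<le> R w u} = {w \<in> space M. \<forall>m. \<forall>k\<in>{1..4^m}. y \<le> R w (s + real k * (1 / 2^m))}"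
    using all_ge_iff_grid_infinite[OF R_cont assms] by auto
  also have "\<dots> \<in> sets M" by measurable
  finally show ?thesis .
qed

lemma bdd_below_iff: "bdd_below (R w ` {s..}) \<longleftrightarrow> (\<exists>n::nat. \<forall>u\<in>{s..}. - real n \<le> R w u)"
proof
  assume "bdd_below (R w ` {s..})"
  then obtain m where m: "\<And>u. u \<in> {s..} \<Longrightarrow> m \<le> R w u" by (auto simp: bdd_below_def)
  obtain n :: nat where "-m \<le> real n" using real_arch_simple by blast
  then show "\<exists>n::nat. \<forall>u\<in>{s..}. - real n \<le> R w u" using m by (intro exI[of _ n]) force
qed (auto simp: bdd_below_def)

text \<open>On the null event of paths unbounded below, the infimum is the fixed junk value
  \<^term>\<open>Inf (UNIV :: real set)\<close>, so measurability holds without completeness of \<^term>\<open>M\<close>.\<close>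
lemma future_inf_measurable:
  assumes "s \<ge> 0"
  shows "(\<lambda>w. future_inf w s) \<in> borel_measurable M"
proof (subst borel_measurable_iff_ge, intro allI)
  fix y
  note [measurable] = all_ge_future_measurable[OF assms]
  have "{w \<in> space M. y \<le> future_inf w s} =
    ({w \<in> space M. \<exists>n::nat. \<forall>u\<in>{s..}. - real n \<le> R w u} \<inter> {w \<in> space M. \<forall>u\<in>{s..}. y \<le> R w u})
    \<union> ({w \<in> space M. \<not> (\<exists>n::nat. \<forall>u\<in>{s..}. - real n \<le> R w u)} \<inter> (if y \<le> Inf UNIV then space M else {}))" (is "?A = ?B")
  proof (rule set_eqI)
    fix w
    show "w \<in> ?A \<longleftrightarrow> w \<in> ?B"
    proof (cases "bdd_below (R w ` {s..})")
      case True
      then show ?thesis using future_inf_ge_iff[OF True] bdd_below_iff[of w s] by auto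
    next
      case False
      then have "future_inf w s = Inf UNIV" unfolding future_inf_def by (rule Inf_real_not_bdd_below)
      then show ?thesis using False bdd_below_iff[of w s] by auto
    qed
  qed
  also have "\<dots> \<in> sets M" by measurable
  finally show "{w \<in> space M. y \<le> future_inf w s} \<in> sets M" .
qed

lemma total_inf_measurable: "(\<lambda>w. total_inf (R w)) \<in> borel_measurable M"
  unfolding total_inf_eq by (rule future_inf_measurable) simp

lemma AE_pos:
  assumes "t > 0"
  shows "AE w in M. R w t > 0"
proof (rule AE_I)
  have "emeasure M {w \<in> space M. path_event R 0 w [(t, {..0})]} = bessel_fdd nu a [(t, {..0})]"
    using assms by (intro R_fdd) auto
  also have "\<dots> = (\<integral>\<^sup>+(y::real). 0 \<partial>lborel)"
    unfolding bessel_fdd.simps by (intro nn_integral_cong) (auto simp: indicator_def)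
  finally show "emeasure M {w \<in> space M. R w t \<le> 0} = 0" by simp
  note [measurable] = R_measurable[OF less_imp_le[OF assms]]
  show "{w \<in> space M. R w t \<le> 0} \<in> sets M" by measurable
qed auto


text \<open>Positivity holds at each grid time; in the limit to all times only the weak inequality
  survives, and it is enough to bound paths from below.\<close>

lemma AE_nonneg: "AE w in M. \<forall>u\<in>{0..}. 0 \<le> R w u"
proof -
  have "AE w in M. \<forall>m k. k \<ge> 1 \<longrightarrow> R w (0 + real k * (1 / 2^m)) > 0"
    unfolding AE_all_countable
  proof (intro allI)
    fix m k :: nat
    show "AE w in M. k \<ge> 1 \<longrightarrow> R w (0 + real k * (1 / 2^m)) > 0"
      by (cases "k \<ge> 1") (use AE_pos[of "0 + real k * (1 / 2^m)"] in auto)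
  qed
  with AE_space show ?thesis
  proof eventually_elim
    case (elim w)
    then show ?case
      by (subst all_ge_iff_grid_infinite[OF R_cont, of w 0]) (auto simp: less_imp_le)
  qed
qed

section \<open>The Markov property through finite-dimensional distributions\<close>

lemma path_event_measurable:
  assumes "\<forall>(dt, A)\<in>set xs. 0 < dt \<and> A \<in> sets borel" "s \<ge> 0"
  shows "{w \<in> space M. path_event R s w xs} \<in> sets M"
  using assms
proof (induction xs arbitrary: s)
  case (Cons p xs)
  obtain dt A where p: "p = (dt, A)" by force
  have "{w \<in> space M. path_event R (s + dt) w xs} \<in> sets M" using Cons p by auto
  moreover have "{w \<in> space M. R w (s + dt) \<in> A} \<in> sets M"
    using Cons p measurable_sets[OF R_measurable[of "s + dt"], of A] by (auto simp: vimage_def Int_def conj_commute)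
  ultimately have "{w \<in> space M. R w (s + dt) \<in> A} \<inter> {w \<in> space M. path_event R (s + dt) w xs} \<in> sets M" by blast
  then show ?case unfolding p by (simp add: Int_def conj_ac)
qed simp

text \<open>A stand-in for events of the past at time \<open>s\<close>: the Markov property itself
  is taken as the predicate on \<open>B\<close>. It holds at time 0 by assumption and passes to
  added constraints at later times and to decreasing intersections, which is enough to reach events
  of the running infimum.\<close>

definition markov_at :: "real \<Rightarrow> 'w set \<Rightarrow> bool" where
  "markov_at s B \<longleftrightarrow> B \<in> sets M \<and> (\<forall>xs. (\<forall>(dt, A)\<in>set xs. 0 < dt \<and> A \<in> sets borel) \<longrightarrow>
     emeasure M (B \<inter> {w \<in> space M. path_event R s w xs}) = (\<integral>\<^sup>+w. indicator B w * bessel_fdd nu (R w s) xs \<partial>M))"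

lemma markov_at_0: "markov_at 0 (space M)"
  unfolding markov_at_def
proof (intro conjI allI impI)
  fix xs :: "(real \<times> real set) list" assume "\<forall>(dt, A)\<in>set xs. 0 < dt \<and> (A :: real set) \<in> sets borel"
  then have "emeasure M {w \<in> space M. path_event R 0 w xs} = bessel_fdd nu a xs" by (rule R_fdd)
  moreover have "(\<integral>\<^sup>+w. indicator (space M) w * bessel_fdd nu (R w 0) xs \<partial>M) = (\<integral>\<^sup>+w. bessel_fdd nu a xs \<partial>M)"
    by (intro nn_integral_cong) (auto simp: R_0)
  moreover have "space M \<inter> {w \<in> space M. path_event R 0 w xs} = {w \<in> space M. path_event R 0 w xs}" by auto
  ultimately show "emeasure M (space M \<inter> {w \<in> space M. path_event R 0 w xs}) = (\<integral>\<^sup>+w. indicator (space M) w * bessel_fdd nu (R w 0) xs \<partial>M)"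
    by (simp add: emeasure_space_1)
qed simp

text \<open>For an indicator this is \<open>markov_at\<close> with a one-element list;
  monotone-class induction does the rest.\<close>

lemma markov_at_step:
  assumes mk: "markov_at s B" and s: "s \<ge> 0" and u: "u > 0" and f: "f \<in> borel_measurable borel"
  shows "(\<integral>\<^sup>+w. indicator B w * f (R w (s + u)) \<partial>M) =
     (\<integral>\<^sup>+w. indicator B w * (\<integral>\<^sup>+y. ennreal (bessel_density nu u (R w s) y) * f y \<partial>lborel) \<partial>M)"
  using f
proof (induction f rule: borel_measurable_induct)
  have su: "s + u \<ge> 0" using s u by simp
  note [measurable] = R_measurable[OF s] R_measurable[OF su]
  have B[measurable]: "B \<in> sets M" using mk by (simp add: markov_at_def)
  {
    case (cong f g)
    then have "f = g" by auto
    then show ?case using cong by simp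
  next
    case (set D)
    have "(\<integral>\<^sup>+w. indicator B w * indicator D (R w (s + u)) \<partial>M) = (\<integral>\<^sup>+w. indicator (B \<inter> {w \<in> space M. path_event R s w [(u, D)]}) w \<partial>M)"
      by (intro nn_integral_cong) (auto simp: indicator_def)
    also have "\<dots> = emeasure M (B \<inter> {w \<in> space M. path_event R s w [(u, D)]})"
      using set u s path_event_measurable[of "[(u, D)]" s] by (intro nn_integral_indicator) auto
    also have "\<dots> = (\<integral>\<^sup>+w. indicator B w * bessel_fdd nu (R w s) [(u, D)] \<partial>M)"
      using mk[unfolded markov_at_def, THEN conjunct2, rule_format, of "[(u, D)]"] set u by simp
    finally show ?case by simp
  next
    case (mult f c)
    note [measurable] = mult(2)
    have "(\<integral>\<^sup>+w. indicator B w * (c * f (R w (s+u))) \<partial>M) = c * (\<integral>\<^sup>+w. indicator B w * f (R w (s+u)) \<partial>M)"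
      by (subst nn_integral_cmult[symmetric]) (auto simp: mult_ac)
    moreover have "(\<integral>\<^sup>+y. ennreal (bessel_density nu u x y) * (c * f y) \<partial>lborel) = c * (\<integral>\<^sup>+y. ennreal (bessel_density nu u x y) * f y \<partial>lborel)" for x
      by (subst nn_integral_cmult[symmetric]) (auto simp: mult_ac)
    moreover have "(\<integral>\<^sup>+w. indicator B w * (c * (\<integral>\<^sup>+y. ennreal (bessel_density nu u (R w s) y) * f y \<partial>lborel)) \<partial>M)
       = c * (\<integral>\<^sup>+w. indicator B w * (\<integral>\<^sup>+y. ennreal (bessel_density nu u (R w s) y) * f y \<partial>lborel) \<partial>M)"
      by (subst nn_integral_cmult[symmetric]) (auto simp: mult_ac)
    ultimately show ?case using mult by simp
  next
    case (add f g)
    note [measurable] = add(1,3)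
    have "(\<integral>\<^sup>+w. indicator B w * (g (R w (s+u)) + f (R w (s+u))) \<partial>M) =
       (\<integral>\<^sup>+w. indicator B w * g (R w (s+u)) \<partial>M) + (\<integral>\<^sup>+w. indicator B w * f (R w (s+u)) \<partial>M)"
      by (subst nn_integral_add[symmetric]) (auto simp: distrib_left)
    moreover have "(\<integral>\<^sup>+y. ennreal (bessel_density nu u x y) * (g y + f y) \<partial>lborel) =
      (\<integral>\<^sup>+y. ennreal (bessel_density nu u x y) * g y \<partial>lborel) + (\<integral>\<^sup>+y. ennreal (bessel_density nu u x y) * f y \<partial>lborel)" for x
      by (subst nn_integral_add[symmetric]) (auto simp: distrib_left)
    moreover have "(\<integral>\<^sup>+w. indicator B w * ((\<integral>\<^sup>+y. ennreal (bessel_density nu u (R w s) y) * g y \<partial>lborel) + (\<integral>\<^sup>+y. ennreal (bessel_density nu u (R w s) y) * f y \<partial>lborel)) \<partial>M)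
      = (\<integral>\<^sup>+w. indicator B w * (\<integral>\<^sup>+y. ennreal (bessel_density nu u (R w s) y) * g y \<partial>lborel) \<partial>M) +
        (\<integral>\<^sup>+w. indicator B w * (\<integral>\<^sup>+y. ennreal (bessel_density nu u (R w s) y) * f y \<partial>lborel) \<partial>M)"
      by (subst nn_integral_add[symmetric]) (auto simp: distrib_left)
    ultimately show ?case using add by simp
  next
    case (seq U)
    note [measurable] = seq(1)
    have inc: "U i y \<le> U j y" if "i \<le> j" for i j y using \<open>incseq U\<close> that by (auto simp: incseq_def le_fun_def)
    have "(\<integral>\<^sup>+w. indicator B w * (SUP i. U i (R w (s+u))) \<partial>M) = (SUP i. \<integral>\<^sup>+w. indicator B w * U i (R w (s+u)) \<partial>M)"
      unfolding SUP_mult_left_ennreal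
      by (intro nn_integral_monotone_convergence_SUP)
         (use inc in \<open>auto simp: incseq_def le_fun_def intro!: mult_left_mono\<close>)
    moreover have "(\<integral>\<^sup>+y. ennreal (bessel_density nu u x y) * (SUP i. U i y) \<partial>lborel) = (SUP i. \<integral>\<^sup>+y. ennreal (bessel_density nu u x y) * U i y \<partial>lborel)" for x
      unfolding SUP_mult_left_ennreal
      by (intro nn_integral_monotone_convergence_SUP)
         (use inc in \<open>auto simp: incseq_def le_fun_def intro!: mult_left_mono\<close>)
    moreover have "(\<integral>\<^sup>+w. indicator B w * (SUP i. \<integral>\<^sup>+y. ennreal (bessel_density nu u (R w s) y) * U i y \<partial>lborel) \<partial>M)
      = (SUP i. \<integral>\<^sup>+w. indicator B w * (\<integral>\<^sup>+y. ennreal (bessel_density nu u (R w s) y) * U i y \<partial>lborel) \<partial>M)"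
      unfolding SUP_mult_left_ennreal
      by (intro nn_integral_monotone_convergence_SUP)
         (use inc in \<open>auto simp: incseq_def le_fun_def intro!: mult_left_mono nn_integral_mono\<close>)
    moreover have "(SUP i. U i) = (\<lambda>y. SUP i. U i y)" by (auto simp: fun_eq_iff image_comp)
    ultimately show ?case using seq by simp
  }
qed

text \<open>A list of constraints after \<open>s + dt\<close> is a longer list after
  \<open>s\<close>; \<open>markov_at_step\<close> then moves the base point of the transitions from
  \<open>s\<close> to \<open>s + dt\<close>.\<close>

lemma markov_at_extend:
  assumes mk: "markov_at s B" and s: "s \<ge> 0" and dt: "dt > 0" and A: "A \<in> sets borel"
  shows "markov_at (s + dt) (B \<inter> {w \<in> space M. R w (s + dt) \<in> A})"
  unfolding markov_at_def
proof (intro conjI allI impI)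
  have B: "B \<in> sets M" using mk by (simp add: markov_at_def)
  moreover have "{w \<in> space M. R w (s + dt) \<in> A} \<in> sets M"
    using path_event_measurable[of "[(dt, A)]" s] s dt A by simp
  ultimately show "B \<inter> {w \<in> space M. R w (s + dt) \<in> A} \<in> sets M" by blast
  fix xs :: "(real \<times> real set) list" assume xs: "\<forall>(dt, A)\<in>set xs. 0 < dt \<and> A \<in> sets borel"
  then have ok: "\<forall>(dt, A)\<in>set ((dt, A) # xs). 0 < dt \<and> A \<in> sets borel" using dt A by simp
  let ?f = "\<lambda>y. indicator A y * bessel_fdd nu y xs"
  have [measurable]: "?f \<in> borel_measurable borel"
    using A borel_measurable_bessel_fdd[OF xs] by measurable
  have "B \<inter> {w \<in> space M. R w (s + dt) \<in> A} \<inter> {w \<in> space M. path_event R (s + dt) w xs} =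
      B \<inter> {w \<in> space M. path_event R s w ((dt, A) # xs)}" by auto
  then have "emeasure M (B \<inter> {w \<in> space M. R w (s + dt) \<in> A} \<inter> {w \<in> space M. path_event R (s + dt) w xs}) =
      (\<integral>\<^sup>+w. indicator B w * bessel_fdd nu (R w s) ((dt, A) # xs) \<partial>M)"
    using mk[unfolded markov_at_def, THEN conjunct2, THEN spec, THEN mp, OF ok] by simp
  also have "\<dots> = (\<integral>\<^sup>+w. indicator B w * ?f (R w (s + dt)) \<partial>M)"
    by (subst markov_at_step[OF mk s dt]) (auto simp: mult.assoc)
  also have "\<dots> = (\<integral>\<^sup>+w. indicator (B \<inter> {w \<in> space M. R w (s + dt) \<in> A}) w * bessel_fdd nu (R w (s + dt)) xs \<partial>M)"
    by (intro nn_integral_cong) (auto simp: indicator_def)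
  finally show "emeasure M (B \<inter> {w \<in> space M. R w (s + dt) \<in> A} \<inter> {w \<in> space M. path_event R (s + dt) w xs}) = \<dots>" .
qed

lemma markov_at_path_event:
  assumes "\<forall>(dt, A)\<in>set ys. 0 < dt \<and> A \<in> sets borel" "markov_at s B" "s \<ge> 0"
  shows "markov_at (s + sum_list (map fst ys)) (B \<inter> {w \<in> space M. path_event R s w ys})"
  using assms
proof (induction ys arbitrary: s B)
  case Nil
  then have "B \<inter> space M = B" using sets.sets_into_space[of B M] by (auto simp: markov_at_def)
  then show ?case using Nil by simp
next
  case (Cons p ys)
  obtain dt A where p: "p = (dt, A)" by force
  have "markov_at (s + dt + sum_list (map fst ys))
      (B \<inter> {w \<in> space M. R w (s + dt) \<in> A} \<inter> {w \<in> space M. path_event R (s + dt) w ys})"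
    using Cons.prems p by (intro Cons.IH markov_at_extend) auto
  moreover have "B \<inter> {w \<in> space M. R w (s + dt) \<in> A} \<inter> {w \<in> space M. path_event R (s + dt) w ys} =
      B \<inter> {w \<in> space M. path_event R s w (p # ys)}" unfolding p by auto
  ultimately show ?case unfolding p by (simp add: add.assoc)
qed

lemma markov_at_INT:
  assumes s: "s \<ge> 0" and B: "\<And>m::nat. markov_at s (B m)" and dec: "decseq B"
  shows "markov_at s (\<Inter>m. B m)"
proof -
  have Bm[measurable]: "B m \<in> sets M" for m using B by (simp add: markov_at_def)
  show ?thesis unfolding markov_at_def
  proof (intro conjI allI impI)
    fix xs :: "(real \<times> real set) list" assume xs: "\<forall>(dt, A)\<in>set xs. 0 < dt \<and> (A :: real set) \<in> sets borel"
    let ?C = "{w \<in> space M. path_event R s w xs}"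
    have [measurable]: "?C \<in> sets M" using xs s by (rule path_event_measurable)
    note [measurable] = R_measurable[OF s] borel_measurable_bessel_fdd[OF xs]
    \<comment> \<open>As the value of a measure, the right-hand side is continuous along decreasing
      sets. \<open>?N\<close> is finite on each \<open>B m\<close> because there it equals a
      probability.\<close>
    let ?N = "density M (\<lambda>w. bessel_fdd nu (R w s) xs)"
    have N: "emeasure ?N X = (\<integral>\<^sup>+w. indicator X w * bessel_fdd nu (R w s) xs \<partial>M)" if "X \<in> sets M" for X
      using that by (subst emeasure_density) (auto simp: mult.commute)
    have eq: "emeasure M (B m \<inter> ?C) = emeasure ?N (B m)" for m
      using B xs by (simp add: N markov_at_def)
    have "(\<lambda>m. emeasure M (B m \<inter> ?C)) \<longlonglongrightarrow> emeasure M (\<Inter>m. B m \<inter> ?C)"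
      using dec by (intro Lim_emeasure_decseq) (auto simp: decseq_def)
    moreover have "(\<lambda>m. emeasure ?N (B m)) \<longlonglongrightarrow> emeasure ?N (\<Inter>m. B m)"
      using dec by (intro Lim_emeasure_decseq) (auto simp: eq[symmetric])
    ultimately have "emeasure M (\<Inter>m. B m \<inter> ?C) = emeasure ?N (\<Inter>m. B m)"
      unfolding eq using LIMSEQ_unique by blast
    then show "emeasure M ((\<Inter>m. B m) \<inter> ?C) = (\<integral>\<^sup>+w. indicator (\<Inter>m. B m) w * bessel_fdd nu (R w s) xs \<partial>M)"
      by (subst (asm) N) auto
  qed auto
qed

lemma markov_at_run_inf:
  assumes s: "s > 0" and A: "A \<in> sets borel"
  shows "markov_at s {w \<in> space M. y \<le> run_inf (R w) s \<and> R w s \<in> A}"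
proof -
  define B where "B m = {w \<in> space M. (\<forall>k\<in>{1..2^m}. y \<le> R w (real k * (s / 2^m))) \<and> R w s \<in> A}" for m :: nat
  have "markov_at s (B m)" for m
  proof -
    let ?d = "s / 2 ^ m"
    \<comment> \<open>The last of the \<open>2 ^ m\<close> grid points is \<open>s\<close> itself,
      so the constraint \<open>A\<close> joins the final entry.\<close>
    let ?ys = "replicate (2^m - 1) (?d, {y..}) @ [(?d, {y..} \<inter> A)]"
    have "\<forall>(dt, A)\<in>set ?ys. 0 < dt \<and> A \<in> sets borel" using s A by auto
    then have "markov_at (0 + sum_list (map fst ?ys)) (space M \<inter> {w \<in> space M. path_event R 0 w ?ys})"
      by (intro markov_at_path_event markov_at_0) auto
    moreover have "space M \<inter> {w \<in> space M. path_event R 0 w ?ys} = {w \<in> space M. path_event R 0 w ?ys}" by auto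
    moreover have sm: "sum_list (map fst ?ys) = s"
      unfolding map_append sum_list_append sum_list_map_fst_replicate using s by (simp add: of_nat_diff field_simps)
    moreover have "path_event R 0 w ?ys \<longleftrightarrow> (\<forall>k\<in>{1..2^m}. y \<le> R w (real k * ?d)) \<and> R w s \<in> A" for w
    proof -
      have "{1..2^m::nat} = insert (2^m) {1..2^m - 1}" by (auto simp: le_less) (metis One_nat_def Suc_leI Suc_pred leD linorder_neqE_nat pos2 zero_less_power)
      moreover have "real (2^m) * ?d = s" by simp
      moreover have "0 + real (2 ^ m - 1) * ?d + ?d = s" using sm
        unfolding map_append sum_list_append sum_list_map_fst_replicate by simp
      ultimately show ?thesis
        unfolding path_event_append path_event_replicate sum_list_map_fst_replicate by simp blast
    qed
    ultimately show ?thesis unfolding B_def by simp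
  qed
  moreover have "decseq B"
  proof (rule decseq_SucI, rule subsetI)
    fix m w assume w: "w \<in> B (Suc m)"
    have "y \<le> R w (real k * (s / 2^m))" if "k \<in> {1..2^m}" for k
    proof -
      have "\<forall>k\<in>{1..2^Suc m}. y \<le> R w (real k * (s / 2^Suc m))"
        using w unfolding B_def mem_Collect_eq by (elim conjE)
      moreover have "2 * k \<in> {1..2^Suc m}" using that by auto
      ultimately have "y \<le> R w (real (2*k) * (s / 2^Suc m))" by (rule bspec)
      then show ?thesis by simp
    qed
    then show "w \<in> B m" using w by (auto simp: B_def)
  qed
  ultimately have "markov_at s (\<Inter>m. B m)" using s by (intro markov_at_INT) auto
  also have "(\<Inter>m. B m) = {w \<in> space M. y \<le> run_inf (R w) s \<and> R w s \<in> A}"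
    using run_inf_ge_iff all_ge_iff_grid[OF R_cont s] s unfolding B_def by auto
  finally show ?thesis .
qed

end

section \<open>The law of the future infimum\<close>

lemma hit_error_nonneg: "nu > 0 \<Longrightarrow> d > 0 \<Longrightarrow> 0 \<le> hit_error nu z z' d"
  using Gamma_real_pos[of nu] Gamma_real_pos[of "nu+1"] Gamma_real_pos[of "nu+3"]
  unfolding hit_error_def by (intro add_nonneg_nonneg) auto

context bessel_path
begin

text \<open>The event splits disjointly by the first grid visit below \<open>z\<close>, and each
  piece is a \<open>path_event\<close> to which \<open>markov_at\<close> applies.\<close>

lemma markov_at_hit:
  assumes mk: "markov_at s B" and s: "s \<ge> 0" and d: "d > 0"
  shows "emeasure M (B \<inter> {w \<in> space M. \<exists>k\<in>{1..n}. R w (s + real k * d) < z})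
     = (\<integral>\<^sup>+w. indicator B w * bessel_hit nu d z n (R w s) \<partial>M)"
proof -
  let ?xs = "\<lambda>k. replicate k (d, {z..}) @ [(d, {..<z})]"
  let ?E = "\<lambda>k. B \<inter> {w \<in> space M. path_event R s w (?xs k)}"
  have ok: "\<forall>(dt, A)\<in>set (?xs k). 0 < dt \<and> A \<in> sets borel" for k using d by auto
  have B[measurable]: "B \<in> sets M" using mk by (simp add: markov_at_def)
  have E: "?E k \<in> sets M" for k using path_event_measurable[OF ok s] B by blast
  have pe: "path_event R s w (?xs k) \<longleftrightarrow> (\<forall>j\<in>{1..k}. z \<le> R w (s + real j * d)) \<and> R w (s + real (Suc k) * d) < z" for w k
    unfolding path_event_append path_event_replicate sum_list_map_fst_replicate
    by (simp add: algebra_simps)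
  have first: "(\<exists>k\<in>{1..n}. P k) \<longleftrightarrow> (\<exists>k<n. (\<forall>j\<in>{1..k}. \<not> P j) \<and> P (Suc k))" for P :: "nat \<Rightarrow> bool"
  proof
    assume "\<exists>k\<in>{1..n}. P k"
    then obtain k where k: "k \<in> {1..n}" "P k" by blast
    define l where "l = (LEAST k. k \<ge> 1 \<and> P k)"
    have l: "l \<ge> 1" "P l" using LeastI[of "\<lambda>k. k \<ge> 1 \<and> P k" k] k unfolding l_def by auto
    have "l \<le> k" unfolding l_def using k by (intro Least_le) auto
    moreover have "\<forall>j\<in>{1..l - 1}. \<not> P j"
      using not_less_Least[of _ "\<lambda>k. k \<ge> 1 \<and> P k"] l(1) unfolding l_def[symmetric] by fastforce
    ultimately show "\<exists>k<n. (\<forall>j\<in>{1..k}. \<not> P j) \<and> P (Suc k)"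
      using l k by (intro exI[of _ "l - 1"]) auto
  next
    assume "\<exists>k<n. (\<forall>j\<in>{1..k}. \<not> P j) \<and> P (Suc k)"
    then obtain k where "k < n" "P (Suc k)" by blast
    then show "\<exists>k\<in>{1..n}. P k" by (intro bexI[of _ "Suc k"]) auto
  qed
  have un: "B \<inter> {w \<in> space M. \<exists>k\<in>{1..n}. R w (s + real k * d) < z} = (\<Union>k<n. ?E k)"
    unfolding first pe by (auto simp: not_less)
  have disj: "disjoint_family_on ?E {..<n}"
  proof -
    have "\<not> (path_event R s w (?xs i) \<and> path_event R s w (?xs j))" if "i < j" for i j w
    proof
      assume *: "path_event R s w (?xs i) \<and> path_event R s w (?xs j)"
      then have "z \<le> R w (s + real (Suc i) * d)" using that unfolding pe by (auto dest: bspec[of _ _ "Suc i"])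
      then show False using * unfolding pe by simp
    qed
    then show ?thesis unfolding disjoint_family_on_def by (auto simp: disjoint_iff) (metis linorder_neqE_nat)
  qed
  have "emeasure M (\<Union>k<n. ?E k) = (\<Sum>k<n. emeasure M (?E k))"
    using E disj by (intro sum_emeasure[symmetric]) auto
  also have "\<dots> = (\<Sum>k<n. \<integral>\<^sup>+w. indicator B w * bessel_fdd nu (R w s) (?xs k) \<partial>M)"
    using mk ok unfolding markov_at_def by (intro sum.cong) auto
  also have "\<dots> = (\<integral>\<^sup>+w. (\<Sum>k<n. indicator B w * bessel_fdd nu (R w s) (?xs k)) \<partial>M)"
  proof (rule nn_integral_sum[symmetric])
    fix k
    note [measurable] = R_measurable[OF s] borel_measurable_bessel_fdd[OF ok[of k]]
    show "(\<lambda>w. indicator B w * bessel_fdd nu (R w s) (?xs k)) \<in> borel_measurable M" by measurable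
  qed
  also have "\<dots> = (\<integral>\<^sup>+w. indicator B w * bessel_hit nu d z n (R w s) \<partial>M)"
    unfolding bessel_hit_def by (simp only: sum_distrib_left)
  finally show ?thesis unfolding un .
qed

text \<open>Transience with a rate: few paths are still below \<open>L\<close> at a late time. This
  disposes of the surviving paths in \<open>markov_at_future_below\<close>.\<close>

lemma prob_below_le:
  assumes "t > 0" "L > 0"
  shows "emeasure M {w \<in> space M. R w t < L} \<le> ennreal (L powr (2*nu+2) / (2 powr nu * Gamma (nu+1) * t powr (nu + 1)))"
proof -
  have "emeasure M {w \<in> space M. path_event R 0 w [(t, {..<L})]} = bessel_fdd nu a [(t, {..<L})]"
    using assms by (intro R_fdd) auto
  also have "\<dots> = (\<integral>\<^sup>+y. ennreal (bessel_density nu t a y) * ennreal (y powr (-0)) * indicator {..<L} y \<partial>lborel)"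
  proof -
    have "ennreal (bessel_density nu t a y) * ennreal (y powr (-0)) = ennreal (bessel_density nu t a y)" for y
      by (cases "y \<le> 0") auto
    then show ?thesis by simp
  qed
  also have "\<dots> \<le> ennreal (L powr (2*nu+2 - 0) * 1 / (2 powr nu * Gamma (nu+1) * t powr (nu + 1)))"
    using assms nu a by (intro nn_integral_bessel_density_below) auto
  finally show ?thesis by simp
qed

text \<open>Upper bound: \<open>bessel_hit_le\<close> on each grid event, and these increase to the
  event in question. Lower bound: \<open>bessel_hit_ge\<close> integrated over \<open>B\<close>;
  first the grid index goes to infinity with \<open>z'\<close> and \<open>L\<close> fixed, then
  \<open>z'\<close> rises to \<open>z\<close> and \<open>L\<close> to infinity.\<close>

lemma markov_at_future_below:
  assumes mk: "markov_at s B" and s: "s \<ge> 0" and z: "z > 0" and Bz: "\<And>w. w \<in> B \<Longrightarrow> z \<le> R w s"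
  shows "emeasure M (B \<inter> {w \<in> space M. \<exists>u\<in>{s..}. R w u < z})
     = (\<integral>\<^sup>+w. indicator B w * (ennreal (z powr (2*nu)) * ennreal (R w s powr (-2*nu))) \<partial>M)"
proof -
  let ?d = "\<lambda>m. 1 / 2 ^ m :: real"
  let ?h = "\<lambda>w. ennreal (R w s powr (-2*nu))"
  define E where "E m = B \<inter> {w \<in> space M. \<exists>k\<in>{1..4^m}. R w (s + real k * ?d m) < z}" for m :: nat
  define p where "p = measure M (B \<inter> {w \<in> space M. \<exists>u\<in>{s..}. R w u < z})"
  have B[measurable]: "B \<in> sets M" using mk by (simp add: markov_at_def)
  note [measurable] = R_measurable[OF s]
  have Em: "E m \<in> sets M" for m
  proof -
    have [measurable]: "(\<lambda>w. R w (s + real k * ?d m)) \<in> borel_measurable M" for k using s by (intro R_measurable) auto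
    show ?thesis unfolding E_def by measurable
  qed
  have hitm: "emeasure M (E m) = (\<integral>\<^sup>+w. indicator B w * bessel_hit nu (?d m) z (4^m) (R w s) \<partial>M)" for m
    unfolding E_def by (rule markov_at_hit[OF mk s]) simp
  have UE: "(\<Union>m. E m) = B \<inter> {w \<in> space M. \<exists>u\<in>{s..}. R w u < z}"
  proof -
    have "(\<exists>u\<in>{s..}. R w u < z) \<longleftrightarrow> (\<exists>m. \<exists>k\<in>{1..4^m}. R w (s + real k * ?d m) < z)" if "w \<in> space M" for w
      using all_ge_iff_grid_infinite[OF R_cont[OF that] s, of z] by (meson not_less)
    then show ?thesis unfolding E_def by blast
  qed
  have inc: "incseq E"
  proof (rule incseq_SucI, rule subsetI)
    fix m w assume "w \<in> E m"
    then obtain k where k: "w \<in> B" "w \<in> space M" "k \<in> {1..4^m}" "R w (s + real k * ?d m) < z"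
      unfolding E_def by blast
    have "R w (s + real (2*k) * ?d (Suc m)) < z" using k(4) by simp
    moreover have "2 * k \<in> {1..4^Suc m}" using k(3) by auto
    ultimately show "w \<in> E (Suc m)" using k(1,2) unfolding E_def by blast
  qed
  have lim: "(\<lambda>m. emeasure M (E m)) \<longlonglongrightarrow> emeasure M (B \<inter> {w \<in> space M. \<exists>u\<in>{s..}. R w u < z})"
    unfolding UE[symmetric] using Em inc by (intro Lim_emeasure_incseq) auto
  have Ele: "emeasure M (E m) \<le> ennreal p" for m
    unfolding p_def emeasure_eq_measure[symmetric] UE[symmetric]
    using Em by (intro emeasure_mono) auto
  have p0: "p \<ge> 0" by (simp add: p_def)

  have upper: "ennreal p \<le> (\<integral>\<^sup>+w. indicator B w * (ennreal (z powr (2*nu)) * ?h w) \<partial>M)"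
    unfolding p_def emeasure_eq_measure[symmetric]
  proof (rule LIMSEQ_le_const2[OF lim], intro exI allI impI)
    fix m
    show "emeasure M (E m) \<le> (\<integral>\<^sup>+w. indicator B w * (ennreal (z powr (2*nu)) * ?h w) \<partial>M)"
      unfolding hitm
    proof (intro nn_integral_mono)
      fix w
      show "indicator B w * bessel_hit nu (?d m) z (4^m) (R w s) \<le> indicator B w * (ennreal (z powr (2*nu)) * ?h w)"
        using Bz[of w] z nu bessel_hit_le[of nu "?d m" "R w s" z "4^m"] by (cases "w \<in> B") auto
    qed
  qed

  have "(\<integral>\<^sup>+w. indicator B w * ?h w \<partial>M) \<le> (\<integral>\<^sup>+w. ennreal (z powr (-2*nu)) \<partial>M)"
  proof (intro nn_integral_mono)
    fix w
    show "indicator B w * ?h w \<le> ennreal (z powr (-2*nu))"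
      using Bz[of w] z nu by (cases "w \<in> B") (auto intro!: ennreal_leI powr_mono2')
  qed
  also have "\<dots> < \<top>" by (simp add: emeasure_space_1)
  finally have fin: "(\<integral>\<^sup>+w. indicator B w * ?h w \<partial>M) < \<top>" .
  define x where "x = enn2real (\<integral>\<^sup>+w. indicator B w * ?h w \<partial>M)"
  have x: "x \<ge> 0" "(\<integral>\<^sup>+w. indicator B w * ?h w \<partial>M) = ennreal x"
    using fin unfolding x_def by (auto simp only: ennreal_enn2real enn2real_nonneg)

  have ineq: "x \<le> z' powr (-2*nu) * p + L powr (-2*nu)" if z': "0 < z'" "z' < z" and L: "L > 0" for z' L
  proof -
    define c where "c m = L powr (2*nu+2) / (2 powr nu * Gamma (nu+1) * (s + 2 ^ m) powr (nu + 1))" for m :: nat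
    have G0: "Gamma (nu+1) > 0" using nu by (intro Gamma_real_pos) auto
    have c0: "c m \<ge> 0" for m using G0 by (simp add: c_def)
    \<comment> \<open>Survivors ending below \<open>L\<close> are in particular below
      \<open>L\<close> at the single time \<open>s + 2 ^ m\<close>, the last grid time.\<close>
    have surv: "(\<integral>\<^sup>+w. indicator B w * bessel_survive nu (?d m) z L (4^m) (R w s) \<partial>M) \<le> ennreal (c m)" for m
    proof -
      obtain n where n: "4 ^ m = Suc n" using not0_implies_Suc[of "4^m"] by auto
      let ?xs = "replicate n (?d m, {z..}) @ [(?d m, {z..<L})]"
      have ok: "\<forall>(dt, A)\<in>set ?xs. 0 < dt \<and> A \<in> sets borel" by auto
      have "real n + 1 = 4 ^ m" using n by (metis of_nat_Suc of_nat_numeral of_nat_power add.commute)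
      also have "\<dots> = (2 ^ m * 2 ^ m :: real)" by (simp flip: power_mult_distrib)
      finally have "(real n + 1) * ?d m = 2 ^ m" by simp
      then have T: "s + real n * ?d m + ?d m = s + 2 ^ m" by (simp add: add_divide_distrib)
      have "(\<integral>\<^sup>+w. indicator B w * bessel_survive nu (?d m) z L (4^m) (R w s) \<partial>M) = emeasure M (B \<inter> {w \<in> space M. path_event R s w ?xs})"
        unfolding n bessel_survive_def using mk ok by (simp add: markov_at_def)
      also have "\<dots> \<le> emeasure M {w \<in> space M. R w (s + 2 ^ m) < L}"
      proof (rule emeasure_mono)
        show "B \<inter> {w \<in> space M. path_event R s w ?xs} \<subseteq> {w \<in> space M. R w (s + 2 ^ m) < L}"
          unfolding path_event_append sum_list_map_fst_replicate path_event.simps T by auto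
        have [measurable]: "(\<lambda>w. R w (s + 2 ^ m)) \<in> borel_measurable M" using s by (intro R_measurable) auto
        show "{w \<in> space M. R w (s + 2 ^ m) < L} \<in> sets M" by measurable
      qed
      also have "\<dots> \<le> ennreal (c m)" unfolding c_def using s L by (intro prob_below_le) (auto intro: add_nonneg_pos)
      finally show ?thesis .
    qed
    define e where "e m = real (4 ^ m) * hit_error nu z z' (?d m)" for m
    have e0: "e m \<ge> 0" for m unfolding e_def using nu by (intro mult_nonneg_nonneg hit_error_nonneg) auto
    have "x \<le> z' powr (-2*nu) * p + z powr (-2*nu) * c m + (L powr (-2*nu) + e m)" for m
    proof -
      note [measurable] = bessel_hit_measurable[of "?d m" nu z "4^m"] bessel_survive_measurable[of "?d m" nu z L "4^m"]
      let ?e = "ennreal (L powr (-2*nu)) + of_nat (4^m) * ennreal (hit_error nu z z' (?d m))"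
      have ee: "?e = ennreal (L powr (-2*nu) + e m)"
        unfolding e_def using nu hit_error_nonneg[of nu "?d m" z z']
        by (subst ennreal_plus) (auto simp: ennreal_mult ennreal_of_nat_eq_real_of_nat simp del: of_nat_power)
      have "(\<integral>\<^sup>+w. indicator B w * ?h w \<partial>M) \<le> (\<integral>\<^sup>+w. ennreal (z' powr (-2*nu)) * (indicator B w * bessel_hit nu (?d m) z (4^m) (R w s))
         + (ennreal (z powr (-2*nu)) * (indicator B w * bessel_survive nu (?d m) z L (4^m) (R w s)) + ?e) \<partial>M)"
      proof (intro nn_integral_mono)
        fix w
        show "indicator B w * ?h w \<le> ennreal (z' powr (-2*nu)) * (indicator B w * bessel_hit nu (?d m) z (4^m) (R w s))
         + (ennreal (z powr (-2*nu)) * (indicator B w * bessel_survive nu (?d m) z L (4^m) (R w s)) + ?e)"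
          using bessel_hit_ge[of nu "?d m" z' z "R w s" L "4^m"] Bz[of w] z' L nu
          by (cases "w \<in> B") (auto simp: add.assoc)
      qed
      also have "\<dots> = ennreal (z' powr (-2*nu)) * emeasure M (E m)
         + (ennreal (z powr (-2*nu)) * (\<integral>\<^sup>+w. indicator B w * bessel_survive nu (?d m) z L (4^m) (R w s) \<partial>M) + ?e)"
        unfolding hitm by (simp add: nn_integral_add nn_integral_cmult emeasure_space_1)
      also have "\<dots> \<le> ennreal (z' powr (-2*nu)) * ennreal p + (ennreal (z powr (-2*nu)) * ennreal (c m) + ?e)"
        by (intro add_mono mult_left_mono Ele surv order_refl) auto
      also have "\<dots> = ennreal (z' powr (-2*nu) * p + (z powr (-2*nu) * c m + (L powr (-2*nu) + e m)))"
        unfolding ee using p0 c0 e0 by (simp add: ennreal_mult)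
      finally have "ennreal x \<le> ennreal (z' powr (-2*nu) * p + (z powr (-2*nu) * c m + (L powr (-2*nu) + e m)))"
        unfolding x(2) .
      then show ?thesis using p0 c0 e0 by (subst (asm) ennreal_le_iff) (auto intro!: add_nonneg_nonneg)
    qed
    moreover have "(\<lambda>m. z' powr (-2*nu) * p + z powr (-2*nu) * c m + (L powr (-2*nu) + e m)) \<longlonglongrightarrow>
        z' powr (-2*nu) * p + z powr (-2*nu) * 0 + (L powr (-2*nu) + 0)"
    proof (intro tendsto_intros)
      show "e \<longlonglongrightarrow> 0" unfolding e_def using nu z' by (intro hit_error_tendsto) auto
      define q where "q = 2 powr nu * Gamma (nu+1)"
      have "q > 0" using G0 by (simp add: q_def)
      then show "c \<longlonglongrightarrow> 0" unfolding c_def q_def[symmetric] using nu s by real_asymp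
    qed
    ultimately have "x \<le> z' powr (-2*nu) * p + z powr (-2*nu) * 0 + (L powr (-2*nu) + 0)"
      by (intro LIMSEQ_le_const) auto
    then show ?thesis by simp
  qed
  \<comment> \<open>One parameter \<open>e\<close> drives both remaining limits:
    \<open>z' = z - e\<close> and \<open>L = 1 / e\<close>.\<close>
  have "x \<le> z powr (-2*nu) * p + 0"
  proof (rule tendsto_lowerbound)
    have "((\<lambda>e. (z - e) powr (-2*nu)) \<longlongrightarrow> (z - 0) powr (-2*nu)) (at_right 0)"
      using z by (intro tendsto_intros) auto
    moreover have "((\<lambda>e. (1/e) powr (-2*nu)) \<longlongrightarrow> 0) (at_right 0)" using nu by real_asymp
    ultimately show "((\<lambda>e. (z - e) powr (-2*nu) * p + (1/e) powr (-2*nu)) \<longlongrightarrow> z powr (-2*nu) * p + 0) (at_right 0)"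
      by (intro tendsto_add tendsto_mult tendsto_const) auto
    show "\<forall>\<^sub>F e in at_right 0. x \<le> (z - e) powr (-2*nu) * p + (1/e) powr (-2*nu)"
      using z by (intro eventually_at_rightI[of 0 z] ineq) auto
  qed simp
  then have "z powr (2*nu) * x \<le> z powr (2*nu) * (z powr (-2*nu) * p)" by (intro mult_left_mono) auto
  also have "\<dots> = p" using z by (simp add: powr_minus)
  finally have "ennreal (z powr (2*nu) * x) \<le> ennreal p" by (rule ennreal_leI)
  moreover have "(\<integral>\<^sup>+w. indicator B w * (ennreal (z powr (2*nu)) * ?h w) \<partial>M) = ennreal (z powr (2*nu) * x)"
  proof -
    have "(\<integral>\<^sup>+w. indicator B w * (ennreal (z powr (2*nu)) * ?h w) \<partial>M) = (\<integral>\<^sup>+w. ennreal (z powr (2*nu)) * (indicator B w * ?h w) \<partial>M)"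
      by (intro nn_integral_cong) (simp add: mult_ac)
    also have "\<dots> = ennreal (z powr (2*nu)) * ennreal x" unfolding x(2)[symmetric] by (intro nn_integral_cmult) measurable
    finally show ?thesis using x(1) by (simp add: ennreal_mult)
  qed
  ultimately show ?thesis using upper unfolding p_def emeasure_eq_measure[symmetric] by (simp add: antisym)
qed

end

section \<open>Uniqueness of measures from half-lines and quadrants\<close>

lemma measure_eqI_Ici:
  fixes M N :: "real measure"
  assumes sets: "sets M = sets borel" "sets N = sets borel"
    and fin: "\<And>x. emeasure M {x..} < \<infinity>" and eq: "\<And>x. emeasure M {x..} = emeasure N {x..}"
  shows "M = N"
proof (rule measure_eqI_generator_eq[where E="range (\<lambda>x::real. {x..})" and \<Omega>=UNIV and A="\<lambda>n. {- real n..}"])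
  have "{x..} \<inter> {y..} = {max x y..}" for x y :: real by auto
  then show "Int_stable (range (\<lambda>x::real. {x..}))" by (auto simp: Int_stable_def)
  show "sets M = sigma_sets UNIV (range (\<lambda>x::real. {x..}))" "sets N = sigma_sets UNIV (range (\<lambda>x::real. {x..}))"
    unfolding sets borel_Ici by auto
  have "\<exists>n::nat. - real n \<le> x" for x :: real using real_arch_simple[of "-x"] by (auto simp: minus_le_iff)
  then show "(\<Union>i. {- real i..}) = UNIV" by auto
  show "emeasure M {- real i..} \<noteq> \<infinity>" for i using fin[of "- real i"] by simp
qed (use eq in auto)

lemma measure_eqI_Iio:
  fixes M N :: "real measure"
  assumes sets: "sets M = sets borel" "sets N = sets borel"
    and fin: "\<And>x. emeasure M {..<x} < \<infinity>" and eq: "\<And>x. emeasure M {..<x} = emeasure N {..<x}"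
  shows "M = N"
proof (rule measure_eqI_generator_eq[where E="range lessThan" and \<Omega>=UNIV and A="\<lambda>n. {..<real n}"])
  have "{..<x} \<inter> {..<y} = {..<min x y}" for x y :: real by auto
  then show "Int_stable (range lessThan :: real set set)" by (auto simp: Int_stable_def)
  show "sets M = sigma_sets UNIV (range lessThan)" "sets N = sigma_sets UNIV (range lessThan)"
    unfolding sets borel_Iio by auto
  show "(\<Union>i. {..<real i}) = UNIV" using reals_Archimedean2 by auto
  show "emeasure M {..<real i} \<noteq> \<infinity>" for i using fin[of "real i"] by simp
qed (use eq in auto)

text \<open>The generators fit what the Markov argument computes: \<open>{y..}\<close> for the past
  infimum, \<open>{..<z}\<close> for the future one. They cover each factor countably, as
  \<open>sigma_prod\<close> demands.\<close>

lemma measure_eqI_Ici_Iio: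
  fixes M N :: "(real \<times> real) measure"
  assumes sets: "sets M = sets (borel \<Otimes>\<^sub>M borel)" "sets N = sets (borel \<Otimes>\<^sub>M borel)"
    and fin: "\<And>y z. emeasure M ({y..} \<times> {..<z}) < \<infinity>"
    and eq: "\<And>y z. emeasure M ({y..} \<times> {..<z}) = emeasure N ({y..} \<times> {..<z})"
  shows "M = N"
proof -
  let ?E = "{a \<times> b |a b. a \<in> range (\<lambda>x::real. {x..}) \<and> b \<in> range (lessThan :: real \<Rightarrow> _)}"
  have c1: "(\<Union>i::nat. {- real i..}) = UNIV"
  proof -
    have "\<exists>n::nat. - real n \<le> x" for x :: real using real_arch_simple[of "-x"] by (auto simp: minus_le_iff)
    then show ?thesis by auto
  qed
  have c2: "(\<Union>i::nat. {..<real i}) = UNIV" using reals_Archimedean2 by auto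
  have "sigma UNIV (range (\<lambda>x::real. {x..})) \<Otimes>\<^sub>M sigma UNIV (range (lessThan :: real \<Rightarrow> _)) = sigma (UNIV \<times> UNIV) ?E"
  proof (rule sigma_prod)
    show "\<exists>E\<subseteq>range (\<lambda>x::real. {x..}). countable E \<and> UNIV = \<Union>E"
      using c1 by (intro exI[of _ "range (\<lambda>i::nat. {- real i..})"]) auto
    show "\<exists>E\<subseteq>range (lessThan :: real \<Rightarrow> _). countable E \<and> UNIV = \<Union>E"
      using c2 by (intro exI[of _ "range (\<lambda>i::nat. {..<real i})"]) auto
  qed auto
  then have "(borel \<Otimes>\<^sub>M borel :: (real \<times> real) measure) = sigma UNIV ?E"
    by (simp flip: borel_Ici borel_Iio)
  then have s: "sets (borel \<Otimes>\<^sub>M borel :: (real \<times> real) measure) = sigma_sets UNIV ?E"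
    by (metis (no_types, lifting) Pow_UNIV sets_measure_of subset_UNIV)
  show ?thesis
  proof (rule measure_eqI_generator_eq[where E="?E" and \<Omega>=UNIV and A="\<lambda>n. {- real n..} \<times> {..<real n}"])
    show "Int_stable ?E"
    proof (rule Int_stableI)
      fix a b assume "a \<in> ?E" "b \<in> ?E"
      then obtain y z y' z' where "a = {y..} \<times> {..<z}" "b = {y'..} \<times> {..<z'}" by auto
      then have "a \<inter> b = {max y y'..} \<times> {..<min z z'}" by auto
      then show "a \<inter> b \<in> ?E" by blast
    qed
    have "\<exists>n::nat. - real n \<le> x \<and> y < real n" for x y :: real
      using reals_Archimedean2[of "max (-x) y"] by (metis less_eq_real_def max_less_iff_conj minus_le_iff)
    then show "(\<Union>i. {- real i..} \<times> {..<real i}) = UNIV" by auto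
    show "emeasure M ({- real i..} \<times> {..<real i}) \<noteq> \<infinity>" for i using fin[of "- real i" "real i"] by simp
  qed (use eq sets s in auto)
qed

text \<open>The Beta law with parameters \<open>2*nu\<close> and 1, that is, the law of
  \<open>U powr (1 / (2*nu))\<close> for \<open>U\<close> uniform on the unit interval. It will be
  the law of the future infimum divided by the current position.\<close>

definition power_law :: "real \<Rightarrow> real measure" where
  "power_law nu = density lborel (\<lambda>v. ennreal (2 * nu * v powr (2*nu - 1)) * indicator {0<..<1} v)"

lemma powr_has_integral:
  fixes nu c :: real
  assumes "nu > 0" "c \<ge> 0"
  shows "((\<lambda>v. 2 * nu * v powr (2*nu - 1)) has_integral c powr (2*nu)) {0..c}"
proof -
  have "((\<lambda>v. 2 * nu * v powr (2*nu - 1)) has_integral (c powr (2*nu) - 0 powr (2*nu))) {0..c}"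
  \<comment> \<open>The primitive is continuous up to 0 even where its derivative blows up there, so
    differentiability is asked for in the interior only.\<close>
  proof (rule fundamental_theorem_of_calculus_interior)
    show "continuous_on {0..c} (\<lambda>v. v powr (2*nu))"
      using assms by (intro continuous_on_powr') (auto intro!: continuous_intros)
    show "((\<lambda>v. v powr (2*nu)) has_vector_derivative 2*nu * x powr (2*nu-1)) (at x)" if "x \<in> {0<..<c}" for x
      using that has_real_derivative_powr[of x "2*nu"] by (simp add: has_real_derivative_iff_has_vector_derivative)
  qed (use assms in auto)
  then show ?thesis by simp
qed

lemma sets_power_law [measurable_cong, simp]: "sets (power_law nu) = sets borel"
  and space_power_law [simp]: "space (power_law nu) = UNIV"
  by (simp_all add: power_law_def)

lemma emeasure_power_law:
  assumes "nu > 0" "0 \<le> c" "c \<le> 1"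
  shows "emeasure (power_law nu) {..<c} = ennreal (c powr (2*nu))"
proof -
  have "emeasure (power_law nu) {..<c} = (\<integral>\<^sup>+v. ennreal (2 * nu * v powr (2*nu - 1)) * indicator {0<..<1} v * indicator {..<c} v \<partial>lborel)"
    unfolding power_law_def by (subst emeasure_density) auto
  also have "\<dots> = (\<integral>\<^sup>+v. ennreal (2 * nu * v powr (2*nu - 1)) * indicator {0..c} v \<partial>lborel)"
  proof (rule nn_integral_cong_AE)
    \<comment> \<open>Excluding \<open>v = c\<close> reconciles the strict and the weak upper bound;
      at \<open>v = 0\<close> both sides vanish because \<open>0 powr r\<close> is 0.\<close>
    have "AE v in lborel. v \<noteq> c" by (rule AE_lborel_singleton)
    then show "AE v in lborel. ennreal (2 * nu * v powr (2*nu - 1)) * indicator {0<..<1} v * indicator {..<c} v = ennreal (2 * nu * v powr (2*nu - 1)) * indicator {0..c} v"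
    proof eventually_elim
      case (elim v)
      then show ?case using assms by (cases "v = 0") (auto simp: indicator_def)
    qed
  qed
  also have "\<dots> = ennreal (c powr (2*nu))"
    using assms by (intro nn_integral_has_integral_lebesgue' powr_has_integral) auto
  finally show ?thesis .
qed

lemma
  assumes "nu > 0"
  shows emeasure_space_power_law: "emeasure (power_law nu) (space (power_law nu)) = 1"
    and AE_power_law: "AE v in power_law nu. 0 < v \<and> v < 1"
proof -
  show ae: "AE v in power_law nu. 0 < v \<and> v < 1"
    unfolding power_law_def by (subst AE_density) (auto simp: indicator_def)
  have "emeasure (power_law nu) (space (power_law nu)) = emeasure (power_law nu) {..<1}"
    using ae by (intro emeasure_eq_AE) auto
  then show "emeasure (power_law nu) (space (power_law nu)) = 1"
    using emeasure_power_law[OF assms, of 1] by simp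
qed

lemma prob_space_power_law: "nu > 0 \<Longrightarrow> prob_space (power_law nu)"
  by (rule prob_spaceI) (rule emeasure_space_power_law)

lemma emeasure_power_law_scaled:
  assumes "nu > 0" "x > 0" "z > 0"
  shows "emeasure (power_law nu) {v. x * v < z} = (if x < z then 1 else ennreal (z powr (2*nu)) * ennreal (x powr (-2*nu)))"
proof -
  have eq: "{v. x * v < z} = {..<z/x}" using assms by (auto simp: field_simps)
  show ?thesis
  proof (cases "x < z")
    case True
    interpret prob_space "power_law nu" using assms(1) by (rule prob_space_power_law)
    have zx: "z / x > 1" using True assms by simp
    have "AE v in power_law nu. v < z/x"
      using AE_power_law[OF assms(1)] by eventually_elim (use zx in auto)
    then have "emeasure (power_law nu) {v \<in> space (power_law nu). v < z/x} = 1"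
      by (intro emeasure_eq_1_AE) auto
    moreover have "{v \<in> space (power_law nu). v < z/x} = {..<z/x}" by auto
    ultimately show ?thesis using True by (simp add: eq)
  next
    case False
    then have "(z/x) powr (2*nu) = z powr (2*nu) * x powr (-2*nu)"
      using assms powr_minus_divide[of x "2*nu"] by (simp add: powr_divide)
    then show ?thesis using False assms unfolding eq
      by (subst emeasure_power_law) (auto simp: ennreal_mult)
  qed
qed

context bessel_path
begin

lemma AE_bdd_below: "AE w in M. \<forall>s\<ge>0. bdd_below (R w ` {s..}) \<and> 0 \<le> future_inf w s"
  using AE_nonneg
proof eventually_elim
  case (elim w)
  show ?case
  proof (intro allI impI)
    fix s :: real assume s: "s \<ge> 0"
    have b: "bdd_below (R w ` {s..})" using elim s by (intro bdd_belowI[of _ 0]) auto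
    show "bdd_below (R w ` {s..}) \<and> 0 \<le> future_inf w s"
      using b future_inf_ge_iff[OF b, of 0] elim s by auto
  qed
qed

text \<open>If \<open>R w s < z\<close>, the future infimum is below \<open>z\<close> at once, since
  \<open>s\<close> belongs to the future; otherwise \<open>markov_at_future_below\<close> applies.
  These are the two branches of \<open>emeasure_power_law_scaled\<close>.\<close>

lemma emeasure_run_inf_future_inf:
  assumes s: "s > 0" and z: "z > 0"
  shows "emeasure M {w \<in> space M. y \<le> run_inf (R w) s \<and> future_inf w s < z} =
    (\<integral>\<^sup>+w. indicator {w \<in> space M. y \<le> run_inf (R w) s} w * emeasure (power_law nu) {v. R w s * v < z} \<partial>M)"
proof -
  let ?A = "{w \<in> space M. y \<le> run_inf (R w) s}"
  let ?A1 = "{w \<in> space M. y \<le> run_inf (R w) s \<and> R w s \<in> {..<z}}"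
  let ?A2 = "{w \<in> space M. y \<le> run_inf (R w) s \<and> R w s \<in> {z..}}"
  let ?F = "{w \<in> space M. \<exists>u\<in>{s..}. R w u < z}"
  have s0: "s \<ge> 0" using s by simp
  note [measurable] = R_measurable[OF s0] run_inf_measurable[OF s] future_inf_measurable[OF s0]
  have F[measurable]: "?F \<in> sets M"
  proof -
    have "?F = space M - {w \<in> space M. \<forall>u\<in>{s..}. z \<le> R w u}" by (force simp: not_le)
    then show ?thesis using all_ge_future_measurable[OF s0, of z] by simp
  qed
  have mk: "markov_at s ?A2" using s by (intro markov_at_run_inf) auto
  have "emeasure M {w \<in> space M. y \<le> run_inf (R w) s \<and> future_inf w s < z} = emeasure M (?A1 \<union> (?A2 \<inter> ?F))"
  proof (rule emeasure_eq_AE)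
    show "AE w in M. w \<in> {w \<in> space M. y \<le> run_inf (R w) s \<and> future_inf w s < z} \<longleftrightarrow> w \<in> ?A1 \<union> (?A2 \<inter> ?F)"
      using AE_bdd_below
    proof eventually_elim
      case (elim w)
      have b: "bdd_below (R w ` {s..})" using elim[rule_format, OF s0] by simp
      have "future_inf w s < z \<longleftrightarrow> (\<exists>u\<in>{s..}. R w u < z)"
        using future_inf_ge_iff[OF b, of z] by (meson not_le)
      then show ?case by (auto simp: not_le)
    qed
  qed measurable
  also have "\<dots> = emeasure M ?A1 + emeasure M (?A2 \<inter> ?F)"
    by (rule plus_emeasure[symmetric]) auto
  also have "emeasure M (?A2 \<inter> ?F) = (\<integral>\<^sup>+w. indicator ?A2 w * (ennreal (z powr (2*nu)) * ennreal (R w s powr (-2*nu))) \<partial>M)"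
    using mk s z by (intro markov_at_future_below) auto
  also have "emeasure M ?A1 = (\<integral>\<^sup>+w. indicator ?A1 w \<partial>M)" by simp
  also have "(\<integral>\<^sup>+w. indicator ?A1 w \<partial>M) + (\<integral>\<^sup>+w. indicator ?A2 w * (ennreal (z powr (2*nu)) * ennreal (R w s powr (-2*nu))) \<partial>M)
     = (\<integral>\<^sup>+w. indicator ?A1 w + indicator ?A2 w * (ennreal (z powr (2*nu)) * ennreal (R w s powr (-2*nu))) \<partial>M)"
    by (rule nn_integral_add[symmetric]) measurable
  also have "\<dots> = (\<integral>\<^sup>+w. indicator ?A w * emeasure (power_law nu) {v. R w s * v < z} \<partial>M)"
  proof (rule nn_integral_cong_AE)
    show "AE w in M. indicator ?A1 w + indicator ?A2 w * (ennreal (z powr (2*nu)) * ennreal (R w s powr (-2*nu)))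
      = indicator ?A w * emeasure (power_law nu) {v. R w s * v < z}"
      using AE_pos[OF s]
    proof eventually_elim
      case (elim w)
      show ?case unfolding emeasure_power_law_scaled[OF nu elim z] by (auto simp: indicator_def)
    qed
  qed
  finally show ?thesis .
qed

text \<open>A conditional law without conditional expectations: the product with
  \<open>power_law nu\<close> adjoins an independent \<open>V\<close>, and the future infimum
  behaves like \<open>R_s V\<close> jointly with the past infimum.\<close>

lemma distr_run_inf_future_inf:
  assumes s: "s > 0"
  shows "distr M (borel \<Otimes>\<^sub>M borel) (\<lambda>w. (run_inf (R w) s, future_inf w s)) =
    distr (M \<Otimes>\<^sub>M power_law nu) (borel \<Otimes>\<^sub>M borel) (\<lambda>(w, v). (run_inf (R w) s, R w s * v))" (is "?L = ?R")
proof (rule measure_eqI_Ici_Iio)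
  have s0: "s \<ge> 0" using s by simp
  interpret D: prob_space "power_law nu" using nu by (rule prob_space_power_law)
  note [measurable] = R_measurable[OF s0] run_inf_measurable[OF s] future_inf_measurable[OF s0]
  interpret L: prob_space ?L by (rule prob_space_distr) measurable
  fix y z
  show "emeasure ?L ({y..} \<times> {..<z}) < \<infinity>" by (simp add: L.emeasure_eq_measure)
  have L: "emeasure ?L ({y..} \<times> {..<z}) = emeasure M {w \<in> space M. y \<le> run_inf (R w) s \<and> future_inf w s < z}"
    by (subst emeasure_distr) (auto intro!: arg_cong[where f="emeasure M"])
  have "emeasure ?R ({y..} \<times> {..<z}) = (\<integral>\<^sup>+x. indicator ({y..} \<times> {..<z}) x \<partial>?R)"
    by (subst nn_integral_indicator) auto
  also have "\<dots> = (\<integral>\<^sup>+x. indicator ({y..} \<times> {..<z}) (case x of (w, v) \<Rightarrow> (run_inf (R w) s, R w s * v)) \<partial>(M \<Otimes>\<^sub>M power_law nu))"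
    by (rule nn_integral_distr) measurable
  also have "\<dots> = (\<integral>\<^sup>+w. \<integral>\<^sup>+v. indicator ({y..} \<times> {..<z}) (run_inf (R w) s, R w s * v) \<partial>power_law nu \<partial>M)"
    by (subst D.nn_integral_fst[symmetric]) auto
  also have "\<dots> = (\<integral>\<^sup>+w. \<integral>\<^sup>+v. indicator {w \<in> space M. y \<le> run_inf (R w) s} w * indicator {v. R w s * v < z} v \<partial>power_law nu \<partial>M)"
    by (intro nn_integral_cong) (auto simp: indicator_def)
  also have "\<dots> = (\<integral>\<^sup>+w. indicator {w \<in> space M. y \<le> run_inf (R w) s} w * emeasure (power_law nu) {v. R w s * v < z} \<partial>M)"
    by (intro nn_integral_cong) (subst nn_integral_cmult, auto)
  finally have R: "emeasure ?R ({y..} \<times> {..<z}) = (\<integral>\<^sup>+w. indicator {w \<in> space M. y \<le> run_inf (R w) s} w * emeasure (power_law nu) {v. R w s * v < z} \<partial>M)" .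
  show "emeasure ?L ({y..} \<times> {..<z}) = emeasure ?R ({y..} \<times> {..<z})"
  proof (cases "z > 0")
    case True
    then show ?thesis unfolding L R using emeasure_run_inf_future_inf[OF s] by simp
  next
    \<comment> \<open>For \<open>z \<le> 0\<close> both sides vanish: paths are almost surely
      nonnegative and \<open>R_s V\<close> is almost surely positive.\<close>
    case False
    have "emeasure M {w \<in> space M. y \<le> run_inf (R w) s \<and> future_inf w s < z} = emeasure M {}"
    proof (rule emeasure_eq_AE)
      show "AE w in M. w \<in> {w \<in> space M. y \<le> run_inf (R w) s \<and> future_inf w s < z} \<longleftrightarrow> w \<in> {}"
        using AE_bdd_below
      proof eventually_elim
        case (elim w)
        have "0 \<le> future_inf w s" using elim[rule_format, OF s0] by simp
        then show ?case using False by auto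
      qed
    qed measurable
    moreover have "(\<integral>\<^sup>+w. indicator {w \<in> space M. y \<le> run_inf (R w) s} w * emeasure (power_law nu) {v. R w s * v < z} \<partial>M) = (\<integral>\<^sup>+w. 0 \<partial>M)"
    proof (rule nn_integral_cong_AE)
      show "AE w in M. indicator {w \<in> space M. y \<le> run_inf (R w) s} w * emeasure (power_law nu) {v. R w s * v < z} = 0"
        using AE_pos[OF s]
      proof eventually_elim
        case (elim w)
        have "emeasure (power_law nu) {v. R w s * v < z} = emeasure (power_law nu) {}"
        proof (rule emeasure_eq_AE)
          show "AE v in power_law nu. v \<in> {v. R w s * v < z} \<longleftrightarrow> v \<in> {}"
            using AE_power_law[OF nu]
          proof eventually_elim
            case (elim v)
            then have "R w s * v > 0" using \<open>R w s > 0\<close> by simp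
            then show ?case using False by auto
          qed
        qed auto
        then show ?case by simp
      qed
    qed
    ultimately show ?thesis unfolding L R by simp
  qed
qed simp_all

text \<open>The analogue at time 0, where \<open>markov_at_0\<close> conditions on the whole space
  and the position is the constant \<open>a\<close>.\<close>

lemma distr_total_inf: "distr M borel (\<lambda>w. total_inf (R w)) = distr (power_law nu) borel (\<lambda>v. a * v)" (is "?L = ?R")
proof (rule measure_eqI_Iio)
  interpret D: prob_space "power_law nu" using nu by (rule prob_space_power_law)
  note [measurable] = total_inf_measurable
  interpret L: prob_space ?L by (rule prob_space_distr) measurable
  interpret R': prob_space ?R by (rule D.prob_space_distr) measurable
  fix z
  show "emeasure ?L {..<z} < \<infinity>" by (simp add: L.emeasure_eq_measure)
  have L: "emeasure ?L {..<z} = emeasure M {w \<in> space M. total_inf (R w) < z}"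
    by (subst emeasure_distr) (auto intro!: arg_cong[where f="emeasure M"])
  have R: "emeasure ?R {..<z} = emeasure (power_law nu) {v. a * v < z}"
    by (subst emeasure_distr) (auto intro!: arg_cong[where f="emeasure (power_law nu)"])
  have ae: "AE w in M. total_inf (R w) < z \<longleftrightarrow> (\<exists>u\<in>{0..}. R w u < z)"
    using AE_bdd_below
  proof eventually_elim
    case (elim w)
    have b: "bdd_below (R w ` {0..})" using elim[rule_format, of 0] by simp
    show ?case unfolding total_inf_eq using future_inf_ge_iff[OF b, of z] by (meson not_le)
  qed
  have F: "{w \<in> space M. \<exists>u\<in>{0..}. R w u < z} \<in> sets M"
  proof -
    have "{w \<in> space M. \<exists>u\<in>{0..}. R w u < z} = space M - {w \<in> space M. \<forall>u\<in>{0..}. z \<le> R w u}" by (force simp: not_le)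
    then show ?thesis using all_ge_future_measurable[of 0 z] by simp
  qed
  have L2: "emeasure M {w \<in> space M. total_inf (R w) < z} = emeasure M {w \<in> space M. \<exists>u\<in>{0..}. R w u < z}"
    using ae F by (intro emeasure_eq_AE) auto
  consider "z \<le> 0" | "0 < z" "z \<le> a" | "a < z" by linarith
  then show "emeasure ?L {..<z} = emeasure ?R {..<z}"
  proof cases
    case 1
    have "emeasure M {w \<in> space M. \<exists>u\<in>{0..}. R w u < z} = emeasure M {}"
    proof (rule emeasure_eq_AE)
      show "AE w in M. w \<in> {w \<in> space M. \<exists>u\<in>{0..}. R w u < z} \<longleftrightarrow> w \<in> {}"
        using AE_nonneg
      proof eventually_elim
        case (elim w)
        show ?case using bspec[OF elim] 1 by fastforce
      qed
    qed (use F in auto)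
    moreover have "emeasure (power_law nu) {v. a * v < z} = emeasure (power_law nu) {}"
    proof (rule emeasure_eq_AE)
      show "AE v in power_law nu. v \<in> {v. a * v < z} \<longleftrightarrow> v \<in> {}"
        using AE_power_law[OF nu]
      proof eventually_elim
        case (elim v)
        then have "a * v > 0" using a by simp
        then show ?case using 1 by auto
      qed
    qed auto
    ultimately show ?thesis unfolding L R L2 by simp
  next
    case 2
    have "emeasure M (space M \<inter> {w \<in> space M. \<exists>u\<in>{0..}. R w u < z})
     = (\<integral>\<^sup>+w. indicator (space M) w * (ennreal (z powr (2*nu)) * ennreal (R w 0 powr (-2*nu))) \<partial>M)"
      using 2 R_0 by (intro markov_at_future_below markov_at_0) auto
    also have "\<dots> = (\<integral>\<^sup>+w. ennreal (z powr (2*nu)) * ennreal (a powr (-2*nu)) \<partial>M)"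
      using R_0 by (intro nn_integral_cong) auto
    also have "\<dots> = ennreal (z powr (2*nu)) * ennreal (a powr (-2*nu))" by (simp add: emeasure_space_1)
    also have "space M \<inter> {w \<in> space M. \<exists>u\<in>{0..}. R w u < z} = {w \<in> space M. \<exists>u\<in>{0..}. R w u < z}" by auto
    finally show ?thesis unfolding L R L2 using emeasure_power_law_scaled[OF nu a, of z] 2 by simp
  next
    case 3
    have "{w \<in> space M. \<exists>u\<in>{0..}. R w u < z} = space M" using 3 R_0 by (auto intro!: bexI[of _ 0])
    then show ?thesis unfolding L R L2 using emeasure_power_law_scaled[OF nu a, of z] 3 a
      by (simp add: emeasure_space_1)
  qed
qed simp_all

end

section \<open>Asymptotics of weighted expectations\<close>

lemma gamma_ratio_measurable [measurable]: "gamma_ratio nu \<in> borel_measurable borel"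
  unfolding gamma_ratio_def[abs_def] by measurable

context bessel_path
begin

text \<open>For negative \<open>t\<close> the infimum is over the empty set, hence constant.
  Covering this case spares side conditions in limits over \<open>t\<close>.\<close>

lemma run_inf_measurable_all: "(\<lambda>w. run_inf (R w) t) \<in> borel_measurable M"
proof -
  consider "t > 0" | "t = 0" | "t < 0" by linarith
  then show ?thesis
  proof cases
    case 1
    then show ?thesis by (rule run_inf_measurable)
  next
    case 2
    then show ?thesis using R_measurable[of 0] by (simp add: run_inf_def)
  next
    case 3
    then show ?thesis by (simp add: run_inf_def)
  qed
qed

lemma nn_integral_marginal:
  assumes t: "t > 0" and f: "f \<in> borel_measurable borel"
  shows "(\<integral>\<^sup>+w. f (R w t) \<partial>M) = (\<integral>\<^sup>+y. ennreal (bessel_density nu t a y) * f y \<partial>lborel)"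
proof -
  have "(\<integral>\<^sup>+w. f (R w t) \<partial>M) = (\<integral>\<^sup>+w. indicator (space M) w * f (R w (0 + t)) \<partial>M)"
    by (intro nn_integral_cong) auto
  also have "\<dots> = (\<integral>\<^sup>+w. indicator (space M) w * (\<integral>\<^sup>+y. ennreal (bessel_density nu t (R w 0) y) * f y \<partial>lborel) \<partial>M)"
    using t f by (intro markov_at_step markov_at_0) auto
  also have "\<dots> = (\<integral>\<^sup>+w. (\<integral>\<^sup>+y. ennreal (bessel_density nu t a y) * f y \<partial>lborel) \<partial>M)"
    by (intro nn_integral_cong) (auto simp: R_0)
  finally show ?thesis by (simp add: emeasure_space_1)
qed

lemma integrable_harmonic:
  assumes t: "t > 0"
  shows "integrable M (\<lambda>w. R w t powr (-2*nu))"
proof (rule integrableI_nonneg)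
  note [measurable] = R_measurable[OF less_imp_le[OF t]]
  show "(\<lambda>w. R w t powr (-2*nu)) \<in> borel_measurable M" by measurable
  have "(\<integral>\<^sup>+w. ennreal (R w t powr (-2*nu)) \<partial>M) = (\<integral>\<^sup>+y. ennreal (bessel_density nu t a y) * ennreal (y powr (-2*nu)) \<partial>lborel)"
    using t by (intro nn_integral_marginal) auto
  also have "\<dots> < \<infinity>" unfolding bessel_density_harmonic[OF nu t a] by simp
  finally show "(\<integral>\<^sup>+w. ennreal (R w t powr (-2*nu)) \<partial>M) < \<infinity>" .
qed auto

text \<open>Quantitative uniform integrability: for \<open>r = e * sqrt t\<close> and after
  multiplication by \<open>t powr nu\<close>, the bound is a multiple of \<open>e^2\<close> free of
  \<open>t\<close>.\<close>

lemma expectation_harmonic_below: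
  assumes t: "t > 0" and r: "r > 0"
  shows "expectation (\<lambda>w. R w t powr (-2*nu) * indicator {..<r} (R w t)) \<le> r\<^sup>2 / (2 powr nu * Gamma (nu+1) * t powr (nu + 1))"
proof -
  note [measurable] = R_measurable[OF less_imp_le[OF t]]
  have G0: "Gamma (nu+1) > 0" using nu by (intro Gamma_real_pos) auto
  have "(\<integral>\<^sup>+w. ennreal (R w t powr (-2*nu) * indicator {..<r} (R w t)) \<partial>M) =
    (\<integral>\<^sup>+y. ennreal (bessel_density nu t a y) * ennreal (y powr (-2*nu) * indicator {..<r} y) \<partial>lborel)"
    using t by (intro nn_integral_marginal) auto
  also have "\<dots> = (\<integral>\<^sup>+y. ennreal (bessel_density nu t a y) * ennreal (y powr (-(2*nu))) * indicator {..<r} y \<partial>lborel)"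
    by (intro nn_integral_cong) (auto simp: indicator_def)
  also have "\<dots> \<le> ennreal (r powr (2*nu + 2 - 2*nu) * 1 / (2 powr nu * Gamma (nu+1) * t powr (nu + 1)))"
    using t nu a r by (intro nn_integral_bessel_density_below) auto
  also have "\<dots> = ennreal (r\<^sup>2 / (2 powr nu * Gamma (nu+1) * t powr (nu + 1)))" using r by simp
  finally show ?thesis
    using G0 by (intro integral_real_bounded) auto
qed

text \<open>The Markov property at \<open>s\<close> with weight \<open>h(R)\<close>, proved as
  equality of two weighted image measures of the running infimum. They agree on half-lines by
  \<open>markov_at_run_inf\<close>, so any \<open>\<phi>\<close> may be integrated against
  them.\<close>

lemma expectation_run_inf_harmonic:
  assumes s: "s > 0" and u: "u > 0" and [measurable]: "\<phi> \<in> borel_measurable borel"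
  shows "expectation (\<lambda>w. R w (s + u) powr (-2*nu) * \<phi> (run_inf (R w) s)) =
    expectation (\<lambda>w. (2*u) powr (-nu) * gamma_ratio nu ((R w s)\<^sup>2 / (2*u)) * \<phi> (run_inf (R w) s))"
proof -
  have s0: "s \<ge> 0" and su: "s + u \<ge> 0" "s + u > 0" using s u by auto
  note [measurable] = R_measurable[OF s0] R_measurable[OF su(1)] run_inf_measurable[OF s]
  let ?f = "\<lambda>w. R w (s + u) powr (-2*nu)"
  let ?g = "\<lambda>w. (2*u) powr (-nu) * gamma_ratio nu ((R w s)\<^sup>2 / (2*u))"
  have g0: "?g w \<ge> 0" for w using u nu by (intro mult_nonneg_nonneg gamma_ratio_nonneg) auto
  let ?L = "distr (density M (\<lambda>w. ennreal (?f w))) borel (\<lambda>w. run_inf (R w) s)"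
  let ?R = "distr (density M (\<lambda>w. ennreal (?g w))) borel (\<lambda>w. run_inf (R w) s)"
  have "?L = ?R"
  proof (rule measure_eqI_Ici)
    fix y
    let ?B = "{w \<in> space M. y \<le> run_inf (R w) s}"
    have B: "?B = (\<lambda>w. run_inf (R w) s) -` {y..} \<inter> space M" by auto
    have mk: "markov_at s ?B" using markov_at_run_inf[OF s, of UNIV y] by simp
    have L: "emeasure ?L {y..} = (\<integral>\<^sup>+w. indicator ?B w * ennreal (?f w) \<partial>M)"
      by (subst emeasure_distr, simp, simp, subst emeasure_density)
         (auto simp: mult.commute indicator_def intro!: nn_integral_cong)
    have R: "emeasure ?R {y..} = (\<integral>\<^sup>+w. indicator ?B w * ennreal (?g w) \<partial>M)"
      by (subst emeasure_distr, simp, simp, subst emeasure_density)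
         (auto simp: mult.commute indicator_def intro!: nn_integral_cong)
    have "emeasure ?L {y..} = (\<integral>\<^sup>+w. indicator ?B w * (\<integral>\<^sup>+x. ennreal (bessel_density nu u (R w s) x) * ennreal (x powr (-2*nu)) \<partial>lborel) \<partial>M)"
      unfolding L by (rule markov_at_step[OF mk s0 u]) auto
    also have "\<dots> = (\<integral>\<^sup>+w. indicator ?B w * ennreal (?g w) \<partial>M)"
    proof (rule nn_integral_cong_AE)
      show "AE w in M. indicator ?B w * (\<integral>\<^sup>+x. ennreal (bessel_density nu u (R w s) x) * ennreal (x powr (-2*nu)) \<partial>lborel) = indicator ?B w * ennreal (?g w)"
        using AE_pos[OF s] by eventually_elim (simp only: bessel_density_harmonic[OF nu u])
    qed
    finally show "emeasure ?L {y..} = emeasure ?R {y..}" unfolding R .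
    have "emeasure ?L {y..} \<le> (\<integral>\<^sup>+w. ennreal (?f w) \<partial>M)"
      unfolding L by (intro nn_integral_mono) (auto simp: indicator_def)
    also have "\<dots> < \<infinity>" using integrable_harmonic[OF su(2)] unfolding integrable_iff_bounded by simp
    finally show "emeasure ?L {y..} < \<infinity>" .
  qed auto
  then have "integral\<^sup>L ?L \<phi> = integral\<^sup>L ?R \<phi>" by simp
  then show ?thesis using g0
    by (simp add: integral_distr integral_density)
qed

lemma run_inf_antimono:
  assumes "w \<in> space M" "0 \<le> s" "s \<le> t"
  shows "run_inf (R w) t \<le> run_inf (R w) s"
  unfolding run_inf_def using assms by (intro cInf_superset_mono bdd_below_path) auto

lemma run_inf_bounds:
  assumes "w \<in> space M" "0 \<le> t" "bdd_below (R w ` {0..})"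
  shows "total_inf (R w) \<le> run_inf (R w) t" "run_inf (R w) t \<le> a" "run_inf (R w) t \<le> R w t"
proof -
  show "total_inf (R w) \<le> run_inf (R w) t"
    unfolding run_inf_def total_inf_def using assms by (intro cInf_superset_mono) auto
  show "run_inf (R w) t \<le> a" "run_inf (R w) t \<le> R w t"
    using run_inf_ge_iff[OF assms(1,2), of "run_inf (R w) t"] assms(2) R_0[OF assms(1)] by force+
qed

lemma run_inf_tendsto:
  assumes w: "w \<in> space M" "bdd_below (R w ` {0..})"
  shows "((\<lambda>t. run_inf (R w) t) \<longlongrightarrow> total_inf (R w)) at_top"
proof (rule order_tendstoI)
  fix y assume "y < total_inf (R w)"
  then show "\<forall>\<^sub>F t in at_top. y < run_inf (R w) t"
    using run_inf_bounds(1)[OF w(1) _ w(2)] by (intro eventually_at_top_linorderI[of 0]) (meson less_le_trans)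
next
  fix y assume "total_inf (R w) < y"
  then have "\<exists>u\<in>{0..}. R w u < y"
    using cInf_less_iff[OF _ w(2), of y] unfolding total_inf_def by auto
  then obtain u where u: "u \<ge> 0" "R w u < y" by auto
  show "\<forall>\<^sub>F t in at_top. run_inf (R w) t < y"
  proof (rule eventually_at_top_linorderI[of u])
    fix t assume "u \<le> t"
    then have "run_inf (R w) t \<le> R w u"
      using run_inf_antimono[OF w(1) u(1), of t] run_inf_bounds(3)[OF w(1) u(1) w(2)] by simp
    then show "run_inf (R w) t < y" using u by simp
  qed
qed

lemma gamma_ratio_tendsto_0: "((\<lambda>w. gamma_ratio nu w) \<longlongrightarrow> 1 / Gamma (nu + 1)) (at_right 0)"
proof (rule tendsto_sandwich)
  show "\<forall>\<^sub>F w in at_right 0. exp (-w) / Gamma (nu+1) \<le> gamma_ratio nu w"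
    using nu gamma_ratio_ge by (auto intro!: eventually_at_rightI[of 0 1])
  show "\<forall>\<^sub>F w in at_right 0. gamma_ratio nu w \<le> 1 / Gamma (nu+1)"
    using nu gamma_ratio_le by (auto intro!: eventually_at_rightI[of 0 1])
  have G0: "Gamma (nu+1) > 0" using nu by (intro Gamma_real_pos) auto
  have "((\<lambda>w::real. exp (-w)) \<longlongrightarrow> 1) (at_right 0)" by real_asymp
  then show "((\<lambda>w. exp (-w) / Gamma (nu+1)) \<longlongrightarrow> 1 / Gamma (nu+1)) (at_right 0)"
    using G0 by (intro tendsto_divide tendsto_const) auto
qed simp

text \<open>With \<open>s\<close> frozen, the prefactor tends to \<open>2 powr (-nu)\<close> and
  \<open>gamma_ratio\<close> to \<open>1 / Gamma (nu+1)\<close>, whatever the position at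
  \<open>s\<close>; dominated convergence does the rest.\<close>

lemma harmonic_limit_fixed:
  assumes s: "s > 0" and [measurable]: "\<phi> \<in> borel_measurable borel" and K: "\<And>x. \<bar>\<phi> x\<bar> \<le> K"
  shows "((\<lambda>t. t powr nu * expectation (\<lambda>w. R w t powr (-2*nu) * \<phi> (run_inf (R w) s)))
    \<longlongrightarrow> 1 / (2 powr nu * Gamma (nu+1)) * expectation (\<lambda>w. \<phi> (run_inf (R w) s))) at_top"
proof -
  have s0: "s \<ge> 0" using s by simp
  note [measurable] = R_measurable[OF s0] run_inf_measurable[OF s]
  have G0: "Gamma (nu+1) > 0" using nu by (intro Gamma_real_pos) auto
  have K0: "K \<ge> 0" using K[of 0] by linarith
  let ?F = "\<lambda>t w. t powr nu * ((2*(t-s)) powr (-nu) * gamma_ratio nu ((R w s)\<^sup>2 / (2*(t-s))) * \<phi> (run_inf (R w) s))"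
  let ?C = "1 / (2 powr nu * Gamma (nu+1))"
  have coef: "((\<lambda>t. t powr nu * (2*(t-s)) powr (-nu)) \<longlongrightarrow> 2 powr (-nu)) at_top"
    using nu by real_asymp
  have "((\<lambda>t. expectation (?F t)) \<longlongrightarrow> expectation (\<lambda>w. ?C * \<phi> (run_inf (R w) s))) at_top"
  proof (rule integral_dominated_convergence_at_top)
    \<comment> \<open>The added 1 is slack: the prefactor is below \<open>2 powr (-nu) + 1\<close>
      for large \<open>t\<close>.\<close>
    show "integrable M (\<lambda>w. (2 powr (-nu) + 1) * (1 / Gamma (nu+1)) * K)" by simp
    show "AE w in M. ((\<lambda>t. ?F t w) \<longlongrightarrow> ?C * \<phi> (run_inf (R w) s)) at_top"
      using AE_pos[OF s]
    proof eventually_elim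
      case (elim w)
      have "(R w s)\<^sup>2 > 0" using elim by simp
      then have "filterlim (\<lambda>t. (R w s)\<^sup>2 / (2*(t-s))) (at_right 0) at_top" by real_asymp
      then have "((\<lambda>t. gamma_ratio nu ((R w s)\<^sup>2 / (2*(t-s)))) \<longlongrightarrow> 1 / Gamma (nu+1)) at_top"
        by (rule filterlim_compose[OF gamma_ratio_tendsto_0])
      then have "((\<lambda>t. (t powr nu * (2*(t-s)) powr (-nu)) * gamma_ratio nu ((R w s)\<^sup>2 / (2*(t-s))) * \<phi> (run_inf (R w) s))
         \<longlongrightarrow> 2 powr (-nu) * (1 / Gamma (nu+1)) * \<phi> (run_inf (R w) s)) at_top"
        by (intro tendsto_mult coef tendsto_const)
      moreover have "2 powr (-nu) * (1 / Gamma (nu+1)) = ?C" by (simp add: powr_minus_divide)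
      ultimately show ?case by (simp only: mult.assoc)
    qed
    have "\<forall>\<^sub>F t in at_top. t powr nu * (2*(t-s)) powr (-nu) < 2 powr (-nu) + 1"
      using coef by (rule order_tendstoD) simp
    then show "\<forall>\<^sub>F t in at_top. AE w in M. norm (?F t w) \<le> (2 powr (-nu) + 1) * (1 / Gamma (nu+1)) * K"
      using eventually_gt_at_top[of s]
    proof eventually_elim
      case (elim t)
      show ?case
      proof (intro AE_I2)
        fix w
        have w: "0 \<le> (R w s)\<^sup>2 / (2*(t-s))" using elim by simp
        have "norm (?F t w) = (t powr nu * (2*(t-s)) powr (-nu)) * gamma_ratio nu ((R w s)\<^sup>2 / (2*(t-s))) * \<bar>\<phi> (run_inf (R w) s)\<bar>"
          using gamma_ratio_nonneg[OF nu w] by (simp add: abs_mult)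
        also have "\<dots> \<le> (2 powr (-nu) + 1) * (1 / Gamma (nu+1)) * K"
          using elim gamma_ratio_nonneg[OF nu w] gamma_ratio_le[OF nu w] K[of "run_inf (R w) s"] K0 G0
          by (intro mult_mono mult_nonneg_nonneg) auto
        finally show "norm (?F t w) \<le> (2 powr (-nu) + 1) * (1 / Gamma (nu+1)) * K" .
      qed
    qed
  qed measurable
  then have "((\<lambda>t. expectation (?F t)) \<longlongrightarrow> ?C * expectation (\<lambda>w. \<phi> (run_inf (R w) s))) at_top"
    by simp
  moreover have "\<forall>\<^sub>F t in at_top. expectation (?F t) = t powr nu * expectation (\<lambda>w. R w t powr (-2*nu) * \<phi> (run_inf (R w) s))"
    using eventually_gt_at_top[of s]
  proof eventually_elim
    case (elim t)
    then show ?case using expectation_run_inf_harmonic[OF s, of "t - s" \<phi>] by simp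
  qed
  ultimately show ?thesis by (rule Lim_transform_eventually)
qed

text \<open>Splitting \<open>{0..}\<close> at \<open>t\<close> makes the total infimum the smaller
  of past and future infimum. One exceptional null set serves all \<open>t\<close>.\<close>

lemma run_inf_in_Icc:
  "AE w in M. \<forall>t\<ge>0. 0 \<le> run_inf (R w) t \<and> run_inf (R w) t \<le> a \<and> run_inf (R w) t \<le> R w t
      \<and> 0 \<le> total_inf (R w) \<and> total_inf (R w) \<le> run_inf (R w) t
      \<and> total_inf (R w) = min (run_inf (R w) t) (future_inf w t)"
  using AE_bdd_below AE_space
proof eventually_elim
  case (elim w)
  show ?case
  proof (intro allI impI)
    fix t :: real assume t: "t \<ge> 0"
    have b: "bdd_below (R w ` {0..})" "0 \<le> total_inf (R w)"
      using elim(1)[rule_format, of 0] by (auto simp: total_inf_eq)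
    have bt: "bdd_below (R w ` {t..})" using elim(1)[rule_format, OF t] by simp
    note bd = run_inf_bounds[OF elim(2) t b(1)]
    have "{0..} = {0..t} \<union> {t..}" using t by auto
    then have "R w ` {0..} = R w ` {0..t} \<union> R w ` {t..}" by (metis image_Un)
    then have "total_inf (R w) = min (run_inf (R w) t) (future_inf w t)"
      unfolding total_inf_def run_inf_def future_inf_def inf_min[symmetric]
      using t bdd_below_path[OF elim(2)] bt by (simp add: cInf_union_distrib)
    then show "0 \<le> run_inf (R w) t \<and> run_inf (R w) t \<le> a \<and> run_inf (R w) t \<le> R w t
      \<and> 0 \<le> total_inf (R w) \<and> total_inf (R w) \<le> run_inf (R w) t
      \<and> total_inf (R w) = min (run_inf (R w) t) (future_inf w t)"
      using bd b by auto
  qed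
qed

lemma harmonic_limit:
  assumes cont: "continuous_on UNIV \<phi>" and K: "\<And>x. \<bar>\<phi> x\<bar> \<le> K"
  shows "((\<lambda>t. t powr nu * expectation (\<lambda>w. R w t powr (-2*nu) * \<phi> (run_inf (R w) t)))
    \<longlongrightarrow> 1 / (2 powr nu * Gamma (nu+1)) * expectation (\<lambda>w. \<phi> (total_inf (R w)))) at_top"
proof -
  have [measurable]: "\<phi> \<in> borel_measurable borel" using cont by (rule borel_measurable_continuous_onI)
  note [measurable] = run_inf_measurable_all total_inf_measurable
  have G0: "Gamma (nu+1) > 0" using nu by (intro Gamma_real_pos) auto
  have K0: "K \<ge> 0" using K[of 0] by linarith
  let ?C = "1 / (2 powr nu * Gamma (nu+1))"
  have C0: "?C > 0" using G0 by simp
  define A where "A t = t powr nu * expectation (\<lambda>w. R w t powr (-2*nu) * \<phi> (run_inf (R w) t))" for t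
  define A' where "A' s t = t powr nu * expectation (\<lambda>w. R w t powr (-2*nu) * \<phi> (run_inf (R w) s))" for s t
  define m where "m = expectation (\<lambda>w. \<phi> (total_inf (R w)))"
  define m' where "m' s = expectation (\<lambda>w. \<phi> (run_inf (R w) s))" for s
  define d where "d s = expectation (\<lambda>w. \<bar>\<phi> (run_inf (R w) s) - \<phi> (total_inf (R w))\<bar>)" for s
  have dK: "\<bar>\<phi> x - \<phi> y\<bar> \<le> 2 * K" for x y using K[of x] K[of y] by linarith
  have intd: "integrable M (\<lambda>w. \<bar>\<phi> (run_inf (R w) s) - \<phi> (total_inf (R w))\<bar>)" for s
    using dK by (intro integrable_const_bound[of _ "2*K"]) auto
  have int1: "integrable M (\<lambda>w. \<phi> (run_inf (R w) s))" for s
    using K by (intro integrable_const_bound[of _ K]) auto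
  have int2: "integrable M (\<lambda>w. \<phi> (total_inf (R w)))"
    using K by (intro integrable_const_bound[of _ K]) auto
  have d_lim: "(d \<longlongrightarrow> 0) at_top"
  proof -
    have "((\<lambda>s. expectation (\<lambda>w. \<bar>\<phi> (run_inf (R w) s) - \<phi> (total_inf (R w))\<bar>)) \<longlongrightarrow> expectation (\<lambda>w. 0)) at_top"
    proof (rule integral_dominated_convergence_at_top)
      show "integrable M (\<lambda>w. 2 * K)" by simp
      show "AE w in M. ((\<lambda>s. \<bar>\<phi> (run_inf (R w) s) - \<phi> (total_inf (R w))\<bar>) \<longlongrightarrow> 0) at_top"
        using AE_bdd_below AE_space
      proof eventually_elim
        case (elim w)
        have "bdd_below (R w ` {0..})" using elim(1)[rule_format, of 0] by simp
        then have "((\<lambda>t. run_inf (R w) t) \<longlongrightarrow> total_inf (R w)) at_top" using elim(2) by (intro run_inf_tendsto)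
        then have "((\<lambda>t. \<phi> (run_inf (R w) t)) \<longlongrightarrow> \<phi> (total_inf (R w))) at_top"
          by (rule continuous_on_tendsto_compose[OF cont]) auto
        then have "((\<lambda>t. \<bar>\<phi> (run_inf (R w) t) - \<phi> (total_inf (R w))\<bar>) \<longlongrightarrow> \<bar>\<phi> (total_inf (R w)) - \<phi> (total_inf (R w))\<bar>) at_top"
          by (intro tendsto_rabs tendsto_diff tendsto_const)
        then show ?case by simp
      qed
      show "\<forall>\<^sub>F s in at_top. AE w in M. norm \<bar>\<phi> (run_inf (R w) s) - \<phi> (total_inf (R w))\<bar> \<le> 2 * K"
        using dK by auto
    qed measurable
    then show ?thesis unfolding d_def[abs_def] by simp
  qed
  have mm: "\<bar>m' s - m\<bar> \<le> d s" for s
  proof -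
    have "m' s - m = expectation (\<lambda>w. \<phi> (run_inf (R w) s) - \<phi> (total_inf (R w)))"
      unfolding m'_def m_def using int1 int2 by (intro Bochner_Integration.integral_diff[symmetric])
    then show ?thesis unfolding d_def using integral_abs_bound[of M "\<lambda>w. \<phi> (run_inf (R w) s) - \<phi> (total_inf (R w))"] by simp
  qed
  \<comment> \<open>Split at \<open>R_t = e * sqrt t\<close>. Below, only boundedness of
    \<open>\<phi>\<close> is used and \<open>expectation_harmonic_below\<close> gives
    \<open>e^2\<close>. Above, the weight is at most \<open>(e * sqrt t) powr (-2*nu)\<close>, whose
    power of \<open>t\<close> cancels \<open>t powr nu\<close>, and the L1 distances
    \<open>d\<close> to the limit remain.\<close>
  have AA: "\<bar>A t - A' s t\<bar> \<le> 2 * K * e\<^sup>2 * ?C + e powr (-2*nu) * (d t + d s)"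
    if t: "t > 0" and e: "e > 0" for s t e
  proof -
    note [measurable] = R_measurable[OF less_imp_le[OF t]]
    let ?h = "\<lambda>w. R w t powr (-2*nu)"
    have bint: "integrable M (\<lambda>w. ?h w * f w)" if [measurable]: "f \<in> borel_measurable M" and f: "\<And>w. \<bar>f w\<bar> \<le> L" for f L
    proof (rule Bochner_Integration.integrable_bound)
      show "integrable M (\<lambda>w. ?h w * L)" using integrable_harmonic[OF t] by (intro integrable_mult_left) auto
      show "AE w in M. norm (?h w * f w) \<le> norm (?h w * L)"
      proof (intro AE_I2)
        fix w
        have "\<bar>f w\<bar> \<le> \<bar>L\<bar>" using f[of w] by linarith
        then show "norm (?h w * f w) \<le> norm (?h w * L)" by (simp add: abs_mult mult_left_mono)
      qed
    qed measurable
    let ?r = "e * sqrt t"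
    have r: "?r > 0" using t e by simp
    let ?D = "\<lambda>w. \<bar>\<phi> (run_inf (R w) t) - \<phi> (total_inf (R w))\<bar> + \<bar>\<phi> (run_inf (R w) s) - \<phi> (total_inf (R w))\<bar>"
    have b1: "integrable M (\<lambda>w. ?h w * \<phi> (run_inf (R w) s))" for s using K by (intro bint[of _ K]) auto
    have "A t - A' s t = t powr nu * expectation (\<lambda>w. ?h w * (\<phi> (run_inf (R w) t) - \<phi> (run_inf (R w) s)))"
      unfolding A_def A'_def by (simp only: right_diff_distrib Bochner_Integration.integral_diff[OF b1[of t] b1[of s]])
    then have "\<bar>A t - A' s t\<bar> = t powr nu * \<bar>expectation (\<lambda>w. ?h w * (\<phi> (run_inf (R w) t) - \<phi> (run_inf (R w) s)))\<bar>"
      by (simp add: abs_mult)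
    also have "\<dots> \<le> t powr nu * expectation (\<lambda>w. \<bar>?h w * (\<phi> (run_inf (R w) t) - \<phi> (run_inf (R w) s))\<bar>)"
      by (intro mult_left_mono integral_abs_bound) auto
    also have "\<dots> \<le> t powr nu * expectation (\<lambda>w. 2 * K * (?h w * indicator {..<?r} (R w t)) + ?r powr (-2*nu) * ?D w)"
    proof (intro mult_left_mono integral_mono_AE)
      show "integrable M (\<lambda>w. \<bar>?h w * (\<phi> (run_inf (R w) t) - \<phi> (run_inf (R w) s))\<bar>)"
        using dK by (intro integrable_abs bint) auto
      show "integrable M (\<lambda>w. 2 * K * (?h w * indicator {..<?r} (R w t)) + ?r powr (-2*nu) * ?D w)"
        by (intro Bochner_Integration.integrable_add integrable_mult_right bint[of _ 1] intd) (auto simp: indicator_def)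
      show "AE w in M. \<bar>?h w * (\<phi> (run_inf (R w) t) - \<phi> (run_inf (R w) s))\<bar> \<le> 2 * K * (?h w * indicator {..<?r} (R w t)) + ?r powr (-2*nu) * ?D w"
      proof (intro AE_I2)
        fix w
        show "\<bar>?h w * (\<phi> (run_inf (R w) t) - \<phi> (run_inf (R w) s))\<bar> \<le> 2 * K * (?h w * indicator {..<?r} (R w t)) + ?r powr (-2*nu) * ?D w"
        proof (cases "R w t < ?r")
          case True
          have "\<bar>?h w * (\<phi> (run_inf (R w) t) - \<phi> (run_inf (R w) s))\<bar> \<le> ?h w * (2 * K)"
            unfolding abs_mult using dK by (intro mult_mono) auto
          moreover have "0 \<le> ?r powr (-2*nu) * ?D w" by (intro mult_nonneg_nonneg) auto
          moreover have "2 * K * (?h w * indicator {..<?r} (R w t)) = ?h w * (2 * K)" using True by simp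
          ultimately show ?thesis by linarith
        next
          case False
          then have "?h w \<le> ?r powr (-2*nu)" using r nu by (intro powr_mono2') auto
          then have "\<bar>?h w * (\<phi> (run_inf (R w) t) - \<phi> (run_inf (R w) s))\<bar> \<le> ?r powr (-2*nu) * ?D w"
            unfolding abs_mult by (intro mult_mono) auto
          then show ?thesis using False by simp
        qed
      qed
    qed auto
    also have "\<dots> = t powr nu * (2 * K * expectation (\<lambda>w. ?h w * indicator {..<?r} (R w t)) + ?r powr (-2*nu) * (d t + d s))"
    proof -
      have "expectation (\<lambda>w. 2 * K * (?h w * indicator {..<?r} (R w t)) + ?r powr (-2*nu) * ?D w) =
        expectation (\<lambda>w. 2 * K * (?h w * indicator {..<?r} (R w t))) + expectation (\<lambda>w. ?r powr (-2*nu) * ?D w)"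
        by (intro Bochner_Integration.integral_add integrable_mult_right Bochner_Integration.integrable_add bint[of _ 1] intd) (auto simp: indicator_def)
      also have "expectation (\<lambda>w. ?r powr (-2*nu) * ?D w) = ?r powr (-2*nu) * (d t + d s)"
        unfolding d_def using intd by (subst Bochner_Integration.integral_add[symmetric]) auto
      finally show ?thesis by simp
    qed
    also have "\<dots> \<le> t powr nu * (2 * K * (?r\<^sup>2 / (2 powr nu * Gamma (nu+1) * t powr (nu + 1))) + ?r powr (-2*nu) * (d t + d s))"
      using K0 expectation_harmonic_below[OF t r] by (intro mult_left_mono add_right_mono) auto
    also have "\<dots> = 2 * K * e\<^sup>2 * ?C + e powr (-2*nu) * (d t + d s)"
    proof -
      have 1: "t powr (nu + 1) = t powr nu * t" using t by (simp add: powr_add)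
      have "t powr nu * ?r powr (-2*nu) = e powr (-2*nu) * (t powr nu * sqrt t powr (-2*nu))"
        using e t by (simp add: powr_mult)
      also have "sqrt t powr (-2*nu) = t powr (-nu)" using t by (simp add: powr_half_sqrt[symmetric] powr_powr)
      also have "t powr nu * t powr (-nu) = 1" using t by (simp flip: powr_add)
      finally have 2: "t powr nu * ?r powr (-2*nu) = e powr (-2*nu)" by simp
      have 3: "?r\<^sup>2 = e\<^sup>2 * t" using t by (simp add: power_mult_distrib)
      have "t powr nu * (2 * K * (?r\<^sup>2 / (2 powr nu * Gamma (nu+1) * t powr (nu + 1)))) = 2 * K * e\<^sup>2 * ?C"
        unfolding 1 3 using t by simp
      then show ?thesis using 2 by (simp only: distrib_left mult.assoc[symmetric])
    qed
    finally show ?thesis .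
  qed
  have "(A \<longlongrightarrow> ?C * m) at_top"
  proof (rule tendstoI)
    \<comment> \<open>Order of choice: \<open>e\<close> against small positions, then
      \<open>s\<close> against both terms with \<open>d s\<close>, then \<open>t\<close>. The pieces
      add up to 7/8 of \<open>\<epsilon>\<close>.\<close>
    fix \<epsilon> :: real assume \<epsilon>: "\<epsilon> > 0"
    have "((\<lambda>e. 2 * K * e\<^sup>2 * ?C) \<longlongrightarrow> 2 * K * 0\<^sup>2 * ?C) (at_right 0)" by (intro tendsto_intros) 
    then have "\<forall>\<^sub>F e in at_right 0. 2 * K * e\<^sup>2 * ?C < \<epsilon> / 4"
      by (rule order_tendstoD) (use \<epsilon> in simp)
    with eventually_at_right_less[of 0] have "\<forall>\<^sub>F e in at_right 0. 0 < e \<and> 2 * K * e\<^sup>2 * ?C < \<epsilon> / 4"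
      by eventually_elim simp
    then obtain e where e: "e > 0" "2 * K * e\<^sup>2 * ?C < \<epsilon> / 4"
      using eventually_happens[of _ "at_right (0::real)"] by auto
    let ?q = "e powr (-2*nu)"
    have q: "?q > 0" using e by simp
    have small: "\<forall>\<^sub>F s in at_top. c * d s < \<epsilon> / 8" for c
    proof -
      have "((\<lambda>s. c * d s) \<longlongrightarrow> c * 0) at_top" by (intro tendsto_mult d_lim tendsto_const)
      then show ?thesis by (rule order_tendstoD) (use \<epsilon> in simp)
    qed
    note dq = small[of ?q] and dC = small[of ?C]
    have "\<forall>\<^sub>F s in at_top. 0 < s \<and> ?q * d s < \<epsilon> / 8 \<and> ?C * d s < \<epsilon> / 8"
      using dq dC eventually_gt_at_top[of 0] by eventually_elim auto
    then obtain s where s: "s > 0" "?q * d s < \<epsilon> / 8" "?C * d s < \<epsilon> / 8"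
      using eventually_happens[of _ "at_top :: real filter"] by auto
    have "(A' s \<longlongrightarrow> ?C * m' s) at_top" unfolding A'_def m'_def using s(1) K by (intro harmonic_limit_fixed) auto
    then have "\<forall>\<^sub>F t in at_top. dist (A' s t) (?C * m' s) < \<epsilon> / 4" using \<epsilon> by (intro tendstoD) auto
    then show "\<forall>\<^sub>F t in at_top. dist (A t) (?C * m) < \<epsilon>"
      using dq eventually_gt_at_top[of 0]
    proof eventually_elim
      case (elim t)
      have 1: "\<bar>A t - A' s t\<bar> \<le> 2 * K * e\<^sup>2 * ?C + (?q * d t + ?q * d s)"
        using AA[OF elim(3) e(1), of s] by (simp add: distrib_left)
      have "\<bar>?C * m' s - ?C * m\<bar> = ?C * \<bar>m' s - m\<bar>"
        unfolding right_diff_distrib[symmetric] abs_mult using C0 by (simp only: abs_of_pos)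
      also have "\<dots> \<le> ?C * d s" using C0 mm by (intro mult_left_mono) auto
      finally have 2: "\<bar>?C * m' s - ?C * m\<bar> \<le> ?C * d s" .
      have "\<bar>A t - ?C * m\<bar> \<le> \<bar>A t - A' s t\<bar> + \<bar>A' s t - ?C * m' s\<bar> + \<bar>?C * m' s - ?C * m\<bar>" by linarith
      then show ?case using 1 2 elim(1,2) e(2) s(2,3) \<epsilon> unfolding dist_real_def by linarith
    qed
  qed
  then show ?thesis unfolding A_def m_def .
qed

end

section \<open>Integrals against the power law\<close>

text \<open>The substitution \<open>z = y * v\<close>, delivered as a Henstock-Kurzweil integral to
  match the final formulas. Continuity bounds \<open>f\<close> on \<open>{0..y}\<close> and so gives
  integrability.\<close>

lemma integral_power_law:
  fixes f :: "real \<Rightarrow> real" and nu y :: real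
  assumes nu: "nu > 0" and y: "y > 0" and cont: "continuous_on UNIV f"
  shows "((\<lambda>z. f z * (2 * nu * z powr (2*nu - 1))) has_integral (y powr (2*nu) * (\<integral>v. f (y * v) \<partial>power_law nu))) {0..y}"
proof -
  interpret prob_space "power_law nu" using nu by (rule prob_space_power_law)
  have [measurable]: "f \<in> borel_measurable borel" using cont by (rule borel_measurable_continuous_onI)
  have "compact (f ` {0..y})" by (intro compact_continuous_image continuous_on_subset[OF cont]) auto
  then obtain B where "\<forall>x\<in>f ` {0..y}. norm x \<le> B"
    using compact_imp_bounded[of "f ` {0..y}"] unfolding bounded_iff by blast
  then have B: "\<bar>f z\<bar> \<le> B" if "z \<in> {0..y}" for z using that by simp
  let ?p = "\<lambda>v. 2 * nu * v powr (2*nu - 1) * indicator {0<..<1} v :: real"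
  have p0: "?p v \<ge> 0" for v using nu by (simp add: indicator_def)
  have D: "power_law nu = density lborel (\<lambda>v. ennreal (?p v))"
    unfolding power_law_def by (intro arg_cong2[where f=density] refl ext) (auto simp: indicator_def)
  have "integrable (power_law nu) (\<lambda>v. f (y * v))"
  proof (rule integrable_const_bound)
    show "AE v in power_law nu. norm (f (y * v)) \<le> B"
      using AE_power_law[OF nu]
    proof eventually_elim
      case (elim v)
      then have "y * v \<in> {0..y}" using y mult_left_mono[of v 1 y] by auto
      then show ?case using B by simp
    qed
  qed measurable
  then have int: "integrable lborel (\<lambda>v. ?p v * f (y * v))"
    unfolding D using p0 by (subst (asm) integrable_density) auto
  have eq: "(\<integral>v. f (y * v) \<partial>power_law nu) = (\<integral>v. ?p v * f (y * v) \<partial>lborel)"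
    unfolding D using p0 by (subst integral_density) auto
  let ?G = "\<lambda>z. indicator {0<..<y} z * (f z * (2 * nu * z powr (2*nu - 1)))"
  have G: "?G (y * v) = y powr (2*nu - 1) * (?p v * f (y * v))" for v
  proof (cases "0 < v \<and> v < 1")
    case True
    then have "0 < y * v" "y * v < y" using y by auto
    moreover have "(y * v) powr (2*nu - 1) = y powr (2*nu - 1) * v powr (2*nu - 1)"
      using True y by (simp add: powr_mult)
    ultimately show ?thesis using True by simp
  next
    case False
    then have "\<not> (0 < y * v \<and> y * v < y)" using y by (auto simp: zero_less_mult_iff)
    then show ?thesis using False by (auto simp: indicator_def)
  qed
  have "integrable lborel (\<lambda>v. ?G (0 + y * v))" using int by (simp only: add_0 G) (intro integrable_mult_right)
  then have intG: "integrable lborel ?G"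
    using y by (subst (asm) lborel_integrable_real_affine_iff) auto
  have "(\<integral>z. ?G z \<partial>lborel) = \<bar>y\<bar> *\<^sub>R (\<integral>v. ?G (0 + y * v) \<partial>lborel)"
    using y by (intro lborel_integral_real_affine) auto
  also have "\<dots> = y * (y powr (2*nu - 1) * (\<integral>v. f (y * v) \<partial>power_law nu))"
    unfolding eq using y by (simp only: add_0 G) simp
  also have "\<dots> = y powr (2*nu) * (\<integral>v. f (y * v) \<partial>power_law nu)"
    using y by (simp add: powr_mult_base mult.assoc[symmetric])
  finally have "(?G has_integral (y powr (2*nu) * (\<integral>v. f (y * v) \<partial>power_law nu))) UNIV"
    using has_integral_integral_lborel[OF intG] by simp
  then have "((\<lambda>z. if z \<in> {0<..<y} then f z * (2 * nu * z powr (2*nu - 1)) else 0) has_integral (y powr (2*nu) * (\<integral>v. f (y * v) \<partial>power_law nu))) UNIV"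
    by (rule has_integral_cong[THEN iffD1, rotated]) (auto simp: indicator_def)
  then have "((\<lambda>z. f z * (2 * nu * z powr (2*nu - 1))) has_integral (y powr (2*nu) * (\<integral>v. f (y * v) \<partial>power_law nu))) {0<..<y}"
    by (simp only: has_integral_restrict_UNIV)
  then show ?thesis by (simp only: has_integral_Icc_iff_Ioo)
qed

lemma integrable_on_power_weight:
  fixes f :: "real \<Rightarrow> real"
  assumes "nu > 0" "y \<ge> 0" "continuous_on UNIV f"
  shows "(\<lambda>z. f z * (2 * nu * z powr (2*nu - 1))) integrable_on {0..y}"
proof (cases "y = 0")
  case False
  then have "y > 0" using assms(2) by simp
  from integral_power_law[OF assms(1) this assms(3)] show ?thesis by (rule has_integral_integrable)
next
  case True
  then show ?thesis using has_integral_refl(2)[of _ "0::real"] by (auto simp: integrable_on_def)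
qed

text \<open>The integral of \<open>g\<close> against \<open>d(z^(2 nu))\<close>; for
  \<open>g = 1\<close> and \<open>y \<ge> 0\<close> it is \<open>y powr (2*nu)\<close>.\<close>

definition weight_prim :: "real \<Rightarrow> (real \<Rightarrow> real) \<Rightarrow> real \<Rightarrow> real" where
  "weight_prim nu g y = integral {0..y} (\<lambda>z. g z * (2 * nu * z powr (2*nu - 1)))"

lemma weight_prim_continuous:
  assumes "nu > 0" "y \<ge> 0" "continuous_on UNIV g"
  shows "continuous_on {0..y} (weight_prim nu g)"
  unfolding weight_prim_def[abs_def]
  by (intro indefinite_integral_continuous_1 integrable_on_power_weight assms)

lemma weight_prim_deriv:
  assumes nu: "nu > 0" and y: "0 < y" "y < c" and g: "continuous_on UNIV g"
  shows "(weight_prim nu g has_real_derivative g y * (2 * nu * y powr (2*nu - 1))) (at y)"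
proof -
  let ?f = "\<lambda>z. g z * (2 * nu * z powr (2*nu - 1))"
  have "isCont g y" using g by (simp add: continuous_on_eq_continuous_at)
  then have "isCont ?f y" using y by (intro continuous_intros) auto
  then have "continuous (at y within {0..c} - {}) ?f" by (simp add: continuous_at_imp_continuous_at_within)
  then have "((\<lambda>u. integral {0..u} ?f) has_vector_derivative ?f y) (at y within {0..c} - {})"
    using y by (intro integral_has_vector_derivative_continuous_at integrable_on_power_weight nu g) auto
  then have "((\<lambda>u. integral {0..u} ?f) has_real_derivative ?f y) (at y within {0..c})"
    by (simp add: has_real_derivative_iff_has_vector_derivative)
  moreover have "at y within {0..c} = at y" using y by (intro at_within_interior) auto
  ultimately show ?thesis unfolding weight_prim_def[abs_def] by simp
qed

text \<open>The product rule for \<open>weight_prim nu g y * y powr (2*nu)\<close> expresses the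
  weighted integral of \<open>weight_prim nu g\<close> as a boundary term minus the weighted
  integral of \<open>g y * y powr (2*nu)\<close>. Subtracting the latter once more produces the
  factor 2.\<close>

lemma weight_prim_by_parts:
  fixes g :: "real \<Rightarrow> real"
  assumes nu: "nu > 0" and a: "a > 0" and g: "continuous_on UNIV g"
  shows "((\<lambda>y. (weight_prim nu g y - g y * y powr (2*nu)) * (2 * nu * y powr (2*nu - 1))) has_integral
     2 * nu * integral {0..a} (\<lambda>z. (a powr (2*nu) - 2 * z powr (2*nu)) * z powr (2*nu - 1) * g z)) {0..a}"
proof -
  let ?w = "\<lambda>y. 2 * nu * y powr (2*nu - 1)"
  let ?G = "weight_prim nu g"
  have cp: "continuous_on X (\<lambda>v. v powr (2*nu))" if "X \<subseteq> {0..}" for X :: "real set"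
    using nu that by (intro continuous_on_powr') (auto intro!: continuous_intros)
  have parts: "((\<lambda>y. g y * ?w y * y powr (2*nu) + ?w y * ?G y) has_integral ?G a * a powr (2*nu) - ?G 0 * 0 powr (2*nu)) {0..a}"
  proof (rule fundamental_theorem_of_calculus_interior)
    show "continuous_on {0..a} (\<lambda>y. ?G y * y powr (2*nu))"
      using a nu g by (intro continuous_on_mult weight_prim_continuous cp) auto
    fix y assume y: "y \<in> {0<..<a}"
    have "((\<lambda>y. ?G y * y powr (2*nu)) has_real_derivative (g y * ?w y * y powr (2*nu) + ?w y * ?G y)) (at y)"
      using y by (intro DERIV_mult weight_prim_deriv[OF nu _ _ g, of _ a] has_real_derivative_powr) auto
    then show "((\<lambda>y. ?G y * y powr (2*nu)) has_vector_derivative (g y * ?w y * y powr (2*nu) + ?w y * ?G y)) (at y)"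
      by (simp add: has_real_derivative_iff_has_vector_derivative)
  qed (use a in auto)
  have i1: "(\<lambda>z. g z * ?w z) integrable_on {0..a}" using nu a g by (intro integrable_on_power_weight) auto
  \<comment> \<open>\<open>integrable_on_power_weight\<close> asks for continuity on the whole line;
    \<open>max 0 z\<close> provides it and agrees with \<open>z\<close> on the interval.\<close>
  have "(\<lambda>z. (g z * (max 0 z) powr (2*nu)) * ?w z) integrable_on {0..a}"
  proof (intro integrable_on_power_weight nu continuous_on_mult g)
    show "continuous_on UNIV (\<lambda>z. (max 0 z) powr (2*nu))"
      using nu by (intro continuous_on_powr') (auto intro!: continuous_intros)
  qed (use a in auto)
  then have i2: "(\<lambda>z. g z * z powr (2*nu) * ?w z) integrable_on {0..a}"
    by (rule integrable_eq) auto
  let ?I2 = "integral {0..a} (\<lambda>z. g z * z powr (2*nu) * ?w z)"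
  have "((\<lambda>y. (g y * ?w y * y powr (2*nu) + ?w y * ?G y) - 2 * (g y * y powr (2*nu) * ?w y)) has_integral
     (?G a * a powr (2*nu) - ?G 0 * 0 powr (2*nu)) - 2 * ?I2) {0..a}"
    by (intro has_integral_diff parts has_integral_mult_right integrable_integral i2)
  then have L: "((\<lambda>y. (?G y - g y * y powr (2*nu)) * ?w y) has_integral ?G a * a powr (2*nu) - 2 * ?I2) {0..a}"
    by (rule has_integral_eq_rhs[OF has_integral_eq[rotated]]) (use nu in \<open>auto simp: algebra_simps\<close>)
  have "((\<lambda>z. a powr (2*nu) * (g z * ?w z) - 2 * (g z * z powr (2*nu) * ?w z)) has_integral a powr (2*nu) * ?G a - 2 * ?I2) {0..a}"
    unfolding weight_prim_def by (intro has_integral_diff has_integral_mult_right integrable_integral i1 i2)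
  then have "((\<lambda>z. 2 * nu * ((a powr (2*nu) - 2 * z powr (2*nu)) * z powr (2*nu - 1) * g z)) has_integral a powr (2*nu) * ?G a - 2 * ?I2) {0..a}"
    by (rule has_integral_eq[rotated]) (auto simp: algebra_simps)
  then have "integral {0..a} (\<lambda>z. 2 * nu * ((a powr (2*nu) - 2 * z powr (2*nu)) * z powr (2*nu - 1) * g z)) = a powr (2*nu) * ?G a - 2 * ?I2"
    by (rule integral_unique)
  then show ?thesis using L by (simp add: mult.commute)
qed

section \<open>The limit theorems\<close>

context bessel_path
begin

text \<open>As \<open>b \<ge> 0\<close>, the gap exceeds \<open>b\<close> exactly when the future
  infimum is below the past one minus \<open>b\<close>; averaging over \<open>V\<close> gives
  \<open>((I_t - b)^+ / R_t)^(2 nu)\<close>. Truncation at \<open>a\<close> is harmless almost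
  surely and gives the bounded \<open>\<phi>\<close> that \<open>harmonic_limit\<close>
  wants.\<close>

lemma prob_gap_eq:
  assumes t: "t > 0" and b: "b \<ge> 0"
  shows "measure M {w \<in> space M. run_inf (R w) t - total_inf (R w) > b}
    = expectation (\<lambda>w. R w t powr (-2*nu) * (max 0 (min (run_inf (R w) t) a - b)) powr (2*nu))"
proof -
  have t0: "t \<ge> 0" using t by simp
  interpret D: prob_space "power_law nu" using nu by (rule prob_space_power_law)
  note [measurable] = R_measurable[OF t0] run_inf_measurable[OF t] total_inf_measurable future_inf_measurable[OF t0]
  let ?X = "{p :: real \<times> real. snd p < fst p - b}"
  have "{p \<in> space (borel \<Otimes>\<^sub>M borel). snd p < fst p - b} \<in> sets (borel \<Otimes>\<^sub>M borel :: (real \<times> real) measure)" by measurable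
  then have X[measurable]: "?X \<in> sets (borel \<Otimes>\<^sub>M borel)" by (simp add: space_pair_measure)
  have "emeasure M {w \<in> space M. run_inf (R w) t - total_inf (R w) > b} = emeasure M {w \<in> space M. future_inf w t < run_inf (R w) t - b}"
  proof (rule emeasure_eq_AE)
    show "AE w in M. w \<in> {w \<in> space M. run_inf (R w) t - total_inf (R w) > b} \<longleftrightarrow> w \<in> {w \<in> space M. future_inf w t < run_inf (R w) t - b}"
      using run_inf_in_Icc
    proof eventually_elim
      case (elim w)
      have "total_inf (R w) = min (run_inf (R w) t) (future_inf w t)" using elim[rule_format, OF t0] by simp
      then show ?case using b by auto
    qed
  qed measurable
  also have "\<dots> = emeasure (distr M (borel \<Otimes>\<^sub>M borel) (\<lambda>w. (run_inf (R w) t, future_inf w t))) ?X"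
    by (subst emeasure_distr) (auto intro!: arg_cong[where f="emeasure M"])
  also have "\<dots> = (\<integral>\<^sup>+p. indicator ?X p \<partial>distr (M \<Otimes>\<^sub>M power_law nu) (borel \<Otimes>\<^sub>M borel) (\<lambda>(w, v). (run_inf (R w) t, R w t * v)))"
    unfolding distr_run_inf_future_inf[OF t] by (subst nn_integral_indicator) auto
  also have "\<dots> = (\<integral>\<^sup>+x. indicator ?X (case x of (w, v) \<Rightarrow> (run_inf (R w) t, R w t * v)) \<partial>(M \<Otimes>\<^sub>M power_law nu))"
    by (rule nn_integral_distr) measurable
  also have "\<dots> = (\<integral>\<^sup>+w. \<integral>\<^sup>+v. indicator ?X (run_inf (R w) t, R w t * v) \<partial>power_law nu \<partial>M)"
    by (subst D.nn_integral_fst[symmetric]) auto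
  also have "\<dots> = (\<integral>\<^sup>+w. \<integral>\<^sup>+v. indicator {v. R w t * v < run_inf (R w) t - b} v \<partial>power_law nu \<partial>M)"
    by (intro nn_integral_cong) (auto simp: indicator_def)
  also have "\<dots> = (\<integral>\<^sup>+w. emeasure (power_law nu) {v. R w t * v < run_inf (R w) t - b} \<partial>M)"
    by (intro nn_integral_cong) (subst nn_integral_indicator, auto)
  also have "\<dots> = (\<integral>\<^sup>+w. ennreal (R w t powr (-2*nu) * (max 0 (min (run_inf (R w) t) a - b)) powr (2*nu)) \<partial>M)"
  proof (rule nn_integral_cong_AE)
    show "AE w in M. emeasure (power_law nu) {v. R w t * v < run_inf (R w) t - b} = ennreal (R w t powr (-2*nu) * (max 0 (min (run_inf (R w) t) a - b)) powr (2*nu))"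
      using run_inf_in_Icc AE_pos[OF t]
    proof eventually_elim
      case (elim w)
      have *: "run_inf (R w) t \<le> a" "run_inf (R w) t \<le> R w t" using elim(1)[rule_format, OF t0] by auto
      show ?case
      proof (cases "run_inf (R w) t - b > 0")
        case True
        then show ?thesis using * b emeasure_power_law_scaled[OF nu elim(2) True]
          by (auto simp: min_absorb1 ennreal_mult mult.commute)
      next
        case False
        have "emeasure (power_law nu) {v. R w t * v < run_inf (R w) t - b} = emeasure (power_law nu) {}"
        proof (rule emeasure_eq_AE)
          show "AE v in power_law nu. v \<in> {v. R w t * v < run_inf (R w) t - b} \<longleftrightarrow> v \<in> {}"
            using AE_power_law[OF nu]
          proof eventually_elim
            case (elim v)
            then have "R w t * v > 0" using \<open>R w t > 0\<close> by simp
            then show ?case using False by auto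
          qed
        qed auto
        then show ?thesis using False * nu by (simp add: min_absorb1 max_absorb1)
      qed
    qed
  qed
  finally have "emeasure M {w \<in> space M. run_inf (R w) t - total_inf (R w) > b} = \<dots>" .
  moreover have "expectation (\<lambda>w. R w t powr (-2*nu) * (max 0 (min (run_inf (R w) t) a - b)) powr (2*nu))
     = enn2real (\<integral>\<^sup>+w. ennreal (R w t powr (-2*nu) * (max 0 (min (run_inf (R w) t) a - b)) powr (2*nu)) \<partial>M)"
    by (rule integral_eq_nn_integral) auto
  ultimately show ?thesis by (simp add: measure_def)
qed

lemma expectation_total_inf:
  assumes "continuous_on UNIV \<phi>"
  shows "((\<lambda>z. \<phi> z * (2 * nu * z powr (2*nu - 1))) has_integral a powr (2*nu) * expectation (\<lambda>w. \<phi> (total_inf (R w)))) {0..a}"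
proof -
  have [measurable]: "\<phi> \<in> borel_measurable borel" using assms by (rule borel_measurable_continuous_onI)
  note [measurable] = total_inf_measurable
  have "expectation (\<lambda>w. \<phi> (total_inf (R w))) = integral\<^sup>L (distr M borel (\<lambda>w. total_inf (R w))) \<phi>"
    by (rule integral_distr[symmetric]) measurable
  also have "\<dots> = (\<integral>v. \<phi> (a * v) \<partial>power_law nu)"
    unfolding distr_total_inf by (rule integral_distr) measurable
  finally show ?thesis using integral_power_law[OF nu a assms] by simp
qed

lemma gap_limit:
  assumes b: "0 \<le> b" "b \<le> a"
  shows "((\<lambda>t. t powr nu * measure M {w \<in> space M. run_inf (R w) t - total_inf (R w) > b})
    \<longlongrightarrow> (2 * nu / (2 powr nu * a powr (2 * nu) * Gamma (nu + 1))) *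
                 integral {b..a} (\<lambda>z. z powr (2 * nu - 1) * (z - b) powr (2 * nu))) at_top"
proof -
  define \<phi> where "\<phi> y = (max 0 (min y a - b)) powr (2*nu)" for y
  have cont: "continuous_on UNIV \<phi>"
    unfolding \<phi>_def using nu by (intro continuous_on_powr') (auto intro!: continuous_intros)
  have bound: "\<bar>\<phi> y\<bar> \<le> a powr (2*nu)" for y
    unfolding \<phi>_def using nu a b by (auto intro!: powr_mono2)
  let ?I = "integral {b..a} (\<lambda>z. z powr (2 * nu - 1) * (z - b) powr (2 * nu))"
  let ?E = "expectation (\<lambda>w. \<phi> (total_inf (R w)))"
  have "((\<lambda>z. if z \<in> {b..a} then 2 * nu * (z powr (2*nu - 1) * (z - b) powr (2*nu)) else 0) has_integral a powr (2*nu) * ?E) {0..a}"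
  proof (rule has_integral_eq[OF _ expectation_total_inf[OF cont]])
    fix z assume "z \<in> {0..a}"
    then show "\<phi> z * (2 * nu * z powr (2*nu - 1)) = (if z \<in> {b..a} then 2 * nu * (z powr (2*nu - 1) * (z - b) powr (2*nu)) else 0)"
      unfolding \<phi>_def using nu by (auto simp: min_absorb1 max_absorb1 max_absorb2)
  qed
  then have "((\<lambda>z. 2 * nu * (z powr (2*nu - 1) * (z - b) powr (2*nu))) has_integral a powr (2*nu) * ?E) {b..a}"
    using b by (subst (asm) has_integral_restrict) auto
  then have "integral {b..a} (\<lambda>z. 2 * nu * (z powr (2*nu - 1) * (z - b) powr (2*nu))) = a powr (2*nu) * ?E"
    by (rule integral_unique)
  then have "2 * nu * ?I = a powr (2*nu) * ?E" by simp
  then have E: "?E = 2 * nu * ?I / a powr (2*nu)" using a by simp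
  have "((\<lambda>t. t powr nu * expectation (\<lambda>w. R w t powr (-2*nu) * \<phi> (run_inf (R w) t))) \<longlongrightarrow> 1 / (2 powr nu * Gamma (nu+1)) * ?E) at_top"
    by (rule harmonic_limit[OF cont bound])
  moreover have "\<forall>\<^sub>F t in at_top. t powr nu * expectation (\<lambda>w. R w t powr (-2*nu) * \<phi> (run_inf (R w) t))
      = t powr nu * measure M {w \<in> space M. run_inf (R w) t - total_inf (R w) > b}"
    using eventually_gt_at_top[of 0] by eventually_elim (simp add: prob_gap_eq[OF _ b(1)] \<phi>_def)
  ultimately have "((\<lambda>t. t powr nu * measure M {w \<in> space M. run_inf (R w) t - total_inf (R w) > b}) \<longlongrightarrow> 1 / (2 powr nu * Gamma (nu+1)) * ?E) at_top"
    by (rule Lim_transform_eventually)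
  moreover have "1 / (2 powr nu * Gamma (nu+1)) * ?E = (2 * nu / (2 powr nu * a powr (2 * nu) * Gamma (nu + 1))) * ?I"
    unfolding E by simp
  ultimately show ?thesis by simp
qed

text \<open>The integrand vanishes where \<open>x * v\<close> exceeds \<open>i\<close>, so the
  integral over \<open>{0..x}\<close> only sees \<open>{0..i}\<close>. Hence \<open>x\<close> enters
  solely through \<open>x powr (-2*nu)\<close>, which brings part (ii) into the scope of
  \<open>harmonic_limit\<close>.\<close>

lemma power_law_truncated:
  assumes g: "continuous_on UNIV g" and x: "x > 0" and i: "0 \<le> i" "i \<le> x"
  shows "(\<integral>v. g (min i (x * v)) - g i \<partial>power_law nu) = x powr (-2*nu) * (weight_prim nu g i - g i * i powr (2*nu))"
proof -
  let ?w = "\<lambda>z. 2 * nu * z powr (2*nu - 1)"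
  let ?f = "\<lambda>z. g (min i z) - g i"
  have "continuous_on UNIV (\<lambda>z. g (min i z))"
    by (rule continuous_on_compose2[OF g]) (auto intro!: continuous_intros)
  then have "continuous_on UNIV ?f" by (intro continuous_on_diff continuous_on_const)
  then have 1: "((\<lambda>z. ?f z * ?w z) has_integral x powr (2*nu) * (\<integral>v. ?f (x * v) \<partial>power_law nu)) {0..x}"
    by (rule integral_power_law[OF nu x])
  have "((\<lambda>z. g z * ?w z - g i * ?w z) has_integral weight_prim nu g i - g i * i powr (2*nu)) {0..i}"
    unfolding weight_prim_def using i nu g
    by (intro has_integral_diff integrable_integral integrable_on_power_weight has_integral_mult_right powr_has_integral) auto
  then have "((\<lambda>z. if z \<in> {0..i} then g z * ?w z - g i * ?w z else 0) has_integral weight_prim nu g i - g i * i powr (2*nu)) {0..x}"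
    using i by (subst has_integral_restrict) auto
  then have 2: "((\<lambda>z. ?f z * ?w z) has_integral weight_prim nu g i - g i * i powr (2*nu)) {0..x}"
    by (rule has_integral_eq[rotated]) (auto simp: min_absorb1 min_absorb2 left_diff_distrib)
  have "x powr (2*nu) * (\<integral>v. ?f (x * v) \<partial>power_law nu) = weight_prim nu g i - g i * i powr (2*nu)"
    using 1 2 by (rule has_integral_unique)
  then have "x powr (-2*nu) * (x powr (2*nu) * (\<integral>v. ?f (x * v) \<partial>power_law nu)) = x powr (-2*nu) * (weight_prim nu g i - g i * i powr (2*nu))"
    by simp
  moreover have "x powr (-2*nu) * x powr (2*nu) = 1" using x by (simp add: powr_minus)
  ultimately show ?thesis by (simp only: mult.assoc[symmetric] mult_1_left)
qed

text \<open>Clamping to \<open>{0..a}\<close>, where the running infimum lies almost surely, makes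
  the function bounded and continuous on the whole line.\<close>

definition gap_fun :: "(real \<Rightarrow> real) \<Rightarrow> real \<Rightarrow> real" where
  "gap_fun g y = (let c = max 0 (min y a) in weight_prim nu g c - g c * c powr (2*nu))"

lemma gap_fun_eq: "0 \<le> y \<Longrightarrow> y \<le> a \<Longrightarrow> gap_fun g y = weight_prim nu g y - g y * y powr (2*nu)"
  by (simp add: gap_fun_def)

lemma gap_fun_continuous:
  assumes g: "continuous_on UNIV g"
  shows "continuous_on UNIV (gap_fun g)"
proof -
  have "continuous_on {0..a} (\<lambda>y. weight_prim nu g y - g y * y powr (2*nu))"
    using nu a by (intro continuous_on_diff continuous_on_mult weight_prim_continuous continuous_on_powr' continuous_on_subset[OF g] g)
      (auto intro!: continuous_intros)
  then show ?thesis unfolding gap_fun_def Let_def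
    by (rule continuous_on_compose2) (use a in \<open>auto intro!: continuous_intros\<close>)
qed

lemma gap_fun_bounded:
  assumes g: "continuous_on UNIV g"
  obtains K where "\<And>y. \<bar>gap_fun g y\<bar> \<le> K"
proof -
  have "compact (gap_fun g ` {0..a})"
    by (intro compact_continuous_image continuous_on_subset[OF gap_fun_continuous[OF g]]) auto
  then obtain K where K: "\<forall>x\<in>gap_fun g ` {0..a}. norm x \<le> K"
    using compact_imp_bounded[of "gap_fun g ` {0..a}"] unfolding bounded_iff by blast
  have "\<bar>gap_fun g y\<bar> \<le> K" for y
  proof -
    have "gap_fun g y = gap_fun g (max 0 (min y a))" using a by (simp add: gap_fun_def)
    then show ?thesis using K a by auto
  qed
  then show ?thesis by (rule that)
qed

text \<open>Write the total infimum as the minimum of past and future infimum, replace the latter by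
  \<open>R_t V\<close> through the joint law, and integrate out \<open>V\<close> first.\<close>

lemma expectation_gap_eq:
  assumes t: "t > 0" and g: "continuous_on UNIV g" and K: "\<And>x. \<bar>g x\<bar> \<le> K"
  shows "expectation (\<lambda>w. g (total_inf (R w))) - expectation (\<lambda>w. g (run_inf (R w) t)) =
    expectation (\<lambda>w. R w t powr (-2*nu) * gap_fun g (run_inf (R w) t))"
proof -
  have t0: "t \<ge> 0" using t by simp
  have [measurable]: "g \<in> borel_measurable borel" using g by (rule borel_measurable_continuous_onI)
  interpret D: prob_space "power_law nu" using nu by (rule prob_space_power_law)
  interpret P: pair_prob_space M "power_law nu" ..
  note [measurable] = R_measurable[OF t0] run_inf_measurable[OF t] total_inf_measurable future_inf_measurable[OF t0]
  let ?F = "\<lambda>p :: real \<times> real. g (min (fst p) (snd p)) - g (fst p)"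
  have FK: "\<bar>?F p\<bar> \<le> 2 * K" for p using K[of "min (fst p) (snd p)"] K[of "fst p"] by linarith
  have "expectation (\<lambda>w. g (total_inf (R w))) - expectation (\<lambda>w. g (run_inf (R w) t)) =
    expectation (\<lambda>w. g (total_inf (R w)) - g (run_inf (R w) t))"
    using K by (intro Bochner_Integration.integral_diff[symmetric] integrable_const_bound[of _ K]) auto
  also have "\<dots> = expectation (\<lambda>w. ?F (run_inf (R w) t, future_inf w t))"
  proof (rule integral_cong_AE)
    show "AE w in M. g (total_inf (R w)) - g (run_inf (R w) t) = ?F (run_inf (R w) t, future_inf w t)"
      using run_inf_in_Icc
    proof eventually_elim
      case (elim w)
      have "total_inf (R w) = min (run_inf (R w) t) (future_inf w t)" using elim[rule_format, OF t0] by simp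
      then show ?case by simp
    qed
  qed measurable
  also have "\<dots> = integral\<^sup>L (distr M (borel \<Otimes>\<^sub>M borel) (\<lambda>w. (run_inf (R w) t, future_inf w t))) ?F"
    by (rule integral_distr[symmetric]) measurable
  also have "\<dots> = (\<integral>x. ?F (case x of (w, v) \<Rightarrow> (run_inf (R w) t, R w t * v)) \<partial>(M \<Otimes>\<^sub>M power_law nu))"
    unfolding distr_run_inf_future_inf[OF t] by (rule integral_distr) measurable
  also have "\<dots> = expectation (\<lambda>w. \<integral>v. ?F (run_inf (R w) t, R w t * v) \<partial>power_law nu)"
  proof -
    have "integrable (M \<Otimes>\<^sub>M power_law nu) (\<lambda>x. ?F (case x of (w, v) \<Rightarrow> (run_inf (R w) t, R w t * v)))"
      using FK by (intro P.P.integrable_const_bound[of _ "2*K"]) auto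
    from P.integral_fst'[OF this] show ?thesis by simp
  qed
  also have "\<dots> = expectation (\<lambda>w. R w t powr (-2*nu) * gap_fun g (run_inf (R w) t))"
  proof (rule integral_cong_AE)
    have [measurable]: "gap_fun g \<in> borel_measurable borel"
      using gap_fun_continuous[OF g] by (rule borel_measurable_continuous_onI)
    show "(\<lambda>w. R w t powr (-2*nu) * gap_fun g (run_inf (R w) t)) \<in> borel_measurable M" by measurable
    show "(\<lambda>w. \<integral>v. ?F (run_inf (R w) t, R w t * v) \<partial>power_law nu) \<in> borel_measurable M"
      by (rule D.borel_measurable_lebesgue_integral) measurable
    show "AE w in M. (\<integral>v. ?F (run_inf (R w) t, R w t * v) \<partial>power_law nu) = R w t powr (-2*nu) * gap_fun g (run_inf (R w) t)"
      using run_inf_in_Icc AE_pos[OF t]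
    proof eventually_elim
      case (elim w)
      have *: "0 \<le> run_inf (R w) t" "run_inf (R w) t \<le> a" "run_inf (R w) t \<le> R w t" using elim(1)[rule_format, OF t0] by auto
      show ?case using power_law_truncated[OF g elim(2) *(1,3)] * by (simp add: gap_fun_eq)
    qed
  qed
  finally show ?thesis .
qed

lemma expectation_gap_limit:
  fixes g :: "real \<Rightarrow> real"
  assumes g: "continuous_on UNIV g"
  shows "((\<lambda>t. t powr nu * (expectation (\<lambda>w. g (total_inf (R w))) - expectation (\<lambda>w. g (run_inf (R w) t))))
    \<longlongrightarrow> (2 * nu / (2 powr nu * a powr (2 * nu) * Gamma (nu + 1))) *
       integral {0..a} (\<lambda>z. (a powr (2 * nu) - 2 * z powr (2 * nu)) * z powr (2 * nu - 1) * g z)) at_top"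
proof -
  let ?cl = "\<lambda>y. max 0 (min y a)"
  \<comment> \<open>\<open>g\<close> may be unbounded; the clamped version is bounded and has the
    same expectations, because all infima lie in \<open>{0..a}\<close> almost surely.\<close>
  define g' where "g' y = g (?cl y)" for y
  have g': "continuous_on UNIV g'"
    unfolding g'_def by (rule continuous_on_compose2[OF g]) (auto intro!: continuous_intros)
  have eq: "g' z = g z" if "0 \<le> z" "z \<le> a" for z using that by (simp add: g'_def)
  have "compact (g ` {0..a})" by (intro compact_continuous_image continuous_on_subset[OF g]) auto
  then obtain K where "\<forall>x\<in>g ` {0..a}. norm x \<le> K"
    using compact_imp_bounded[of "g ` {0..a}"] unfolding bounded_iff by blast
  then have K: "\<bar>g' y\<bar> \<le> K" for y unfolding g'_def using a by auto
  obtain L where L: "\<And>y. \<bar>gap_fun g' y\<bar> \<le> L" using gap_fun_bounded[OF g'] by blast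
  have [measurable]: "g \<in> borel_measurable borel" "g' \<in> borel_measurable borel"
    using g g' by (auto intro: borel_measurable_continuous_onI)
  note [measurable] = run_inf_measurable_all total_inf_measurable
  let ?I = "integral {0..a} (\<lambda>z. (a powr (2 * nu) - 2 * z powr (2 * nu)) * z powr (2 * nu - 1) * g z)"
  let ?E = "expectation (\<lambda>w. gap_fun g' (total_inf (R w)))"
  have "((\<lambda>z. gap_fun g' z * (2 * nu * z powr (2*nu - 1))) has_integral a powr (2*nu) * ?E) {0..a}"
    by (rule expectation_total_inf[OF gap_fun_continuous[OF g']])
  moreover have "((\<lambda>z. gap_fun g' z * (2 * nu * z powr (2*nu - 1))) has_integral
     2 * nu * integral {0..a} (\<lambda>z. (a powr (2*nu) - 2 * z powr (2*nu)) * z powr (2*nu - 1) * g' z)) {0..a}"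
    by (rule has_integral_eq[OF _ weight_prim_by_parts[OF nu a g']]) (simp add: gap_fun_eq)
  ultimately have "a powr (2*nu) * ?E = 2 * nu * integral {0..a} (\<lambda>z. (a powr (2*nu) - 2 * z powr (2*nu)) * z powr (2*nu - 1) * g' z)"
    by (rule has_integral_unique)
  also have "integral {0..a} (\<lambda>z. (a powr (2*nu) - 2 * z powr (2*nu)) * z powr (2*nu - 1) * g' z) = ?I"
    by (rule integral_cong) (simp add: eq)
  finally have E: "?E = 2 * nu * ?I / a powr (2*nu)" using a by (simp add: field_simps)
  have "((\<lambda>t. t powr nu * expectation (\<lambda>w. R w t powr (-2*nu) * gap_fun g' (run_inf (R w) t))) \<longlongrightarrow> 1 / (2 powr nu * Gamma (nu+1)) * ?E) at_top"
    by (rule harmonic_limit[OF gap_fun_continuous[OF g'] L])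
  moreover have "\<forall>\<^sub>F t in at_top. t powr nu * expectation (\<lambda>w. R w t powr (-2*nu) * gap_fun g' (run_inf (R w) t))
      = t powr nu * (expectation (\<lambda>w. g (total_inf (R w))) - expectation (\<lambda>w. g (run_inf (R w) t)))"
    using eventually_gt_at_top[of 0]
  proof eventually_elim
    case (elim t)
    have "expectation (\<lambda>w. g (total_inf (R w))) = expectation (\<lambda>w. g' (total_inf (R w)))"
    proof (rule integral_cong_AE)
      show "AE w in M. g (total_inf (R w)) = g' (total_inf (R w))"
        using run_inf_in_Icc
      proof eventually_elim
        case (elim w)
        show ?case using elim[rule_format, of 0] by (intro eq[symmetric]) auto
      qed
    qed measurable
    moreover have "expectation (\<lambda>w. g (run_inf (R w) t)) = expectation (\<lambda>w. g' (run_inf (R w) t))"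
    proof (rule integral_cong_AE)
      show "AE w in M. g (run_inf (R w) t) = g' (run_inf (R w) t)"
        using run_inf_in_Icc
      proof eventually_elim
        case (elim w)
        show ?case using elim[rule_format, of t] \<open>0 < t\<close> by (intro eq[symmetric]) auto
      qed
    qed measurable
    ultimately show ?case using expectation_gap_eq[OF elim g' K] by simp
  qed
  ultimately have "((\<lambda>t. t powr nu * (expectation (\<lambda>w. g (total_inf (R w))) - expectation (\<lambda>w. g (run_inf (R w) t)))) \<longlongrightarrow> 1 / (2 powr nu * Gamma (nu+1)) * ?E) at_top"
    by (rule Lim_transform_eventually)
  moreover have "1 / (2 powr nu * Gamma (nu+1)) * ?E = (2 * nu / (2 powr nu * a powr (2 * nu) * Gamma (nu + 1))) * ?I"
    unfolding E by simp
  ultimately show ?thesis by simp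
qed

section \<open>The time at which the infimum is attained\<close>

lemma closed_argmin: "w \<in> space M \<Longrightarrow> closed {t. 0 \<le> t \<and> R w t = c}"
proof -
  assume "w \<in> space M"
  then have "closed ({0..} \<inter> R w -` {c})" by (intro continuous_closed_preimage R_cont) auto
  moreover have "{0..} \<inter> R w -` {c} = {t. 0 \<le> t \<and> R w t = c}" by auto
  ultimately show ?thesis by simp
qed

text \<open>The minimising times form a closed set, so their infimum is itself a minimising time
  once there is one; otherwise \<open>argmin_time\<close> would be the junk value
  \<open>Inf {}\<close>.\<close>

lemma argmin_time_gt_iff:
  assumes w: "w \<in> space M" and ne: "\<exists>u\<ge>0. R w u = total_inf (R w)"
  shows "argmin_time (R w) > t \<longleftrightarrow> \<not> (\<exists>u\<in>{0..t}. R w u = total_inf (R w))"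
proof -
  let ?S = "{t. 0 \<le> t \<and> R w t = total_inf (R w)}"
  have bdd: "bdd_below ?S" by (rule bdd_belowI[of _ 0]) auto
  have "Inf ?S \<in> ?S" using ne bdd closed_argmin[OF w] by (intro closed_contains_Inf) auto
  moreover have "Inf ?S \<le> u" if "u \<in> ?S" for u using that bdd by (rule cInf_lower)
  ultimately show ?thesis unfolding argmin_time_def by force
qed

text \<open>By compactness the infimum is attained up to \<open>T\<close> iff the distance of the
  path to it is not bounded away from 0 on \<open>{0..T}\<close>. Each lower bound on this
  continuous distance is a grid condition by \<open>all_ge_iff_grid\<close>.\<close>

lemma attained_measurable:
  assumes T: "T > 0"
  shows "{w \<in> space M. \<exists>u\<in>{0..T}. R w u = total_inf (R w)} \<in> sets M"
proof -
  note [measurable] = total_inf_measurable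
  have [measurable]: "(\<lambda>w. R w (real k * (T / 2^m))) \<in> borel_measurable M" for k m
    using T by (intro R_measurable) auto
  have "(\<exists>u\<in>{0..T}. R w u = total_inf (R w)) \<longleftrightarrow>
     \<not> (\<exists>n::nat. \<forall>m. \<forall>k\<in>{1..2^m}. 1 / (real n + 1) \<le> \<bar>R w (real k * (T / 2^m)) - total_inf (R w)\<bar>)" if w: "w \<in> space M" for w
  proof -
    let ?r = "\<lambda>u. \<bar>R w u - total_inf (R w)\<bar>"
    have cont: "continuous_on {0..} ?r" using R_cont[OF w] by (intro continuous_intros)
    have "(\<exists>u\<in>{0..T}. R w u = total_inf (R w)) \<longleftrightarrow> \<not> (\<exists>n::nat. \<forall>u\<in>{0..T}. 1 / (real n + 1) \<le> ?r u)"
    proof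
      assume "\<exists>u\<in>{0..T}. R w u = total_inf (R w)"
      then obtain u where u: "u \<in> {0..T}" "?r u = 0" by auto
      then show "\<not> (\<exists>n::nat. \<forall>u\<in>{0..T}. 1 / (real n + 1) \<le> ?r u)"
        by (metis add_nonneg_pos divide_pos_pos less_numeral_extra(1) not_less of_nat_0_le_iff)
    next
      assume *: "\<not> (\<exists>n::nat. \<forall>u\<in>{0..T}. 1 / (real n + 1) \<le> ?r u)"
      obtain u where u: "u \<in> {0..T}" "\<And>v. v \<in> {0..T} \<Longrightarrow> ?r u \<le> ?r v"
        using continuous_attains_inf[of "{0..T}" ?r] continuous_on_subset[OF cont] T by auto
      have "?r u = 0"
      proof (rule ccontr)
        assume "?r u \<noteq> 0"
        then have "?r u > 0" by simp
        then obtain n :: nat where "1 / (real n + 1) < ?r u"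
          by (metis nat_approx_posE of_nat_Suc add.commute)
        then have "\<forall>v\<in>{0..T}. 1 / (real n + 1) \<le> ?r v" using u(2) by force
        then show False using * by blast
      qed
      then show "\<exists>u\<in>{0..T}. R w u = total_inf (R w)" using u(1) by auto
    qed
    then show ?thesis using all_ge_iff_grid[OF cont T] by simp
  qed
  then have "{w \<in> space M. \<exists>u\<in>{0..T}. R w u = total_inf (R w)} =
    {w \<in> space M. \<not> (\<exists>n::nat. \<forall>m. \<forall>k\<in>{1..2^m}. 1 / (real n + 1) \<le> \<bar>R w (real k * (T / 2^m)) - total_inf (R w)\<bar>)}" by blast
  also have "\<dots> \<in> sets M" by measurable
  finally show ?thesis .
qed

lemma argmin_time_measurable:
  assumes t: "t > 0"
  shows "{w \<in> space M. argmin_time (R w) > t} \<in> sets M"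
proof -
  note [measurable] = attained_measurable[OF t]
  have [measurable]: "{w \<in> space M. \<exists>u\<in>{0..real n + 1}. R w u = total_inf (R w)} \<in> sets M" for n :: nat
    by (rule attained_measurable) simp
  have ex: "(\<exists>u\<ge>0. R w u = total_inf (R w)) \<longleftrightarrow> (\<exists>n::nat. \<exists>u\<in>{0..real n + 1}. R w u = total_inf (R w))" for w
  proof
    assume "\<exists>u\<ge>0. R w u = total_inf (R w)"
    then obtain u where u: "u \<ge> 0" "R w u = total_inf (R w)" by blast
    obtain n :: nat where "u \<le> real n" using real_arch_simple by blast
    then show "\<exists>n::nat. \<exists>u\<in>{0..real n + 1}. R w u = total_inf (R w)" using u by (intro exI[of _ n] bexI[of _ u]) auto
  qed auto
  \<comment> \<open>Where the infimum is never attained, \<open>argmin_time\<close> is the fixed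
    real \<open>Inf {}\<close>, so that part contributes all of its paths or none.\<close>
  have "{w \<in> space M. argmin_time (R w) > t} =
    {w \<in> space M. \<exists>n::nat. \<exists>u\<in>{0..real n + 1}. R w u = total_inf (R w)} \<inter> {w \<in> space M. \<not> (\<exists>u\<in>{0..t}. R w u = total_inf (R w))}
    \<union> {w \<in> space M. \<not> (\<exists>n::nat. \<exists>u\<in>{0..real n + 1}. R w u = total_inf (R w))} \<inter> (if Inf ({} :: real set) > t then space M else {})"
    (is "?A = ?B")
  proof (rule set_eqI)
    fix w
    show "w \<in> ?A \<longleftrightarrow> w \<in> ?B"
    proof (cases "\<exists>u\<ge>0. R w u = total_inf (R w)")
      case True
      then show ?thesis using argmin_time_gt_iff[OF _ True, of t] ex[of w] by auto
    next
      case False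
      then have "argmin_time (R w) = Inf {}" unfolding argmin_time_def by (intro arg_cong[where f=Inf]) auto
      then show ?thesis using False ex[of w] by auto
    qed
  qed
  also have "\<dots> \<in> sets M" by measurable
  finally show ?thesis .
qed

lemma run_inf_attained:
  assumes "w \<in> space M" "t \<ge> 0"
  obtains u where "u \<in> {0..t}" "R w u = run_inf (R w) t"
proof -
  obtain u where u: "u \<in> {0..t}" "\<And>v. v \<in> {0..t} \<Longrightarrow> R w u \<le> R w v"
    using continuous_attains_inf[of "{0..t}" "R w"] continuous_on_subset[OF R_cont[OF assms(1)]] assms(2) by auto
  then have "R w u = run_inf (R w) t"
    unfolding run_inf_def by (intro cInf_eq_minimum[symmetric]) auto
  then show ?thesis using u that by blast
qed

text \<open>\<open>gap_limit\<close> at \<open>b = 0\<close> forces the probability of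
  \<open>I_t > I_\<infinity>\<close> to 0. So almost surely some \<open>I_n\<close> already equals
  the total infimum, and a continuous path attains \<open>I_n\<close> on
  \<open>{0..n}\<close>.\<close>

lemma AE_attained: "AE w in M. \<exists>u\<ge>0. R w u = total_inf (R w)"
proof -
  note [measurable] = run_inf_measurable_all total_inf_measurable
  let ?N = "{w \<in> space M. \<forall>n::nat. run_inf (R w) (real n) - total_inf (R w) > 0}"
  let ?p = "\<lambda>t. measure M {w \<in> space M. run_inf (R w) t - total_inf (R w) > 0}"
  obtain l where "((\<lambda>t. t powr nu * ?p t) \<longlongrightarrow> l) at_top" using gap_limit[of 0] a by auto
  moreover have "((\<lambda>t::real. t powr (-nu)) \<longlongrightarrow> 0) at_top" using nu by real_asymp
  ultimately have "((\<lambda>t. t powr (-nu) * (t powr nu * ?p t)) \<longlongrightarrow> 0 * l) at_top" by (intro tendsto_mult)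
  then have "(?p \<longlongrightarrow> 0 * l) at_top"
  proof (rule Lim_transform_eventually)
    show "\<forall>\<^sub>F t in at_top. t powr (-nu) * (t powr nu * ?p t) = ?p t"
      using eventually_gt_at_top[of 0] by eventually_elim (simp add: powr_minus)
  qed
  then have "(\<lambda>n. ?p (real n)) \<longlonglongrightarrow> 0"
    using filterlim_compose[OF _ filterlim_real_sequentially, of ?p "nhds (0 * l)"] by simp
  moreover have "measure M ?N \<le> ?p (real n)" for n by (intro finite_measure_mono) auto
  ultimately have "measure M ?N \<le> 0" by (intro LIMSEQ_le_const) auto
  then have "measure M ?N = 0" using measure_nonneg[of M ?N] by linarith
  then have "emeasure M ?N = 0" by (simp only: emeasure_eq_measure ennreal_0)
  then have "AE w in M. \<not> (\<forall>n::nat. run_inf (R w) (real n) - total_inf (R w) > 0)"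
    by (intro AE_I[of _ _ ?N]) auto
  then show ?thesis using run_inf_in_Icc AE_space
  proof eventually_elim
    case (elim w)
    obtain n :: nat where n: "run_inf (R w) (real n) \<le> total_inf (R w)" using elim(1) by (auto simp: not_less)
    obtain u where u: "u \<in> {0..real n}" "R w u = run_inf (R w) (real n)"
      using run_inf_attained[OF elim(3), of "real n"] by auto
    have "total_inf (R w) \<le> run_inf (R w) (real n)" using elim(2)[rule_format, of "real n"] by simp
    then show ?case using n u by (intro exI[of _ u]) auto
  qed
qed

text \<open>When the infimum is attained, the minimising time exceeds \<open>t\<close> exactly if
  the running infimum is still above the total one, so this is \<open>gap_limit\<close> at
  \<open>b = 0\<close>.\<close>

lemma argmin_limit:
  "((\<lambda>t. t powr nu * measure M {w \<in> space M. argmin_time (R w) > t})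
     \<longlongrightarrow> a powr (2 * nu) / (2 powr (nu + 1) * Gamma (nu + 1))) at_top"
proof -
  note [measurable] = run_inf_measurable_all total_inf_measurable
  let ?I = "integral {0..a} (\<lambda>z. z powr (2 * nu - 1) * (z - 0) powr (2 * nu))"
  \<comment> \<open>At \<open>b = 0\<close> the integrand is \<open>z powr (4*nu - 1)\<close>, hence
    \<open>powr_has_integral\<close> with \<open>2*nu\<close> in place of \<open>nu\<close>.\<close>
  have "((\<lambda>v. 2 * (2*nu) * v powr (2*(2*nu) - 1)) has_integral a powr (2*(2*nu))) {0..a}"
    using nu a by (intro powr_has_integral) auto
  then have "((\<lambda>z. (4 * nu) * (z powr (2*nu - 1) * (z - 0) powr (2*nu))) has_integral a powr (2*(2*nu))) {0..a}"
  proof (rule has_integral_eq[rotated])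
    fix z assume "z \<in> {0..a}"
    then show "2 * (2*nu) * z powr (2*(2*nu) - 1) = (4 * nu) * (z powr (2*nu - 1) * (z - 0) powr (2*nu))"
      by (simp flip: powr_add)
  qed
  then have "integral {0..a} (\<lambda>z. (4 * nu) * (z powr (2*nu - 1) * (z - 0) powr (2*nu))) = a powr (2*(2*nu))"
    by (rule integral_unique)
  then have "(4 * nu) * ?I = a powr (2*nu + 2*nu)" by simp
  then have I: "?I = a powr (2*nu) * a powr (2*nu) / (4 * nu)" unfolding powr_add using nu by (simp add: field_simps)
  have val: "(2 * nu / (2 powr nu * a powr (2 * nu) * Gamma (nu + 1))) * ?I = a powr (2 * nu) / (2 powr (nu + 1) * Gamma (nu + 1))"
    unfolding I powr_add using nu a by simp
  have "((\<lambda>t. t powr nu * measure M {w \<in> space M. run_inf (R w) t - total_inf (R w) > 0})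
     \<longlongrightarrow> a powr (2 * nu) / (2 powr (nu + 1) * Gamma (nu + 1))) at_top"
    using gap_limit[of 0] a unfolding val by simp
  then show ?thesis
  proof (rule Lim_transform_eventually)
    show "\<forall>\<^sub>F t in at_top. t powr nu * measure M {w \<in> space M. run_inf (R w) t - total_inf (R w) > 0} = t powr nu * measure M {w \<in> space M. argmin_time (R w) > t}"
      using eventually_gt_at_top[of 0]
    proof eventually_elim
      case (elim t)
      have "measure M {w \<in> space M. run_inf (R w) t - total_inf (R w) > 0} = measure M {w \<in> space M. argmin_time (R w) > t}"
      proof (rule measure_eq_AE)
        show "AE w in M. w \<in> {w \<in> space M. run_inf (R w) t - total_inf (R w) > 0} \<longleftrightarrow> w \<in> {w \<in> space M. argmin_time (R w) > t}"
          using AE_attained run_inf_in_Icc AE_space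
        proof eventually_elim
          case (elim w)
          have ti: "total_inf (R w) \<le> run_inf (R w) t" using elim(2)[rule_format, of t] \<open>0 < t\<close> by simp
          obtain u where u: "u \<in> {0..t}" "R w u = run_inf (R w) t"
            using run_inf_attained[OF elim(3), of t] \<open>0 < t\<close> by auto
          have "run_inf (R w) t \<le> R w v" if "v \<in> {0..t}" for v
            using run_inf_ge_iff[OF elim(3), of t "run_inf (R w) t"] that \<open>0 < t\<close> by auto
          then have "(\<exists>v\<in>{0..t}. R w v = total_inf (R w)) \<longleftrightarrow> run_inf (R w) t = total_inf (R w)"
            using u ti by force
          then show ?case using argmin_time_gt_iff[OF elim(3,1), of t] ti elim(3) by auto
        qed
      qed (use argmin_time_measurable[OF elim] in auto)
      then show ?case by simp
    qed
  qed
qed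

end

theorem theorem2p2:
  fixes nu a :: real and M :: "'w measure" and R :: "'w \<Rightarrow> real \<Rightarrow> real"
  assumes "0 < nu" and "0 < a" and "bessel_process M R nu a"
  shows "(\<forall>b. 0 \<le> b \<and> b \<le> a \<longrightarrow>
           ((\<lambda>t. t powr nu * measure M {w \<in> space M. run_inf (R w) t - total_inf (R w) > b})
             \<longlongrightarrow> (2 * nu / (2 powr nu * a powr (2 * nu) * Gamma (nu + 1))) *
                 integral {b..a} (\<lambda>z. z powr (2 * nu - 1) * (z - b) powr (2 * nu))) at_top)
       \<and> ((\<lambda>t. t powr nu * measure M {w \<in> space M. argmin_time (R w) > t})
             \<longlongrightarrow> a powr (2 * nu) / (2 powr (nu + 1) * Gamma (nu + 1))) at_top
       \<and> (\<forall>g :: real \<Rightarrow> real. continuous_on UNIV g \<longrightarrow>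
           ((\<lambda>t. t powr nu * ((\<integral>w. g (total_inf (R w)) \<partial>M) - (\<integral>w. g (run_inf (R w) t) \<partial>M)))
             \<longlongrightarrow> (2 * nu / (2 powr nu * a powr (2 * nu) * Gamma (nu + 1))) *
                 integral {0..a} (\<lambda>z. (a powr (2 * nu) - 2 * z powr (2 * nu)) * z powr (2 * nu - 1) * g z)) at_top)"
proof -
  interpret bessel_path M R nu a
    using assms unfolding bessel_process_def bessel_path_def bessel_path_axioms_def by auto
  show ?thesis using gap_limit argmin_limit expectation_gap_limit by blast
qed

end
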